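(* Let $Q\in F_{A\cup X}$ be a quadratic word. If the equation $Q=1$ is solvable in the free group $F_A$, then there exists a solution $\alpha$ of $Q=1$ such that for every variable $x$ occurring in $Q$, $$ |x^\alpha| \le \begin{cases} N\, n(Q)\, c(Q) & \text{if } Q \text{ is orientable},\\ N\, n(Q)^2\, c(Q) & \text{if } Q \text{ is non-orientable}, \end{cases} $$ for some (absolute) constant $N$; one can take $N=40$ for orientable $Q$ and $N=150$ for non-orientable $Q$. If moreover $Q$ is standard orientable or semi-standard non-orientable, then (whenever $Q=1$ is solvable in $F_A$) there exists a solution $\alpha$ with the better bound, for every variable $x$ occurring in $Q$, $$ |x^\alpha| \le \begin{cases} N\, c(Q) & \text{if } Q \text{ is orientable},\\ N\, n(Q)\, c(Q) & \text{if } Q \text{ is non-orientable}, \end{cases} $$ with $N=8$ and $N=36$ respectively.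
   Context: $F_Y$ denotes the free group freely generated by a set $Y$. $A$ is the alphabet of constants and $X$ is a countable (infinite) set of variables, disjoint from $A$. A quadratic word is a (freely reduced) word $Q\in F_{A\cup X}$ such that every variable $x\in X$ occurring in $Q$ (as $x$ or $x^{-1}$) occurs precisely twice. It is orientable if every variable $x$ occurring in $Q$ occurs once as $x$ and once as $x^{-1}$, and non-orientable otherwise (some variable occurs twice with the same exponent). A solution of $Q=1$ in $F_A$ is a homomorphism $\alpha:F_{A\cup X}\to F_A$ which is the identity on $F_A$ and satisfies $Q^\alpha=1$; $x^\alpha$ denotes the image of $x$ and $|w|$ the length of the freely reduced word representing $w\in F_A$. $n(Q)$ is the number of variables occurring in $Q$, and $c(Q)$ is the total length of the coefficients occurring in $Q$ (the number of occurrences of letters of $A^{\pm1}$ in $Q$). $[a,b]=a^{-1}b^{-1}ab$. A standard orientable quadratic word is one of the form $[x_1,y_1]\cdots[x_g,y_g]$ $(g\ge 0)$ or $[x_1,y_1]\cdots[x_g,y_g]\,c_1 z_2^{-1}c_2z_2\cdots z_m^{-1}c_mz_m$ $(g\ge 0,\ m\ge 1)$. A semi-standard non-orientable quadratic word is one of the form $x_1^2\cdots x_k^2[x_{k+1},y_{k+1}]\cdots[x_n,y_n]$ or $x_1^2\cdots x_k^2[x_{k+1},y_{k+1}]\cdots[x_n,y_n]\,c_1z_2^{-1}c_2z_2\cdots z_m^{-1}c_mz_m$ with $k\ge1$, $m\ge 1$, where the commutator factors need not be present. Here $x_i,y_i,z_i$ are distinct variables and the coefficients $c_i\in F_A$ satisfy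 $c_i\ne1$. *)

theory Defs
  imports "HOL-Algebra.Group" "HOL-Library.Countable_Set"
begin

text \<open>
  Elements of a free group are freely reduced words, so equality of group elements is
  equality of lists and \<open>|w|\<close> is \<^const>\<open>length\<close>. The letter \<open>(y, True)\<close> stands for \<open>y\<close>
  and \<open>(y, False)\<close> for \<open>y\<inverse>\<close>.
\<close>

type_synonym 'g letter = "'g \<times> bool"
type_synonym 'g word = "'g letter list"

definition inv_letter :: "'g letter \<Rightarrow> 'g letter" where
  "inv_letter l = (fst l, \<not> snd l)"

definition inv_word :: "'g word \<Rightarrow> 'g word" where
  "inv_word w = rev (map inv_letter w)"

fun freely_reduced :: "'g word \<Rightarrow> bool" where
  "freely_reduced (k # l # w) \<longleftrightarrow> l \<noteq> inv_letter k \<and> freely_reduced (l # w)"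
| "freely_reduced _ \<longleftrightarrow> True"

fun cancel_cons :: "'g letter \<Rightarrow> 'g word \<Rightarrow> 'g word" where
  "cancel_cons k (l # w) = (if l = inv_letter k then w else k # l # w)"
| "cancel_cons k [] = [k]"

definition free_reduction :: "'g word \<Rightarrow> 'g word" where
  "free_reduction w = foldr cancel_cons w []"

definition free_group :: "'g set \<Rightarrow> 'g word monoid" where
  "free_group Y =
    \<lparr>carrier = {w. freely_reduced w \<and> fst ` set w \<subseteq> Y},
     monoid.mult = (\<lambda>u v. free_reduction (u @ v)),
     one = []\<rparr>"

definition solution :: "'g set \<Rightarrow> 'g set \<Rightarrow> 'g word \<Rightarrow> ('g word \<Rightarrow> 'g word) \<Rightarrow> bool" where
  "solution A X Q \<alpha> \<longleftrightarrow>
     \<alpha> \<in> hom (free_group (A \<union> X)) (free_group A) \<and>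
     (\<forall>w \<in> carrier (free_group A). \<alpha> w = w) \<and>
     \<alpha> Q = \<one>\<^bsub>free_group A\<^esub>"

definition vars :: "'g set \<Rightarrow> 'g word \<Rightarrow> 'g set" where
  "vars X Q = {x \<in> X. x \<in> fst ` set Q}"

definition num_vars :: "'g set \<Rightarrow> 'g word \<Rightarrow> nat" where
  "num_vars X Q = card (vars X Q)"

definition coeff_length :: "'g set \<Rightarrow> 'g word \<Rightarrow> nat" where
  "coeff_length A Q = length (filter (\<lambda>l. fst l \<in> A) Q)"

definition quadratic_word :: "'g set \<Rightarrow> 'g set \<Rightarrow> 'g word \<Rightarrow> bool" where
  "quadratic_word A X Q \<longleftrightarrow>
     Q \<in> carrier (free_group (A \<union> X)) \<and>
     (\<forall>x \<in> vars X Q. length (filter (\<lambda>l. fst l = x) Q) = 2)"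

definition orientable :: "'g set \<Rightarrow> 'g word \<Rightarrow> bool" where
  "orientable X Q \<longleftrightarrow>
     (\<forall>x \<in> vars X Q. count_list Q (x, True) = 1 \<and> count_list Q (x, False) = 1)"

definition square_word :: "'g \<Rightarrow> 'g word" where
  "square_word x = [(x, True), (x, True)]"

definition comm_word :: "'g \<Rightarrow> 'g \<Rightarrow> 'g word" where
  "comm_word x y = [(x, False), (y, False), (x, True), (y, True)]"

definition conj_word :: "'g \<Rightarrow> 'g word \<Rightarrow> 'g word" where
  "conj_word z c = (z, False) # c @ [(z, True)]"

text \<open>
  The optional tail \<open>c\<^sub>1 z\<^sub>2\<inverse> c\<^sub>2 z\<^sub>2 \<dots> z\<^sub>m\<inverse> c\<^sub>m z\<^sub>m\<close>, with \<open>m = 0\<close> encoding its absence.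
  The index of \<open>z\<close> starts at 2. Under the side conditions imposed below all
  concatenations in this and the following definitions are already freely reduced, so they
  coincide with the products in the free group.
\<close>

definition coeff_tail :: "nat \<Rightarrow> (nat \<Rightarrow> 'g word) \<Rightarrow> (nat \<Rightarrow> 'g) \<Rightarrow> 'g word" where
  "coeff_tail m c z =
     (if m = 0 then [] else c 1 @ concat (map (\<lambda>i. conj_word (z i) (c i)) [2..<Suc m]))"

definition standard_orientable :: "'g set \<Rightarrow> 'g set \<Rightarrow> 'g word \<Rightarrow> bool" where
  "standard_orientable A X Q \<longleftrightarrow>
     (\<exists>g m x y z c.
        distinct (map x [1..<Suc g] @ map y [1..<Suc g] @ map z [2..<Suc m]) \<and>
        set (map x [1..<Suc g] @ map y [1..<Suc g] @ map z [2..<Suc m]) \<subseteq> X \<and>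
        (\<forall>i \<in> {1..m}. c i \<in> carrier (free_group A) \<and> c i \<noteq> \<one>\<^bsub>free_group A\<^esub>) \<and>
        Q = concat (map (\<lambda>i. comm_word (x i) (y i)) [1..<Suc g]) @ coeff_tail m c z)"

definition semistandard_nonorientable :: "'g set \<Rightarrow> 'g set \<Rightarrow> 'g word \<Rightarrow> bool" where
  "semistandard_nonorientable A X Q \<longleftrightarrow>
     (\<exists>k n m x y z c.
        1 \<le> k \<and> k \<le> n \<and>
        distinct (map x [1..<Suc n] @ map y [Suc k..<Suc n] @ map z [2..<Suc m]) \<and>
        set (map x [1..<Suc n] @ map y [Suc k..<Suc n] @ map z [2..<Suc m]) \<subseteq> X \<and>
        (\<forall>i \<in> {1..m}. c i \<in> carrier (free_group A) \<and> c i \<noteq> \<one>\<^bsub>free_group A\<^esub>) \<and>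
        Q = concat (map (\<lambda>i. square_word (x i)) [1..<Suc k]) @
            concat (map (\<lambda>i. comm_word (x i) (y i)) [Suc k..<Suc n]) @ coeff_tail m c z)"

lemma inv_letter_invol [simp]: "inv_letter (inv_letter l) = l"
  by (simp add: inv_letter_def)

lemma fst_inv_letter [simp]: "fst (inv_letter l) = fst l"
  by (simp add: inv_letter_def)

lemma freely_reduced_tl: "freely_reduced (k # w) \<Longrightarrow> freely_reduced w"
  by (cases w) auto

lemma freely_reduced_cancel_cons: "freely_reduced w \<Longrightarrow> freely_reduced (cancel_cons k w)"
  by (cases w) (auto dest: freely_reduced_tl)

lemma freely_reduced_foldr: "freely_reduced w \<Longrightarrow> freely_reduced (foldr cancel_cons u w)"
  by (induction u) (auto intro: freely_reduced_cancel_cons)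

lemma freely_reduced_free_reduction: "freely_reduced (free_reduction w)"
  by (simp add: free_reduction_def freely_reduced_foldr)

lemma cancel_cons_inverse:
  assumes "freely_reduced w"
  shows "cancel_cons k (cancel_cons (inv_letter k) w) = w"
proof (cases w)
  case (Cons l v)
  then show ?thesis using assms by (cases v) auto
qed simp

lemma foldr_cancel_cons_cancel_cons:
  assumes "freely_reduced v"
  shows "foldr cancel_cons (cancel_cons k u) v = cancel_cons k (foldr cancel_cons u v)"
proof (cases u)
  case (Cons l t)
  then show ?thesis
    using cancel_cons_inverse[OF freely_reduced_foldr[OF assms, of t], of k] by auto
qed simp

lemma foldr_free_reduction:
  "freely_reduced v \<Longrightarrow> foldr cancel_cons (free_reduction u) v = foldr cancel_cons u v"
  by (induction u) (auto simp: free_reduction_def foldr_cancel_cons_cancel_cons)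

lemma free_reduction_id: "freely_reduced w \<Longrightarrow> free_reduction w = w"
proof (induction w)
  case (Cons k w)
  then show ?case
    by (cases w) (auto simp: free_reduction_def)
qed (simp add: free_reduction_def)

lemma free_reduction_append:
  "free_reduction (u @ v) = foldr cancel_cons u (free_reduction v)"
  by (simp add: free_reduction_def)

lemma set_cancel_cons: "set (cancel_cons k w) \<subseteq> insert k (set w)"
  by (cases w) auto

lemma set_free_reduction: "set (free_reduction w) \<subseteq> set w"
proof (induction w)
  case (Cons k w)
  then show ?case
    using set_cancel_cons[of k "free_reduction w"] by (auto simp: free_reduction_def)
qed (simp add: free_reduction_def)

lemma foldr_inv_word:
  "freely_reduced v \<Longrightarrow> foldr cancel_cons (inv_word u) (foldr cancel_cons u v) = v"
proof (induction u arbitrary: v)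
  case (Cons k u)
  have "cancel_cons (inv_letter k) (cancel_cons k (foldr cancel_cons u v))
      = foldr cancel_cons u v"
    using cancel_cons_inverse[OF freely_reduced_foldr[OF Cons.prems, of u], of "inv_letter k"]
    by simp
  with Cons show ?case by (simp add: inv_word_def)
qed (simp add: inv_word_def)

lemma free_reduction_closed:
  assumes "fst ` set w \<subseteq> Y"
  shows "free_reduction w \<in> carrier (free_group Y)"
  using image_mono[OF set_free_reduction[of w], of fst] assms
  by (simp add: free_group_def freely_reduced_free_reduction)

lemma free_reduction_assoc:
  "free_reduction (free_reduction (u @ v) @ w) = free_reduction (u @ free_reduction (v @ w))"
proof -
  have "free_reduction (free_reduction (u @ v) @ w)
      = foldr cancel_cons (u @ v) (free_reduction w)"
    by (simp only: free_reduction_append[of "free_reduction (u @ v)"]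
        foldr_free_reduction[OF freely_reduced_free_reduction])
  also have "\<dots> = foldr cancel_cons u (free_reduction (v @ w))"
    by (simp add: free_reduction_def)
  also have "\<dots> = free_reduction (u @ free_reduction (v @ w))"
    by (simp only: free_reduction_append[of u "free_reduction (v @ w)"]
        free_reduction_id[OF freely_reduced_free_reduction])
  finally show ?thesis .
qed

lemma free_reduction_inverse: "free_reduction (free_reduction (inv_word u) @ free_reduction u) = []"
proof -
  have "free_reduction (free_reduction (inv_word u) @ free_reduction u)
      = foldr cancel_cons (inv_word u) (free_reduction u)"
    by (simp only: free_reduction_append[of "free_reduction (inv_word u)"]
        foldr_free_reduction[OF freely_reduced_free_reduction]
        free_reduction_id[OF freely_reduced_free_reduction])
  also have "\<dots> = []"
    unfolding free_reduction_def by (rule foldr_inv_word) simp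
  finally show ?thesis .
qed

theorem group_free_group: "group (free_group Y)"
proof (rule groupI)
  fix u v assume "u \<in> carrier (free_group Y)" "v \<in> carrier (free_group Y)"
  then have "free_reduction (u @ v) \<in> carrier (free_group Y)"
    by (intro free_reduction_closed) (simp add: free_group_def image_Un)
  then show "u \<otimes>\<^bsub>free_group Y\<^esub> v \<in> carrier (free_group Y)"
    by (simp add: free_group_def)
next
  fix u assume u: "u \<in> carrier (free_group Y)"
  have "fst ` set (inv_word u) = fst ` set u"
    by (simp add: inv_word_def image_image)
  then have "free_reduction (inv_word u) \<in> carrier (free_group Y)"
    using u by (intro free_reduction_closed) (simp add: free_group_def)
  moreover have "free_reduction (inv_word u) \<otimes>\<^bsub>free_group Y\<^esub> u = \<one>\<^bsub>free_group Y\<^esub>"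
    using free_reduction_inverse[of u] u by (simp add: free_group_def free_reduction_id)
  ultimately show "\<exists>v \<in> carrier (free_group Y). v \<otimes>\<^bsub>free_group Y\<^esub> u = \<one>\<^bsub>free_group Y\<^esub>"
    by blast
qed (simp_all add: free_group_def free_reduction_assoc free_reduction_id)

end

theory Submission
  imports Defs "HOL-Library.Z2" "HOL-Library.Sublist"
begin

text \<open>
  Cancellation in \<open>Q\<^sup>\<alpha>\<close> pairs off the letters of the coefficients, so one may give every pair
  a name of its own and assume that each letter occurs exactly twice in the coefficients. Gluing
  the coefficients, as boundaries of discs, along these pairs gives a closed surface. Gluing them
  along a spanning forest already yields short conjugators that turn the product of the
  coefficients into a quadratic word \<open>V\<close>, no longer than the coefficients together, and cutting
  handles and crosscaps splits \<open>V\<close> into commutators and squares of short elements. There are not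
  too many of them for the given equation: both the given solution and the splitting of \<open>V\<close>
  express the same bilinear form over the field with two elements, the cup product form of the
  surface, which is non-degenerate on the splitting. In the non-orientable case, squares and
  commutators are traded for each other, and coefficients glued with the wrong orientation are
  inverted by moving a square past them; both cost a factor linear in the number of variables.
  An arbitrary quadratic word is brought to standard form by the same splittings.
\<close>

text \<open>The obstacle is that the shape of the equation is prescribed: the order and orientation
  of the coefficients and the numbers of squares and commutators. The given solution contributes a
  pairing of the coefficient letters and these numbers; the short values are then built afresh from
  coefficient letters. Let \<open>C\<close> be the total length of the coefficients. A conjugator
  undoes one insertion, at cost \<open>C\<close>, and passes a suffix of the marked word, at cost
  \<open>2 * C\<close>; hence \<open>3 * C\<close>. Elements cut from \<open>V\<close> are written
  in the letters of \<open>V\<close>, not in terms of earlier elements, so \<open>2 * C\<close>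
  bounds them all. The form is evaluated only on functionals modulo 2 that vanish on the
  coefficients: there conjugation and inversion of coefficients are invisible, so that only squares
  and commutators are compared. A form without squares is alternating, which yields the strict
  inequality that leaves room for the one square from which all trades start. Standard form costs a
  factor of about \<open>4 * n\<close> for \<open>n\<close> variables: prefixes are bounded by
  \<open>2 * n * L + C\<close>, and a variable is a quotient of two prefixes.\<close>

declare add_bit_eq_xor [simp del] mult_bit_eq_and [simp del]

section \<open>The free group as a type\<close>

text \<open>The type has no alphabet parameter: every \<open>free_group Y\<close> lies in the free
  group on the whole letter type, so that letters can be renamed and substituted without membership
  conditions. Values over \<open>A\<close> are restored at the end by a retraction.\<close>

typedef 'g fg = "{w :: 'g word. freely_reduced w}" morphisms rep_fg abs_fg
  by (rule exI[of _ "[]"]) simp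

definition cls :: "'g word \<Rightarrow> 'g fg" where
  "cls w = abs_fg (free_reduction w)"

lemma free_reduction_Nil [simp]: "free_reduction [] = []"
  by (simp add: free_reduction_def)

lemma rep_cls: "rep_fg (cls w) = free_reduction w"
  by (simp add: cls_def abs_fg_inverse freely_reduced_free_reduction)

lemma freely_reduced_rep: "freely_reduced (rep_fg g)"
  using rep_fg[of g] by simp

lemma cls_rep [simp]: "cls (rep_fg g) = g"
  by (simp add: cls_def free_reduction_id freely_reduced_rep rep_fg_inverse)

lemma free_reduction_append2: "free_reduction (free_reduction u @ free_reduction v) = free_reduction (u @ v)"
  by (simp add: free_reduction_append foldr_free_reduction
      free_reduction_id freely_reduced_free_reduction)

lemma cls_cong: "free_reduction u = free_reduction v \<Longrightarrow> cls u = cls v"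
  by (simp add: cls_def)

lemma inv_word_simps [simp]:
  "inv_word [] = []" "inv_word (u @ v) = inv_word v @ inv_word u"
  "inv_word (l # u) = inv_word u @ [inv_letter l]" "inv_word (inv_word u) = u"
  "length (inv_word u) = length u"
  by (simp_all add: inv_word_def rev_map comp_def)

text \<open>The group operation is written additively because \<open>group_add\<close> is the library's type class
  for groups that need not be commutative.\<close>

instantiation fg :: (type) group_add
begin
definition "0 = cls []"
definition "a + b = cls (rep_fg a @ rep_fg b)"
definition "- a = cls (inv_word (rep_fg a))"
definition "a - b = a + - (b :: 'a fg)"
instance
proof
  fix a b c :: "'a fg"
  show "a + b + c = a + (b + c)"
    by (auto simp: plus_fg_def rep_cls free_reduction_assoc intro: cls_cong)
  show "0 + a = a" "a + 0 = a"
    by (simp_all add: plus_fg_def zero_fg_def rep_cls)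
  show "- a + a = 0"
    unfolding plus_fg_def uminus_fg_def zero_fg_def rep_cls
    using free_reduction_inverse[of "rep_fg a"]
    by (auto intro!: cls_cong simp: free_reduction_id freely_reduced_rep)
  show "a + - b = a - b"
    by (simp add: minus_fg_def)
qed
end

lemma cls_append: "cls (u @ v) = cls u + cls v"
  by (auto simp: plus_fg_def rep_cls free_reduction_append2 intro: cls_cong)

lemma cls_Nil [simp]: "cls [] = 0"
  by (simp add: zero_fg_def)

lemma cls_inv_word: "cls (inv_word u) = - cls u"
proof -
  have "cls (inv_word u) + cls u = 0"
    using free_reduction_inverse[of u]
      cls_cong[of "free_reduction (inv_word u) @ free_reduction u" "[]"]
    unfolding plus_fg_def rep_cls by simp
  then show ?thesis by (simp add: eq_neg_iff_add_eq_0)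
qed

definition flen :: "'g fg \<Rightarrow> nat" where
  "flen g = length (rep_fg g)"

lemma length_cancel_cons: "length (cancel_cons k w) \<le> Suc (length w)"
  by (cases w) auto

lemma length_free_reduction: "length (free_reduction w) \<le> length w"
proof (induction w)
  case (Cons k w)
  then show ?case
    using length_cancel_cons[of k "free_reduction w"] by (simp add: free_reduction_def)
qed (simp add: free_reduction_def)

lemma flen_cls: "flen (cls w) \<le> length w"
  by (simp add: flen_def rep_cls length_free_reduction)

lemma flen_zero [simp]: "flen 0 = 0"
  using flen_cls[of "[]"] by simp

lemma flen_add: "flen (a + b) \<le> flen a + flen b"
  using flen_cls[of "rep_fg a @ rep_fg b"] by (simp add: plus_fg_def flen_def)

lemma flen_minus [simp]: "flen (- a) = flen a"
proof -
  have "flen (- a) \<le> flen a" for a :: "'a fg"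
    using flen_cls[of "inv_word (rep_fg a)"] by (simp add: uminus_fg_def flen_def)
  from this[of a] this[of "- a"] show ?thesis by simp
qed

text \<open>Together with the deletion of \<open>add_uminus_conv_diff\<close>, these rules reduce words in a
  non-commutative group to a normal form.\<close>

lemmas group_word_simps = minus_add add.assoc diff_conv_add_uminus

section \<open>Evaluation of words\<close>

text \<open>The target group is left open: it is the free group for substitutions,
  \<open>int\<close> for exponent sums, and \<open>bit\<close> and \<open>heis\<close> for the
  invariants that count squares and commutators.\<close>

definition lev :: "('g \<Rightarrow> 'h::group_add) \<Rightarrow> 'g letter \<Rightarrow> 'h" where
  "lev \<beta> l = (if snd l then \<beta> (fst l) else - \<beta> (fst l))"

definition ev :: "('g \<Rightarrow> 'h::group_add) \<Rightarrow> 'g word \<Rightarrow> 'h" where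
  "ev \<beta> w = sum_list (map (lev \<beta>) w)"

lemma lev_inv_letter [simp]: "lev \<beta> (inv_letter l) = - lev \<beta> l"
  by (simp add: lev_def inv_letter_def)

lemma ev_simps [simp]:
  "ev \<beta> [] = 0" "ev \<beta> (u @ v) = ev \<beta> u + ev \<beta> v" "ev \<beta> (l # u) = lev \<beta> l + ev \<beta> u"
  by (simp_all add: ev_def)

lemma ev_inv_word [simp]: "ev \<beta> (inv_word w) = - ev \<beta> w"
  by (induction w) (simp_all add: minus_add)

lemma ev_cancel_cons: "ev \<beta> (cancel_cons k w) = lev \<beta> k + ev \<beta> w"
  by (cases w) (simp_all add: add.assoc[symmetric])

lemma ev_free_reduction [simp]: "ev \<beta> (free_reduction w) = ev \<beta> w"
  by (induction w) (simp_all add: free_reduction_def ev_cancel_cons)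

lemma ev_cong: "(\<And>x. x \<in> fst ` set w \<Longrightarrow> \<beta> x = \<gamma> x) \<Longrightarrow> ev \<beta> w = ev \<gamma> w"
  by (induction w) (simp_all add: lev_def)

lemma ev_zero: "(\<And>x. x \<in> fst ` set w \<Longrightarrow> \<beta> x = 0) \<Longrightarrow> ev \<beta> w = 0"
  by (induction w) (simp_all add: lev_def)

definition gen :: "'g \<Rightarrow> 'g fg" where
  "gen a = cls [(a, True)]"

lemma lev_gen: "lev gen l = cls [l]"
  using cls_inv_word[of "[(fst l, True)]"] by (cases l) (auto simp: lev_def inv_letter_def gen_def)

lemma ev_gen [simp]: "ev gen w = cls w"
proof (induction w)
  case (Cons l w)
  then show ?case using cls_append[of "[l]" w] by (simp add: lev_gen)
qed simp

text \<open>The homomorphism that the universal property of the free group assigns to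
  \<beta>.\<close>

definition lift :: "('g \<Rightarrow> 'h::group_add) \<Rightarrow> 'g fg \<Rightarrow> 'h" where
  "lift \<beta> g = ev \<beta> (rep_fg g)"

lemma lift_cls [simp]: "lift \<beta> (cls w) = ev \<beta> w"
  by (simp add: lift_def rep_cls)

lemma lift_zero [simp]: "lift \<beta> 0 = 0"
  using lift_cls[of \<beta> "[]"] by simp

lemma lift_add [simp]: "lift \<beta> (a + b) = lift \<beta> a + lift \<beta> b"
  using lift_cls[of \<beta> "rep_fg a @ rep_fg b"] by (simp only: plus_fg_def) (simp add: lift_def)

lemma lift_minus [simp]: "lift \<beta> (- a) = - lift \<beta> a"
  using lift_cls[of \<beta> "inv_word (rep_fg a)"] by (simp only: uminus_fg_def) (simp add: lift_def)

lemma lift_diff [simp]: "lift \<beta> (a - b) = lift \<beta> a - lift \<beta> b"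
  using lift_add[of \<beta> a "- b"] by simp

lemma flen_ev:
  assumes "\<And>b. flen (\<beta> b) \<le> 1"
  shows "flen (ev \<beta> w) \<le> length w"
proof (induction w)
  case (Cons l w)
  have "flen (lev \<beta> l) \<le> 1" using assms by (simp add: lev_def)
  with Cons show ?case using flen_add[of "lev \<beta> l" "ev \<beta> w"] by simp
qed simp

text \<open>Meant for the two homomorphisms that erase data: the one that forgets the names given to
  cancelling letters and the one that kills the letters outside \<open>A\<close>.\<close>

lemma flen_lift:
  assumes "\<And>b. flen (\<beta> b) \<le> 1"
  shows "flen (lift \<beta> g) \<le> flen g"
  using flen_ev[OF assms, where w = "rep_fg g"] by (simp add: lift_def flen_def)

section \<open>Products of conjugates, squares and commutators\<close>

definition comm :: "'h::group_add \<Rightarrow> 'h \<Rightarrow> 'h" where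
  "comm a b = - a + - b + a + b"

definition conjg :: "'h::group_add \<Rightarrow> 'h \<Rightarrow> 'h" where
  "conjg c z = - z + c + z"

text \<open>\<open>SQ\<close>, \<open>CM\<close> and \<open>CJ\<close> are the values of the three
  parts of a standard equation: squares, commutators and conjugated coefficients.\<close>

definition SQ :: "'h::group_add list \<Rightarrow> 'h" where
  "SQ xs = sum_list (map (\<lambda>x. x + x) xs)"

definition CM :: "('h::group_add \<times> 'h) list \<Rightarrow> 'h" where
  "CM ps = sum_list (map (\<lambda>p. comm (fst p) (snd p)) ps)"

definition CJ :: "'h::group_add list \<Rightarrow> 'h list \<Rightarrow> 'h" where
  "CJ cs zs = sum_list (map2 conjg cs zs)"

lemma SQ_simps [simp]: "SQ [] = 0" "SQ (x # xs) = x + x + SQ xs" "SQ (xs @ ys) = SQ xs + SQ ys"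
  by (simp_all add: SQ_def)

lemma CM_simps [simp]: "CM [] = 0" "CM (p # ps) = comm (fst p) (snd p) + CM ps"
  "CM (ps @ qs) = CM ps + CM qs"
  by (simp_all add: CM_def)

lemma CJ_simps [simp]: "CJ [] zs = 0" "CJ (c # cs) (z # zs) = conjg c z + CJ cs zs"
  by (simp_all add: CJ_def)

lemma lift_comm [simp]: "lift \<beta> (comm a b) = comm (lift \<beta> a) (lift \<beta> b)"
  by (simp add: comm_def)

lemma lift_conjg [simp]: "lift \<beta> (conjg a b) = conjg (lift \<beta> a) (lift \<beta> b)"
  by (simp add: conjg_def)

lemma lift_SQ: "lift \<beta> (SQ xs) = SQ (map (lift \<beta>) xs)"
  by (induction xs) simp_all

lemma lift_CM: "lift \<beta> (CM ps) = CM (map (map_prod (lift \<beta>) (lift \<beta>)) ps)"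
  by (induction ps) simp_all

lemma lift_CJ:
  "length cs = length zs \<Longrightarrow> lift \<beta> (CJ cs zs) = CJ (map (lift \<beta>) cs) (map (lift \<beta>) zs)"
  by (induction cs zs rule: list_induct2) simp_all

section \<open>Quadratic words\<close>

definition occ :: "'b word \<Rightarrow> 'b \<Rightarrow> nat" where
  "occ w b = count_list w (b, True) + count_list w (b, False)"

definition fully_quadratic :: "'b word \<Rightarrow> bool" where
  "fully_quadratic w \<longleftrightarrow> (\<forall>b. occ w b = 0 \<or> occ w b = 2)"

text \<open>For a fully quadratic word this means that each name occurs once with each sign or not
  at all, the case in which gluing along the pairs gives an oriented surface.\<close>

definition balanced :: "'b word \<Rightarrow> bool" where
  "balanced w \<longleftrightarrow> (\<forall>b. count_list w (b, True) = count_list w (b, False))"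

lemma occ_simps [simp]:
  "occ [] b = 0" "occ (u @ v) b = occ u b + occ v b"
  "occ (l # v) b = (if fst l = b then 1 else 0) + occ v b"
  by (cases l; auto simp: occ_def)+

lemma count_inv_word [simp]: "count_list (inv_word w) (b, s) = count_list w (b, \<not> s)"
  by (induction w) (auto simp: inv_letter_def)

lemma occ_inv_word [simp]: "occ (inv_word w) b = occ w b"
  by (simp add: occ_def)

lemma occ_le_2: "fully_quadratic w \<Longrightarrow> occ w b \<le> 2"
  by (metis fully_quadratic_def order_refl zero_le)

lemma occ_eq_0: "occ w b = 0 \<longleftrightarrow> b \<notin> fst ` set w"
  by (induction w) auto

lemma occ_concat: "occ (concat ws) b = (\<Sum>j<length ws. occ (ws ! j) b)"
  by (induction ws rule: rev_induct) (simp_all add: nth_append)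

lemma count_list_concat: "count_list (concat ws) l = (\<Sum>j<length ws. count_list (ws ! j) l)"
  by (induction ws rule: rev_induct) (simp_all add: nth_append)

lemma length_concat_sum: "length (concat ws) = (\<Sum>j<length ws. length (ws ! j))"
  by (induction ws rule: rev_induct) (simp_all add: nth_append)

lemma bit_add_self: "(x :: bit) + x = 0"
  by (cases x) simp_all

lemma bit_add_self2: "(x :: bit) + (x + y) = y"
  by (cases x; cases y) simp_all

lemma lev_bit [simp]: "lev (u :: 'b \<Rightarrow> bit) l = u (fst l)"
  by (simp add: lev_def)

text \<open>Modulo 2 neither the order nor the signs of the letters count.\<close>

lemma ev_bit_sum:
  fixes u :: "'b \<Rightarrow> bit"
  assumes "finite B" "fst ` set w \<subseteq> B"
  shows "ev u w = (\<Sum>b\<in>B. of_nat (occ w b) * u b)"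
  using assms(2)
proof (induction w)
  case (Cons l w)
  have "(\<Sum>b\<in>B. of_nat (occ (l # w) b) * u b)
      = (\<Sum>b\<in>B. (if fst l = b then u b else 0) + of_nat (occ w b) * u b)"
    by (intro sum.cong) (auto simp: algebra_simps)
  also have "\<dots> = u (fst l) + ev u w"
    using Cons assms(1) by (simp add: sum.distrib)
  finally show ?case by simp
qed simp

section \<open>Gluing the coefficients into one word\<close>

definition flipw :: "bool \<Rightarrow> 'b word \<Rightarrow> 'b word" where
  "flipw f c = (if f then inv_word c else c)"

lemma occ_flipw [simp]: "occ (flipw f c) b = occ c b"
  by (simp add: flipw_def)

lemma length_flipw [simp]: "length (flipw f c) = length c"
  by (simp add: flipw_def)

lemma ev_flipw: "ev (u :: 'b \<Rightarrow> bit) (flipw f c) = ev u c"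
  by (simp add: flipw_def)

datatype 'b item = Let "'b letter" | Mark nat "'b word"

fun item_word :: "nat set \<Rightarrow> 'b item \<Rightarrow> 'b word" where
  "item_word S (Let l) = [l]"
| "item_word S (Mark j v) = (if j \<in> S then [] else v)"

text \<open>\<open>S\<close> is the set of suppressed marks. In a state of the gluing
  \<open>read {} K\<close> is trivial in the free group, and each index added to \<open>S\<close>
  multiplies the value by one conjugate of a coefficient, until \<open>read UNIV K\<close> is the
  boundary word.\<close>

definition read :: "nat set \<Rightarrow> 'b item list \<Rightarrow> 'b word" where
  "read S K = concat (map (item_word S) K)"

fun marks :: "'b item list \<Rightarrow> nat list" where
  "marks [] = []"
| "marks (Let l # K) = marks K"
| "marks (Mark j v # K) = j # marks K"

lemma read_simps [simp]:
  "read S [] = []" "read S (i # K) = item_word S i @ read S K" "read S (K @ L) = read S K @ read S L"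
  by (simp_all add: read_def)

lemma read_Let [simp]: "read S (map Let w) = w"
  by (induction w) simp_all

lemma marks_append [simp]: "marks (K @ L) = marks K @ marks L"
  by (induction K rule: marks.induct) simp_all

lemma marks_Let [simp]: "marks (map Let w) = []"
  by (induction w) simp_all

lemma in_marks: "j \<in> set (marks K) \<longleftrightarrow> (\<exists>v. Mark j v \<in> set K)"
  by (induction K rule: marks.induct) auto

lemma read_cong: "S \<inter> set (marks K) = S' \<inter> set (marks K) \<Longrightarrow> read S K = read S' K"
  by (induction K rule: marks.induct) auto

lemma length_read: "length (read S K) \<le> length (read {} K)"
  by (induction K rule: marks.induct) auto

lemma in_read_UNIV: "l \<in> set (read UNIV K) \<Longrightarrow> Let l \<in> set K"
  by (induction K rule: marks.induct) auto

text \<open>A state of the gluing: the coefficients with index in \<open>D\<close> have been glued, along the letters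
  in \<open>T\<close>, to the word \<open>read UNIV K\<close>, those with \<open>fl j\<close> after inversion. A mark undoes the insertion
  of its coefficient, so that \<open>read S K\<close> is the product of the conjugates of the coefficients with
  index in \<open>S\<close> alone; this yields the conjugates in any prescribed order. \<open>\<rho>\<close> is the coefficient
  that is not to be conjugated, and \<open>cr\<close> the first one of the current component of the surface.\<close>

definition glued where
  "glued cs \<rho> D K fl T cr \<longleftrightarrow>
     D \<subseteq> {..<length cs} \<and> \<rho> \<in> D \<and> cr \<in> D \<and>
     distinct (marks K) \<and> set (marks K) = D \<and>
     (\<exists>K0 v. K = K0 @ [Mark \<rho> v]) \<and> \<not> fl \<rho> \<and>
     cls (read {} K) = 0 \<and>
     length (read UNIV K) \<le> (\<Sum>j\<in>D. length (cs ! j)) \<and>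
     length (read {} K) \<le> 2 * (\<Sum>j\<in>D. length (cs ! j)) \<and>
     (\<forall>j v. Mark j v \<in> set K \<longrightarrow>
        (\<exists>r. flen r \<le> length (cs ! j) \<and> (j = \<rho> \<longrightarrow> r = 0) \<and>
           cls v = r - cls (flipw (fl j) (cs ! j)) - r)) \<and>
     (\<forall>b\<in>T. occ (read UNIV K) b = 0 \<and> (\<Sum>j\<in>D. occ (cs ! j) b) = 2) \<and>
     (\<forall>b s. b \<notin> T \<longrightarrow>
        count_list (read UNIV K) (b, s) = (\<Sum>j\<in>D. count_list (flipw (fl j) (cs ! j)) (b, s))) \<and>
     (\<forall>u0 :: _ \<Rightarrow> bit. \<exists>u. (\<forall>b. b \<notin> T \<longrightarrow> u b = u0 b) \<and> (\<forall>j\<in>D - {cr}. ev u (cs ! j) = 0)) \<and>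
     (balanced (concat cs) \<longrightarrow> (\<forall>j. \<not> fl j))"

lemma glued_occ:
  assumes "glued cs \<rho> D K fl T cr" "b \<notin> T"
  shows "occ (read UNIV K) b = (\<Sum>j\<in>D. occ (cs ! j) b)"
proof -
  have "occ (read UNIV K) b = (\<Sum>j\<in>D. occ (flipw (fl j) (cs ! j)) b)"
    using assms unfolding glued_def occ_def by (simp add: sum.distrib)
  then show ?thesis by simp
qed

text \<open>Each letter of \<open>T\<close> joins one new coefficient to a component, so its value
  can be used to make that coefficient vanish; the first coefficient of the current component has no
  such letter and is left out. This is the source of all functionals that vanish on the
  coefficients.\<close>

lemma glued_functional:
  "glued cs \<rho> D K fl T cr \<Longrightarrow>
    \<exists>u :: _ \<Rightarrow> bit. (\<forall>b. b \<notin> T \<longrightarrow> u b = u0 b) \<and> (\<forall>j\<in>D - {cr}. ev u (cs ! j) = 0)"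
  unfolding glued_def by (elim conjE, erule spec)

lemma glued_mark:
  assumes "glued cs \<rho> D K fl T cr"
  shows "\<forall>j v. Mark j v \<in> set K \<longrightarrow>
        (\<exists>r. flen r \<le> length (cs ! j) \<and> (j = \<rho> \<longrightarrow> r = 0) \<and>
           cls v = r - cls (flipw (fl j) (cs ! j)) - r)"
  using assms unfolding glued_def by (elim conjE)

text \<open>The coefficient is followed at once by its mark, and this mark remains the last item
  from here on; that is what will leave \<open>\<rho>\<close> unconjugated.\<close>

lemma glued_start:
  assumes "\<rho> < length cs"
  shows "glued cs \<rho> {\<rho>} (map Let (cs ! \<rho>) @ [Mark \<rho> (inv_word (cs ! \<rho>))]) (\<lambda>_. False) {} \<rho>"
  using assms unfolding glued_def
  by (auto simp: flipw_def cls_append cls_inv_word intro!: exI[of _ 0])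

text \<open>When every letter is counted twice or not at all, the values of the coefficients in
  \<open>D\<close> add up to 0 modulo 2, so the one that was left out vanishes with the
  others.\<close>

lemma glued_root_closed:
  fixes u :: "'b \<Rightarrow> bit"
  assumes g: "glued cs \<rho> D K fl T cr" and "\<And>b. occ (read UNIV K) b \<in> {0, 2}"
    and u: "\<And>j. j \<in> D - {cr} \<Longrightarrow> ev u (cs ! j) = 0"
  shows "j \<in> D \<Longrightarrow> ev u (cs ! j) = 0"
proof -
  have D: "D \<subseteq> {..<length cs}" "cr \<in> D" using g by (auto simp: glued_def)
  then have fin: "finite D" by (auto intro: finite_subset)
  let ?B = "fst ` set (concat cs)"
  have "(\<Sum>j\<in>D. ev u (cs ! j)) = (\<Sum>j\<in>D. \<Sum>b\<in>?B. of_nat (occ (cs ! j) b) * u b)"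
    using D by (intro sum.cong ev_bit_sum) force+
  also have "\<dots> = (\<Sum>b\<in>?B. \<Sum>j\<in>D. of_nat (occ (cs ! j) b) * u b)"
    by (rule sum.swap)
  also have "\<dots> = (\<Sum>b\<in>?B. of_nat (\<Sum>j\<in>D. occ (cs ! j) b) * u b)"
    by (simp add: sum_distrib_right)
  also have "\<dots> = 0"
  proof (intro sum.neutral ballI)
    fix b
    have "(\<Sum>j\<in>D. occ (cs ! j) b) \<in> {0, 2}"
      using glued_occ[OF g, of b] assms(2)[of b] g unfolding glued_def by fastforce
    then have "(of_nat (\<Sum>j\<in>D. occ (cs ! j) b) :: bit) = 0" by (auto simp del: of_nat_sum)
    then show "of_nat (\<Sum>j\<in>D. occ (cs ! j) b) * u b = 0" by (simp only: mult_zero_left)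
  qed
  finally have "(\<Sum>j\<in>D. ev u (cs ! j)) = 0" .
  moreover have "(\<Sum>j\<in>D. ev u (cs ! j)) = ev u (cs ! cr) + (\<Sum>j\<in>D - {cr}. ev u (cs ! j))"
    using fin D by (simp add: sum.remove)
  ultimately have "ev u (cs ! cr) = 0" using u by simp
  then show "j \<in> D \<Longrightarrow> ev u (cs ! j) = 0" using u by (cases "j = cr") auto
qed

text \<open>With no single letter on the boundary the components are closed, so \<open>cr\<close>
  vanishes too and \<open>j\<close> may take its place as the exception. The new coefficient is put
  in front because the last place belongs to \<open>\<rho>\<close>.\<close>

lemma glued_new_component:
  assumes g: "glued cs \<rho> D K fl T cr" and "\<And>b. occ (read UNIV K) b \<in> {0, 2}"
    and fq: "fully_quadratic (concat cs)" and j: "j < length cs" "j \<notin> D"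
  shows "glued cs \<rho> (insert j D) (map Let (cs ! j) @ Mark j (inv_word (cs ! j)) # K) (fl(j := False)) T j"
proof -
  have D: "D \<subseteq> {..<length cs}" "finite D" "\<rho> \<in> D" using g by (auto simp: glued_def finite_subset)
  have fl: "(\<Sum>i\<in>D. count_list (flipw ((fl(j := False)) i) (cs ! i)) l)
      = (\<Sum>i\<in>D. count_list (flipw (fl i) (cs ! i)) l)" for l
    using j by (intro sum.cong) auto
  \<comment> \<open>A letter of \<open>T\<close> has both its occurrences inside \<open>D\<close>
    already.\<close>
  have T: "occ (cs ! j) b = 0" if "b \<in> T" for b
  proof -
    have "occ (concat cs) b \<ge> (\<Sum>i\<in>insert j D. occ (cs ! i) b)"
      unfolding occ_concat using D j by (intro sum_mono2) auto
    moreover have "(\<Sum>i\<in>D. occ (cs ! i) b) = 2" using g that by (auto simp: glued_def)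
    ultimately have "occ (concat cs) b \<ge> occ (cs ! j) b + 2" using D j by simp
    moreover have "occ (concat cs) b \<le> 2" by (rule occ_le_2[OF fq])
    ultimately show ?thesis by simp
  qed
  have u: "\<exists>u. (\<forall>b. b \<notin> T \<longrightarrow> u b = u0 b) \<and> (\<forall>i\<in>insert j D - {j}. ev u (cs ! i) = 0)"
    for u0 :: "_ \<Rightarrow> bit"
  proof -
    obtain u where u: "\<forall>b. b \<notin> T \<longrightarrow> u b = u0 b" "\<forall>j\<in>D - {cr}. ev u (cs ! j) = 0"
      using glued_functional[OF g] by blast
    with glued_root_closed[OF g assms(2), of u] show ?thesis by blast
  qed
  have cnt: "count_list (cs ! j) (b, s) = 0" if "b \<in> T" for b s
    using T[OF that] by (cases s) (auto simp: occ_def)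
  from g obtain K0 v where K: "K = K0 @ [Mark \<rho> v]" by (auto simp: glued_def)
  show ?thesis
    unfolding glued_def
  proof (intro conjI)
    show "\<exists>K0 v. map Let (cs ! j) @ Mark j (inv_word (cs ! j)) # K = K0 @ [Mark \<rho> v]"
      using K by (metis append_Cons append_assoc)
    show "cls (read {} (map Let (cs ! j) @ Mark j (inv_word (cs ! j)) # K)) = 0"
      using g by (simp add: glued_def cls_append cls_inv_word)
    show "\<forall>i v. Mark i v \<in> set (map Let (cs ! j) @ Mark j (inv_word (cs ! j)) # K) \<longrightarrow>
        (\<exists>r. flen r \<le> length (cs ! i) \<and> (i = \<rho> \<longrightarrow> r = 0) \<and>
           cls v = r - cls (flipw ((fl(j := False)) i) (cs ! i)) - r)"
    proof (intro allI impI)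
      fix i v assume iv: "Mark i v \<in> set (map Let (cs ! j) @ Mark j (inv_word (cs ! j)) # K)"
      show "\<exists>r. flen r \<le> length (cs ! i) \<and> (i = \<rho> \<longrightarrow> r = 0) \<and>
           cls v = r - cls (flipw ((fl(j := False)) i) (cs ! i)) - r"
      proof (cases "i = j")
        case True
        with iv have "v = inv_word (cs ! j)"
          using g j in_marks[of j K] by (auto simp: glued_def)
        with True show ?thesis by (intro exI[of _ 0]) (simp add: flipw_def cls_inv_word)
      next
        case False
        with iv g show ?thesis by (auto simp: glued_def)
      qed
    qed
    show "\<forall>b\<in>T. occ (read UNIV (map Let (cs ! j) @ Mark j (inv_word (cs ! j)) # K)) b = 0 \<and>
        (\<Sum>i\<in>insert j D. occ (cs ! i) b) = 2"
      using g T D j by (simp add: glued_def)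
    show "\<forall>b s. b \<notin> T \<longrightarrow>
        count_list (read UNIV (map Let (cs ! j) @ Mark j (inv_word (cs ! j)) # K)) (b, s)
        = (\<Sum>i\<in>insert j D. count_list (flipw ((fl(j := False)) i) (cs ! i)) (b, s))"
      using g D j fl by (simp add: glued_def flipw_def)
    show "\<forall>u0. \<exists>u :: _ \<Rightarrow> bit. (\<forall>b. b \<notin> T \<longrightarrow> u b = u0 b) \<and> (\<forall>i\<in>insert j D - {j}. ev u (cs ! i) = 0)"
      using u by blast
  qed (use g D j in \<open>auto simp: glued_def\<close>)
qed

lemma sum_occ_le:
  assumes "fully_quadratic (concat cs)" "D \<subseteq> {..<length cs}"
  shows "(\<Sum>i\<in>D. occ (cs ! i) b) \<le> 2"
proof -
  have "(\<Sum>i\<in>D. occ (cs ! i) b) \<le> occ (concat cs) b"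
    unfolding occ_concat using assms(2) by (intro sum_mono2) auto
  also have "\<dots> \<le> 2" by (rule occ_le_2[OF assms(1)])
  finally show ?thesis .
qed

lemma split_at_single:
  assumes "count_list w (b, s) = 1" "count_list w (b, \<not> s) = 0"
  obtains p q where "w = p @ (b, s) # q" "occ p b = 0" "occ q b = 0"
proof -
  have "(b, s) \<in> set w" using assms(1) by (metis count_list_0_iff zero_neq_one)
  then obtain p q where w: "w = p @ (b, s) # q" by (meson split_list)
  have "occ w b = 1" using assms by (cases s) (simp_all add: occ_def)
  with w have "occ p b = 0" "occ q b = 0" by simp_all
  with w that show ?thesis by blast
qed

text \<open>The second occurrence of \<open>b\<close> lies in a coefficient outside
  \<open>D\<close>. Up to inversion this coefficient is \<open>c = p e q\<close>, where
  \<open>e\<close> is inverse to the boundary letter. Solving for the boundary letter gives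
  \<open>q p\<close> times the conjugate by \<open>p\<close> of the inverse of \<open>c\<close>; so
  \<open>q p\<close> replaces the letter, and the conjugate is the new mark.\<close>

lemma glued_extend:
  fixes cs :: "'b word list"
  assumes g: "glued cs \<rho> D K fl T cr" and one: "occ (read UNIV K) b = 1"
    and fq: "fully_quadratic (concat cs)"
  shows "\<exists>j K' fl' T'. j < length cs \<and> j \<notin> D \<and> glued cs \<rho> (insert j D) K' fl' T' cr"
proof -
  have D: "D \<subseteq> {..<length cs}" "finite D" "\<rho> \<in> D" "cr \<in> D"
    using g by (auto simp: glued_def finite_subset)
  have bT: "b \<notin> T" using g one by (auto simp: glued_def)
  have dn: "(\<Sum>i\<in>D. occ (cs ! i) b) = 1" using glued_occ[OF g bT] one by simp
  have tot: "(\<Sum>i<length cs. occ (cs ! i) b) = 2"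
  proof -
    have "(\<Sum>i<length cs. occ (cs ! i) b) \<ge> 1"
      unfolding dn[symmetric] using D by (intro sum_mono2) auto
    then show ?thesis using fq unfolding fully_quadratic_def occ_concat
      by (metis not_one_le_zero)
  qed
  have "(\<Sum>i\<in>{..<length cs} - D. occ (cs ! i) b) = 1"
    using tot dn D by (simp add: sum_diff_nat)
  then have "\<exists>j\<in>{..<length cs} - D. occ (cs ! j) b \<noteq> 0"
    by (metis sum.neutral zero_neq_one)
  then obtain j where j: "j < length cs" "j \<notin> D" and jb: "occ (cs ! j) b \<noteq> 0"
    by auto
  have le: "(\<Sum>i\<in>insert j D. occ (cs ! i) a) \<le> 2" for a
    using sum_occ_le[OF fq, of "insert j D" a] D j by simp
  have jb1: "occ (cs ! j) b = 1"
    using le[of b] dn D j jb by simp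
  have jT: "occ (cs ! j) a = 0" if "a \<in> T" for a
  proof -
    have "(\<Sum>i\<in>D. occ (cs ! i) a) = 2" using g that by (auto simp: glued_def)
    then show ?thesis using le[of a] D j by simp
  qed
  obtain s where s: "count_list (read UNIV K) (b, s) = 1" "count_list (read UNIV K) (b, \<not> s) = 0"
    using one unfolding occ_def by (metis (full_types) One_nat_def add_is_1 )
  \<comment> \<open>Inversion is called for when both occurrences of \<open>b\<close> have the same
    sign.\<close>
  define f where "f = (count_list (cs ! j) (b, \<not> s) \<noteq> 1)"
  have fs: "count_list (flipw f (cs ! j)) (b, \<not> s) = 1" "count_list (flipw f (cs ! j)) (b, s) = 0"
    using jb1 unfolding f_def flipw_def occ_def by (cases s; auto)+
  obtain p q where pq: "flipw f (cs ! j) = p @ (b, \<not> s) # q" "occ p b = 0" "occ q b = 0"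
    using split_at_single[of "flipw f (cs ! j)" b "\<not> s"] fs by auto
  have "Let (b, s) \<in> set K"
    using s(1) by (metis count_list_0_iff in_read_UNIV zero_neq_one)
  then obtain K1 K2 where K: "K = K1 @ Let (b, s) # K2" by (meson split_list)
  obtain K0 v0 where "K = K0 @ [Mark \<rho> v0]" using g by (auto simp: glued_def)
  with K have "\<exists>K0'. K2 = K0' @ [Mark \<rho> v0]"
    by (cases K2 rule: rev_cases) auto
  then obtain K0' where K0': "K2 = K0' @ [Mark \<rho> v0]" by blast
  define d where "d = q @ p"
  define v where "v = inv_word d @ [(b, s)]"
  define K' where "K' = K1 @ map Let d @ Mark j v # K2"
  have occd: "occ d b = 0" using pq by (simp add: d_def)
  have lend: "length (cs ! j) = Suc (length d)"
    using pq(1) length_flipw[of f "cs ! j"] by (simp add: d_def)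
  have cntd: "count_list (flipw f (cs ! j)) (a, t) = count_list d (a, t)" if "a \<noteq> b" for a t
    using that by (simp add: pq(1) d_def)
  have occj: "occ (cs ! j) a = occ d a" if "a \<noteq> b" for a
    using cntd[OF that] occ_flipw[of f "cs ! j" a] by (simp add: occ_def)
  have fl: "(\<Sum>i\<in>D. count_list (flipw ((fl(j := f)) i) (cs ! i)) l)
      = (\<Sum>i\<in>D. count_list (flipw (fl i) (cs ! i)) l)" for l
    using j by (intro sum.cong) auto
  have clsv: "cls v = - cls p - cls (flipw f (cs ! j)) - (- cls p)"
  proof -
    have "cls [(b, \<not> s)] = - cls [(b, s)]"
      using cls_inv_word[of "[(b, s)]"] by (simp add: inv_letter_def)
    then have e: "cls (flipw f (cs ! j)) = cls p + (- cls [(b, s)] + cls q)"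
      using cls_append[of p "(b, \<not> s) # q"] cls_append[of "[(b, \<not> s)]" q] by (simp add: pq(1))
    show ?thesis
      unfolding v_def d_def e
      by (simp add: cls_append cls_inv_word group_word_simps
          del: add_uminus_conv_diff)
  qed
  have "glued cs \<rho> (insert j D) K' (fl(j := f)) (insert b T) cr"
    unfolding glued_def
  proof (intro conjI)
    show "distinct (marks K')" "set (marks K') = insert j D"
      using g j by (auto simp: glued_def K K'_def)
    show "\<exists>K0 v. K' = K0 @ [Mark \<rho> v]"
      unfolding K'_def K0' by (metis append_Cons append_assoc)
    show "cls (read {} K') = 0"
    proof -
      have "cls (read {} K1) + (cls [(b, s)] + cls (read {} K2)) = 0"
        using g cls_append[of "read {} K1" "(b, s) # read {} K2"] cls_append[of "[(b, s)]" "read {} K2"]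
        by (simp add: glued_def K)
      then show ?thesis
        using cls_append[of "[(b, s)]" "read {} K2"]
        by (simp add: K'_def v_def cls_append cls_inv_word add.assoc)
    qed
    show "length (read UNIV K') \<le> (\<Sum>i\<in>insert j D. length (cs ! i))"
      using g D j lend by (simp add: glued_def K K'_def)
    show "length (read {} K') \<le> 2 * (\<Sum>i\<in>insert j D. length (cs ! i))"
      using g D j lend by (simp add: glued_def K K'_def v_def)
    show "\<forall>i v. Mark i v \<in> set K' \<longrightarrow>
        (\<exists>r. flen r \<le> length (cs ! i) \<and> (i = \<rho> \<longrightarrow> r = 0) \<and>
           cls v = r - cls (flipw ((fl(j := f)) i) (cs ! i)) - r)"
    proof (intro allI impI)
      fix i w assume iw: "Mark i w \<in> set K'"
      show "\<exists>r. flen r \<le> length (cs ! i) \<and> (i = \<rho> \<longrightarrow> r = 0) \<and>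
           cls w = r - cls (flipw ((fl(j := f)) i) (cs ! i)) - r"
      proof (cases "i = j")
        case True
        with iw have "w = v"
          using g j in_marks[of j K] by (auto simp: glued_def K'_def K)
        moreover have "flen (- cls p) \<le> length (cs ! j)"
          using flen_cls[of p] lend by (simp add: d_def)
        ultimately show ?thesis using True clsv D j by (intro exI[of _ "- cls p"]) auto
      next
        case False
        with iw g show ?thesis by (auto simp: glued_def K'_def K)
      qed
    qed
    show "\<forall>a\<in>insert b T. occ (read UNIV K') a = 0 \<and> (\<Sum>i\<in>insert j D. occ (cs ! i) a) = 2"
    proof
      fix a assume a: "a \<in> insert b T"
      show "occ (read UNIV K') a = 0 \<and> (\<Sum>i\<in>insert j D. occ (cs ! i) a) = 2"
      proof (cases "a = b")
        case True
        then show ?thesis using one occd dn jb1 D j by (simp add: K K'_def)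
      next
        case False
        with a have "a \<in> T" by simp
        with False jT[of a] occj[of a] g D j show ?thesis
          by (simp add: glued_def K K'_def)
      qed
    qed
    show "\<forall>a t. a \<notin> insert b T \<longrightarrow>
        count_list (read UNIV K') (a, t)
        = (\<Sum>i\<in>insert j D. count_list (flipw ((fl(j := f)) i) (cs ! i)) (a, t))"
    proof (intro allI impI)
      fix a t assume a: "a \<notin> insert b T"
      then have "count_list (read UNIV K) (a, t) = (\<Sum>i\<in>D. count_list (flipw (fl i) (cs ! i)) (a, t))"
        using g by (simp add: glued_def)
      then show "count_list (read UNIV K') (a, t)
        = (\<Sum>i\<in>insert j D. count_list (flipw ((fl(j := f)) i) (cs ! i)) (a, t))"
        using a D j fl cntd[of a t] by (auto simp: K K'_def split: if_splits)
    qed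
    show "\<forall>u0. \<exists>u :: _ \<Rightarrow> bit. (\<forall>a. a \<notin> insert b T \<longrightarrow> u a = u0 a) \<and>
        (\<forall>i\<in>insert j D - {cr}. ev u (cs ! i) = 0)"
    proof
      fix u0 :: "'b \<Rightarrow> bit"
      \<comment> \<open>The value of \<open>b\<close> equals that of \<open>d\<close>, so both
        cancel modulo 2 and the new coefficient vanishes. The remaining values on \<open>T\<close>
        come from the earlier stage.\<close>
      obtain u where u: "\<forall>a. a \<notin> T \<longrightarrow> u a = (u0(b := ev u0 d)) a" "\<forall>i\<in>D - {cr}. ev u (cs ! i) = 0"
        using glued_functional[OF g] by blast
      have "ev u d = ev u0 d"
      proof (rule ev_cong)
        fix a assume a: "a \<in> fst ` set d"
        then have "a \<noteq> b" using occd by (auto simp: occ_eq_0)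
        moreover have "a \<notin> T"
          using jT[of a] occj[OF \<open>a \<noteq> b\<close>] a by (metis occ_eq_0)
        ultimately show "u a = u0 a" using u by simp
      qed
      then have "u b = ev u d" using u(1) bT by simp
      then have "ev u (flipw f (cs ! j)) = ev u d + ev u d"
        unfolding pq(1) by (simp add: d_def ac_simps)
      then have "ev u (cs ! j) = 0" by (simp add: ev_flipw bit_add_self)
      with u show "\<exists>u :: _ \<Rightarrow> bit. (\<forall>a. a \<notin> insert b T \<longrightarrow> u a = u0 a) \<and>
        (\<forall>i\<in>insert j D - {cr}. ev u (cs ! i) = 0)"
        by (intro exI[of _ u]) auto
    qed
    show "balanced (concat cs) \<longrightarrow> (\<forall>i. \<not> (fl(j := f)) i)"
    proof
      assume bal: "balanced (concat cs)"
      then have nf: "\<not> fl i" for i using g by (simp add: glued_def)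
      have sum: "(\<Sum>i<length cs. count_list (cs ! i) (b, t)) = 1" for t
      proof -
        have "(\<Sum>i<length cs. count_list (cs ! i) (b, True)) = (\<Sum>i<length cs. count_list (cs ! i) (b, False))"
          using bal by (simp add: balanced_def count_list_concat)
        moreover have "(\<Sum>i<length cs. count_list (cs ! i) (b, True)) + (\<Sum>i<length cs. count_list (cs ! i) (b, False)) = 2"
          using tot by (simp add: occ_def sum.distrib)
        ultimately show ?thesis by (cases t) simp_all
      qed
      \<comment> \<open>The one occurrence of \<open>b\<close> with sign \<open>s\<close> is on the
        boundary already, so the other has the opposite sign and no inversion takes place.\<close>
      have "(\<Sum>i\<in>D. count_list (cs ! i) (b, s)) = 1"
        using s g bT nf by (simp add: glued_def flipw_def)
      moreover have "(\<Sum>i\<in>insert j D. count_list (cs ! i) (b, s)) \<le> 1"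
        unfolding sum[of s, symmetric] using D j by (intro sum_mono2) auto
      ultimately have "count_list (cs ! j) (b, s) = 0" using D j by simp
      then have "\<not> f" using jb1 unfolding f_def occ_def by (cases s) auto
      with nf show "\<forall>i. \<not> (fl(j := f)) i" by simp
    qed
  qed (use g D j in \<open>auto simp: glued_def\<close>)
  with j have "j < length cs \<and> j \<notin> D \<and> glued cs \<rho> (insert j D) K' (fl(j := f)) (insert b T) cr"
    by (intro conjI)
  then show ?thesis by (intro exI)
qed

lemma glued_exists:
  assumes fq: "fully_quadratic (concat cs)" and \<rho>: "\<rho> < length cs"
  shows "n < length cs \<Longrightarrow> \<exists>D K fl T cr. card D = Suc n \<and> glued cs \<rho> D K fl T cr"
proof (induction n)
  case 0
  show ?case
    by (rule exI[of _ "{\<rho>}"]) (use glued_start[OF \<rho>] in auto)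
next
  case (Suc n)
  then obtain D K fl T cr where D: "card D = Suc n" and g: "glued cs \<rho> D K fl T cr" by auto
  have sub: "D \<subseteq> {..<length cs}" using g by (simp add: glued_def)
  then have fin: "finite D" by (rule finite_subset) simp
  show ?case
  proof (cases "\<exists>b. occ (read UNIV K) b = 1")
    case True
    then obtain b where "occ (read UNIV K) b = 1" by blast
    from glued_extend[OF g this fq] obtain j K' fl' T'
      where "j \<notin> D" "glued cs \<rho> (insert j D) K' fl' T' cr" by blast
    moreover from this have "card (insert j D) = Suc (Suc n)" using fin D by simp
    ultimately show ?thesis by (intro exI conjI)
  next
    case False
    have two: "occ (read UNIV K) b \<in> {0, 2}" for b
    proof (cases "b \<in> T")
      case True
      then show ?thesis using g by (simp add: glued_def)
    next
      case nT: False
      then have "occ (read UNIV K) b \<le> 2"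
        using glued_occ[OF g nT] sum_occ_le[OF fq sub, of b] by simp
      with False show ?thesis by (auto simp: le_Suc_eq numeral_2_eq_2)
    qed
    have "\<not> {..<length cs} \<subseteq> D"
      using D Suc.prems fin card_mono[of D "{..<length cs}"] by auto
    then obtain j where j: "j < length cs" "j \<notin> D" by auto
    then have "card (insert j D) = Suc (Suc n)" using fin D by simp
    with glued_new_component[OF g two fq j] show ?thesis by (intro exI conjI)
  qed
qed

lemma CJ_snoc: "length cs = length zs \<Longrightarrow> CJ (cs @ [c]) (zs @ [z]) = CJ cs zs + conjg c z"
  by (simp add: CJ_def)

text \<open>Suppressing the marks by increasing index leads from the trivial word to
  \<open>V\<close> and multiplies on the right by one conjugate at each stage. So the conjugates
  come in the order of the equation, whatever the order of gluing was, and each partial product is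
  the class of a word of length at most \<open>2 * length (concat cs)\<close>.\<close>

lemma gluing:
  fixes cs :: "'b word list"
  assumes fq: "fully_quadratic (concat cs)" and \<rho>: "\<rho> < length cs"
  obtains fl :: "nat \<Rightarrow> bool" and zs V where
    "length zs = length cs" "zs ! \<rho> = 0" "\<not> fl \<rho>" "balanced (concat cs) \<Longrightarrow> \<forall>j. \<not> fl j"
    "fully_quadratic V" "balanced (concat cs) \<Longrightarrow> balanced V" "length V \<le> length (concat cs)"
    "CJ (map (\<lambda>j. cls (flipw (fl j) (cs ! j))) [0..<length cs]) zs = cls V"
    "\<And>k. k \<le> length cs \<Longrightarrow>
       flen (CJ (map (\<lambda>j. cls (flipw (fl j) (cs ! j))) [0..<k]) (take k zs)) \<le> 2 * length (concat cs)"
    "\<And>z. z \<in> set zs \<Longrightarrow> flen z \<le> 3 * length (concat cs)"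
    "\<And>u0 :: 'b \<Rightarrow> bit. \<exists>u. (\<forall>b\<in>fst ` set V. u b = u0 b) \<and> (\<forall>c\<in>set cs. ev u c = 0)"
proof -
  let ?m = "length cs" and ?C = "length (concat cs)"
  have "Suc (?m - 1) = ?m" "?m - 1 < ?m" using \<rho> by simp_all
  then have "\<exists>D K fl T cr. card D = ?m \<and> glued cs \<rho> D K fl T cr"
    using glued_exists[OF fq \<rho>, of "?m - 1"] by (simp only: simp_thms if_True)
  then
  obtain D K fl T cr where "card D = ?m" and g: "glued cs \<rho> D K fl T cr" by blast
  moreover have "D \<subseteq> {..<?m}" using g by (simp add: glued_def)
  ultimately have D: "D = {..<?m}" by (metis card_lessThan card_subset_eq finite_lessThan)
  let ?V = "read UNIV K" and ?c = "\<lambda>j. cls (flipw (fl j) (cs ! j))"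
  have C: "(\<Sum>j\<in>D. length (cs ! j)) = ?C" by (simp add: D length_concat_sum)
  have lenC: "length (cs ! j) \<le> ?C" if "j < ?m" for j
    unfolding length_concat_sum using that by (intro member_le_sum) auto
  have len: "length (read S K) \<le> 2 * ?C" for S
    using length_read[of S K] g C by (simp add: glued_def)
  have "\<exists>z. flen z \<le> 3 * ?C \<and> (k = \<rho> \<longrightarrow> z = 0) \<and>
      cls (read {..<Suc k} K) = cls (read {..<k} K) + conjg (?c k) z" if k: "k < ?m" for k
  proof -
    have "k \<in> set (marks K)" using g D k by (simp add: glued_def)
    then obtain v where v: "Mark k v \<in> set K" by (auto simp: in_marks)
    then obtain K1 K2 where K: "K = K1 @ Mark k v # K2" by (meson split_list)
    obtain r where r: "flen r \<le> length (cs ! k)" "k = \<rho> \<longrightarrow> r = 0" "cls v = r - ?c k - r"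
      using glued_mark[OF g] v by blast
    have dist: "k \<notin> set (marks K1)" "k \<notin> set (marks K2)" using g by (auto simp: glued_def K)
    have e: "read {..<Suc k} K1 = read {..<k} K1" "read {..<Suc k} K2 = read {..<k} K2"
      using dist by (auto intro!: read_cong simp: less_Suc_eq)
    \<comment> \<open>Dropping \<open>v\<close> from \<open>K1 v K2\<close> multiplies on the right
      by the inverse of \<open>v\<close> conjugated by \<open>K2\<close>, and that inverse is
      \<open>?c k\<close> conjugated by \<open>- r\<close>. Hence the conjugator
      \<open>- r + ?f\<close>.\<close>
    let ?f = "cls (read {..<k} K2)"
    have "flen (- r + ?f) \<le> ?C + 2 * ?C"
      using flen_add[of "- r" ?f] r(1) lenC[OF k] flen_cls[of "read {..<k} K2"]
        len[of "{..<k}"] by (simp add: K)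
    moreover have "- r + ?f = 0" if "k = \<rho>"
    proof -
      obtain K0 v0 where "K = K0 @ [Mark \<rho> v0]" using g by (auto simp: glued_def)
      then have "K2 = []"
        using K dist that by (cases K2 rule: rev_cases) auto
      with r that show ?thesis by simp
    qed
    moreover have "cls (read {..<Suc k} K) = cls (read {..<k} K) + conjg (?c k) (- r + ?f)"
      by (simp add: K e cls_append r(3) conjg_def group_word_simps
          del: add_uminus_conv_diff)
    ultimately show ?thesis by (intro exI[of _ "- r + ?f"]) auto
  qed
  then obtain z where z: "\<And>k. k < ?m \<Longrightarrow> flen (z k) \<le> 3 * ?C" "\<rho> < ?m \<Longrightarrow> z \<rho> = 0"
    "\<And>k. k < ?m \<Longrightarrow> cls (read {..<Suc k} K) = cls (read {..<k} K) + conjg (?c k) (z k)"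
    by metis
  let ?zs = "map z [0..<?m]"
  have part: "CJ (map ?c [0..<k]) (map z [0..<k]) = cls (read {..<k} K)" if "k \<le> ?m" for k
    using that
  proof (induction k)
    case 0
    then show ?case using g by (simp add: glued_def)
  next
    case (Suc k)
    then show ?case using z(3)[of k] by (simp add: CJ_snoc)
  qed
  have take: "take k ?zs = map z [0..<k]" if "k \<le> ?m" for k
    using that by (simp add: take_map)
  have V: "read {..<?m} K = ?V"
    using g D by (intro read_cong) (auto simp: glued_def)
  have all0: "fully_quadratic ?V" unfolding fully_quadratic_def
  proof
    fix b
    show "occ ?V b = 0 \<or> occ ?V b = 2"
    proof (cases "b \<in> T")
      case True
      then show ?thesis using g by (simp add: glued_def)
    next
      case False
      then show ?thesis using glued_occ[OF g] fq by (simp add: fully_quadratic_def occ_concat D)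
    qed
  qed
  show thesis
  proof (rule that[of ?zs fl ?V])
    show "length ?zs = ?m" by simp
    show "?zs ! \<rho> = 0" using z(2) \<rho> by simp
    show "\<not> fl \<rho>" using g by (simp add: glued_def)
    show "balanced (concat cs) \<Longrightarrow> \<forall>j. \<not> fl j" using g by (simp add: glued_def)
    show "fully_quadratic ?V" by fact
    show "balanced ?V" if bal: "balanced (concat cs)" unfolding balanced_def
    proof
      fix b
      have nf: "\<not> fl i" for i using g bal by (simp add: glued_def)
      show "count_list ?V (b, True) = count_list ?V (b, False)"
      proof (cases "b \<in> T")
        case True
        then have "occ ?V b = 0" using g by (simp add: glued_def)
        then show ?thesis by (simp add: occ_def)
      next
        case False
        then show ?thesis
          using g bal nf by (simp add: glued_def D flipw_def balanced_def count_list_concat)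
      qed
    qed
    show "length ?V \<le> ?C" using g C by (simp add: glued_def)
    show "CJ (map ?c [0..<?m]) ?zs = cls ?V" using part[of ?m] V by simp
    show "flen (CJ (map ?c [0..<k]) (take k ?zs)) \<le> 2 * ?C" if "k \<le> ?m" for k
      using part[OF that] take[OF that] flen_cls[of "read {..<k} K"] len[of "{..<k}"] by simp
    show "flen y \<le> 3 * ?C" if "y \<in> set ?zs" for y using that z(1) by auto
    show "\<exists>u. (\<forall>b\<in>fst ` set ?V. u b = u0 b) \<and> (\<forall>c\<in>set cs. ev u c = 0)" for u0 :: "'b \<Rightarrow> bit"
    proof -
      obtain u where u: "\<forall>b. b \<notin> T \<longrightarrow> u b = u0 b" "\<forall>j\<in>D - {cr}. ev u (cs ! j) = 0"
        using glued_functional[OF g] by blast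
      have "b \<notin> T" if "b \<in> fst ` set ?V" for b
        using g that occ_eq_0[of ?V b] by (auto simp: glued_def)
      moreover have "ev u (cs ! j) = 0" if "j < ?m" for j
        using glued_root_closed[OF g, of u j] u(2) that D all0
        unfolding fully_quadratic_def by blast
      ultimately show ?thesis using u(1) by (metis in_set_conv_nth)
    qed
  qed
qed

section \<open>Giving cancelling coefficient letters a common name\<close>

lemma not_freely_reduced: "\<not> freely_reduced w \<Longrightarrow> \<exists>u k v. w = u @ k # inv_letter k # v"
proof (induction w rule: freely_reduced.induct)
  case (1 k l w)
  show ?case
  proof (cases "l = inv_letter k")
    case True
    then show ?thesis by (intro exI[of _ "[]"]) simp
  next
    case False
    with 1 obtain u j v where "l # w = u @ j # inv_letter j # v" by auto
    then show ?thesis by (intro exI[of _ "k # u"]) simp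
  qed
qed simp_all

lemma cls_eq_0_cases:
  assumes "cls w = 0" "w \<noteq> []"
  shows "\<exists>u k v. w = u @ k # inv_letter k # v"
proof (rule not_freely_reduced)
  have "free_reduction w = rep_fg (cls [])" using assms(1) rep_cls[of w] by simp
  then have "free_reduction w = []" by (simp only: rep_cls free_reduction_Nil)
  with assms(2) show "\<not> freely_reduced w" using free_reduction_id by force
qed

lemma cls_map_cancel:
  assumes "l q = inv_letter (l p)"
  shows "cls (map l (us @ p # q # vs)) = cls (map l (us @ vs))"
  using assms cls_inv_word[of "[l p]"] cls_append[of "[l p]" "inv_letter (l p) # map l vs"]
    cls_append[of "[inv_letter (l p)]" "map l vs"]
  by (simp add: cls_append)

text \<open>The pairing \<tau> records how the letters cancel. Cancellation only needs the two
  letters of each pair to be inverse, so it can be repeated for every labelling that respects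
  \<tau>, over any alphabet.\<close>

lemma cancellation_matching:
  fixes lam :: "'p \<Rightarrow> 'a letter"
  shows "distinct ps \<Longrightarrow> cls (map lam ps) = 0 \<Longrightarrow>
    \<exists>\<tau>. (\<forall>p\<in>set ps. \<tau> p \<in> set ps \<and> \<tau> p \<noteq> p \<and> \<tau> (\<tau> p) = p \<and> lam (\<tau> p) = inv_letter (lam p)) \<and>
      (\<forall>lam' :: 'p \<Rightarrow> 'b letter.
         (\<forall>p\<in>set ps. lam' (\<tau> p) = inv_letter (lam' p)) \<longrightarrow> cls (map lam' ps) = 0)"
proof (induction "length ps" arbitrary: ps rule: less_induct)
  case less
  show ?case
  proof (cases "ps = []")
    case True
    then show ?thesis by simp
  next
    case False
    with cls_eq_0_cases[OF less.prems(2)]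
    obtain u k v where "map lam ps = u @ k # inv_letter k # v" by auto
    then obtain us p q vs where ps: "ps = us @ p # q # vs" and lam: "lam q = inv_letter (lam p)"
      by (auto simp: map_eq_append_conv map_eq_Cons_conv)
    have dist: "distinct (us @ vs)" using less.prems(1) by (simp add: ps)
    moreover have "cls (map lam (us @ vs)) = 0"
      using less.prems(2) cls_map_cancel[of lam, OF lam] by (simp add: ps)
    moreover have "length (us @ vs) < length ps" by (simp add: ps)
    ultimately obtain \<tau> where
      \<tau>: "\<forall>x\<in>set (us @ vs). \<tau> x \<in> set (us @ vs) \<and> \<tau> x \<noteq> x \<and> \<tau> (\<tau> x) = x \<and> lam (\<tau> x) = inv_letter (lam x)"
      and \<tau>': "\<forall>lam' :: 'p \<Rightarrow> 'b letter.
         (\<forall>x\<in>set (us @ vs). lam' (\<tau> x) = inv_letter (lam' x)) \<longrightarrow> cls (map lam' (us @ vs)) = 0"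
      using less.hyps[of "us @ vs"] by blast
    let ?\<tau> = "\<tau>(p := q, q := p)"
    have pq: "p \<notin> set (us @ vs)" "q \<notin> set (us @ vs)" "p \<noteq> q" using less.prems(1) by (auto simp: ps)
    have eq: "?\<tau> x = \<tau> x" if "x \<in> set (us @ vs)" for x using that pq by auto
    have set: "set ps = insert p (insert q (set (us @ vs)))" by (auto simp: ps)
    have "?\<tau> x \<in> set ps \<and> ?\<tau> x \<noteq> x \<and> ?\<tau> (?\<tau> x) = x \<and> lam (?\<tau> x) = inv_letter (lam x)"
      if "x \<in> set ps" for x
    proof (cases "x \<in> set (us @ vs)")
      case True
      then have t: "\<tau> x \<in> set (us @ vs)" using \<tau> by blast
      from True \<tau> set show ?thesis unfolding eq[OF True] eq[OF t] by blast
    next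
      case False
      with that set have "x = p \<or> x = q" by blast
      moreover have "lam p = inv_letter (lam q)" using lam by simp
      ultimately show ?thesis using pq(3) lam set by auto
    qed
    moreover have "cls (map lam' ps) = 0"
      if l: "\<forall>x\<in>set ps. lam' (?\<tau> x) = inv_letter (lam' x)" for lam' :: "'p \<Rightarrow> 'b letter"
    proof -
      have "p \<in> set ps" by (simp add: ps)
      from bspec[OF l this] have "lam' q = inv_letter (lam' p)" using pq(3) by simp
      moreover have "lam' (\<tau> x) = inv_letter (lam' x)" if x: "x \<in> set (us @ vs)" for x
      proof -
        have "x \<in> set ps" using x set by blast
        from bspec[OF l this] show ?thesis unfolding eq[OF x] .
      qed
      ultimately show ?thesis using \<tau>' cls_map_cancel[of lam' q p us vs] by (simp add: ps)
    qed
    ultimately show ?thesis by (intro exI[of _ ?\<tau>]) blast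
  qed
qed

text \<open>The orbits of two involutions are paths or cycles, so each of them contains
  no fixed point or exactly two.\<close>

lemma orbit_labelling:
  fixes g :: "'p \<Rightarrow> 'a"
  shows "finite P \<Longrightarrow> (\<And>p. p \<in> P \<Longrightarrow> \<tau> p \<in> P \<and> \<tau> p \<noteq> p \<and> \<tau> (\<tau> p) = p \<and> g (\<tau> p) = g p) \<Longrightarrow>
    (\<And>p. p \<in> P \<Longrightarrow> \<sigma> p \<in> P \<and> \<sigma> (\<sigma> p) = p \<and> g (\<sigma> p) = g p) \<Longrightarrow>
    \<exists>f :: 'p \<Rightarrow> nat. (\<forall>p\<in>P. f (\<tau> p) = f p \<and> f (\<sigma> p) = f p) \<and>
      (\<forall>n a. card {p\<in>P. \<sigma> p = p \<and> f p = n \<and> g p = a} \<in> {0, 2})"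
proof (induction "card P" arbitrary: P \<sigma> rule: less_induct)
  case less
  note fin = less.prems(1) and \<tau> = less.prems(2) and \<sigma> = less.prems(3)
  show ?case
  proof (cases "\<exists>p\<in>P. \<sigma> p = p")
    case False
    then have "card {p \<in> P. \<sigma> p = p \<and> 0 = n \<and> g p = a} \<in> {0, 2}" for n :: nat and a
      by (auto simp: card_eq_0_iff)
    then show ?thesis by (intro exI[of _ "\<lambda>_. 0"] conjI allI) simp_all
  next
    case True
    then obtain p where p: "p \<in> P" "\<sigma> p = p" by blast
    define q where "q = \<tau> p"
    have q: "q \<in> P" "q \<noteq> p" "\<tau> q = p" "g q = g p" using \<tau>[OF p(1)] by (auto simp: q_def)
    define P' where "P' = P - {p, q}"
    have P: "P = insert p (insert q P')" "p \<notin> P'" "q \<notin> P'" using p q by (auto simp: P'_def)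
    have fin': "finite P'" using fin by (simp add: P'_def)
    have "card P' < card P" using fin p by (intro psubset_card_mono) (auto simp: P'_def)
    note IH = less.hyps[OF this fin']
    have \<tau>': "\<tau> x \<in> P' \<and> \<tau> x \<noteq> x \<and> \<tau> (\<tau> x) = x \<and> g (\<tau> x) = g x" if "x \<in> P'" for x
    proof -
      have x: "x \<in> P" "x \<noteq> p" "x \<noteq> q" using that by (auto simp: P'_def)
      with \<tau>[OF x(1)] have "\<tau> x \<noteq> p" "\<tau> x \<noteq> q" using q q_def by auto
      with \<tau>[OF x(1)] show ?thesis by (simp add: P'_def)
    qed
    show ?thesis
    proof (cases "\<sigma> q = q")
      \<comment> \<open>The path consists of its two ends \<open>p\<close> and \<open>q\<close>
        alone and receives a fresh number.\<close>
      case True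
      have \<sigma>': "\<sigma> x \<in> P' \<and> \<sigma> (\<sigma> x) = x \<and> g (\<sigma> x) = g x" if "x \<in> P'" for x
      proof -
        have x: "x \<in> P" "x \<noteq> p" "x \<noteq> q" using that by (auto simp: P'_def)
        with \<sigma>[OF x(1)] have "\<sigma> x \<noteq> p" "\<sigma> x \<noteq> q" using p True by auto
        with \<sigma>[OF x(1)] show ?thesis by (simp add: P'_def)
      qed
      have "\<exists>f :: 'p \<Rightarrow> nat. (\<forall>x\<in>P'. f (\<tau> x) = f x \<and> f (\<sigma> x) = f x) \<and>
          (\<forall>n a. card {x\<in>P'. \<sigma> x = x \<and> f x = n \<and> g x = a} \<in> {0, 2})"
        by (rule IH; (rule \<tau>' | rule \<sigma>'), assumption)
      then show ?thesis
      proof (elim exE conjE)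
        fix f :: "'p \<Rightarrow> nat"
        assume f: "\<forall>x\<in>P'. f (\<tau> x) = f x \<and> f (\<sigma> x) = f x"
          "\<forall>n a. card {x\<in>P'. \<sigma> x = x \<and> f x = n \<and> g x = a} \<in> {0, 2}"
        obtain n0 where n0: "n0 \<notin> f ` P'"
          using ex_new_if_finite[OF infinite_UNIV_nat finite_imageI[OF fin', of f]] by blast
        let ?f = "f(p := n0, q := n0)"
        have A: "?f (\<tau> x) = ?f x \<and> ?f (\<sigma> x) = ?f x" if "x \<in> P" for x
        proof (cases "x \<in> P'")
          case True
          then have "\<tau> x \<in> P'" "\<sigma> x \<in> P'" using \<tau>' \<sigma>' by auto
          then have "x \<noteq> p" "x \<noteq> q" "\<tau> x \<noteq> p" "\<tau> x \<noteq> q" "\<sigma> x \<noteq> p" "\<sigma> x \<noteq> q"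
            using True P(2,3) by auto
          then show ?thesis using f(1) True by simp
        next
          case False
          with that P have "x = p \<or> x = q" by blast
          then show ?thesis using p q q_def True by auto
        qed
        have B: "card {x\<in>P. \<sigma> x = x \<and> ?f x = n \<and> g x = a} \<in> {0, 2}" for n a
        proof (cases "n = n0")
          case n: True
          have "{x\<in>P. \<sigma> x = x \<and> ?f x = n \<and> g x = a} = (if g p = a then {p, q} else {})"
            using P n0 n p q True by auto
          then show ?thesis using q by simp
        next
          case False
          then have "{x\<in>P. \<sigma> x = x \<and> ?f x = n \<and> g x = a} = {x\<in>P'. \<sigma> x = x \<and> f x = n \<and> g x = a}"
            using P by auto
          then show ?thesis using f(2) by simp
        qed
        show ?thesis
          by (intro exI[of _ ?f] conjI ballI allI)
            (erule A[THEN conjunct1] | erule A[THEN conjunct2] | rule B)+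
      qed
    next
      case False
      \<comment> \<open>The path goes on from \<open>q\<close> to \<open>r\<close>. Cutting off
        \<open>p\<close> and \<open>q\<close> makes \<open>r\<close> an end in place of
        \<open>p\<close>, so the number of ends with given label is unchanged.\<close>
      define r where "r = \<sigma> q"
      have r: "r \<in> P'" "\<sigma> r = q" "r \<noteq> q" "g r = g p"
        using \<sigma>[OF q(1)] False p q unfolding r_def P'_def by auto
      let ?\<sigma> = "\<sigma>(r := r)"
      have \<sigma>': "?\<sigma> x \<in> P' \<and> ?\<sigma> (?\<sigma> x) = x \<and> g (?\<sigma> x) = g x" if x: "x \<in> P'" for x
      proof (cases "x = r")
        case True
        then show ?thesis using x by simp
      next
        case xr: False
        have "x \<in> P" "x \<noteq> p" "x \<noteq> q" using x by (auto simp: P'_def)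
        with \<sigma>[of x] have "\<sigma> x \<in> P" "\<sigma> (\<sigma> x) = x" "g (\<sigma> x) = g x" by auto
        moreover have "\<sigma> x \<noteq> p" "\<sigma> x \<noteq> q" "\<sigma> x \<noteq> r"
          using \<open>\<sigma> (\<sigma> x) = x\<close> p r xr \<open>x \<noteq> p\<close> \<open>x \<noteq> q\<close> by (auto simp: r_def)
        ultimately show ?thesis using xr by (simp add: P'_def)
      qed
      have "\<exists>f :: 'p \<Rightarrow> nat. (\<forall>x\<in>P'. f (\<tau> x) = f x \<and> f (?\<sigma> x) = f x) \<and>
          (\<forall>n a. card {x\<in>P'. ?\<sigma> x = x \<and> f x = n \<and> g x = a} \<in> {0, 2})"
        by (rule IH; (rule \<tau>' | rule \<sigma>'), assumption)
      then show ?thesis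
      proof (elim exE conjE)
        fix f :: "'p \<Rightarrow> nat"
        assume f: "\<forall>x\<in>P'. f (\<tau> x) = f x \<and> f (?\<sigma> x) = f x"
          "\<forall>n a. card {x\<in>P'. ?\<sigma> x = x \<and> f x = n \<and> g x = a} \<in> {0, 2}"
        let ?f = "f(p := f r, q := f r)"
        have ne: "r \<noteq> p" using r P by auto
        have A: "?f (\<tau> x) = ?f x \<and> ?f (\<sigma> x) = ?f x" if "x \<in> P" for x
        proof (cases "x \<in> P'")
          case True
          then have t: "\<tau> x \<in> P'" "x \<noteq> p" "x \<noteq> q" using \<tau>' P by auto
          then have "\<tau> x \<noteq> p" "\<tau> x \<noteq> q" using P by auto
          then have 1: "?f (\<tau> x) = ?f x" using t f(1) True by simp
          have "?f (\<sigma> x) = ?f x"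
          proof (cases "x = r")
            case True
            then show ?thesis using r ne q by simp
          next
            case xr: False
            then have "\<sigma> x \<in> P'" using \<sigma>'[OF True] by simp
            then have "\<sigma> x \<noteq> p" "\<sigma> x \<noteq> q" using P by auto
            then show ?thesis using t f(1) True xr by auto
          qed
          with 1 show ?thesis ..
        next
          case False
          with that P have "x = p \<or> x = q" by blast
          then show ?thesis using p q q_def r ne by (auto simp: r_def)
        qed
        have B: "card {x\<in>P. \<sigma> x = x \<and> ?f x = n \<and> g x = a} \<in> {0, 2}" for n a
        proof -
          let ?S' = "{x\<in>P'. ?\<sigma> x = x \<and> f x = n \<and> g x = a}"
          have "{x\<in>P. \<sigma> x = x \<and> ?f x = n \<and> g x = a} = (\<lambda>x. if x = r then p else x) ` ?S'"
          proof (intro equalityI subsetI)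
            fix x assume x: "x \<in> {x\<in>P. \<sigma> x = x \<and> ?f x = n \<and> g x = a}"
            have "x \<noteq> q" "x \<noteq> r" using x False r q by auto
            show "x \<in> (\<lambda>x. if x = r then p else x) ` ?S'"
            proof (cases "x = p")
              case True
              then show ?thesis using x r q by (intro image_eqI[of _ _ r]) auto
            next
              case False
              then show ?thesis using x \<open>x \<noteq> q\<close> \<open>x \<noteq> r\<close> P(1) by (intro image_eqI[of _ _ x]) auto
            qed
          next
            fix x assume "x \<in> (\<lambda>x. if x = r then p else x) ` ?S'"
            then obtain y where y: "y \<in> P'" "?\<sigma> y = y" "f y = n" "g y = a" "x = (if y = r then p else y)"
              by blast
            then show "x \<in> {x\<in>P. \<sigma> x = x \<and> ?f x = n \<and> g x = a}"
            proof (cases "y = r")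
              case True
              then show ?thesis using y r p by simp
            next
              case False
              then have "x = y" "y \<noteq> p" "y \<noteq> q" "\<sigma> y = y" using y P(2,3) by auto
              then show ?thesis using y P(1) by simp
            qed
          qed
          moreover have "inj_on (\<lambda>x. if x = r then p else x) ?S'"
            using P by (auto simp: inj_on_def)
          ultimately have "card {x\<in>P. \<sigma> x = x \<and> ?f x = n \<and> g x = a} = card ?S'"
            by (simp only: card_image)
          then show ?thesis using f(2)[rule_format, of n a] by (simp only:)
        qed
        show ?thesis
          by (intro exI[of _ ?f] conjI ballI allI)
            (erule A[THEN conjunct1] | erule A[THEN conjunct2] | rule B)+
      qed
    qed
  qed
qed

section \<open>Positions of letters in a word after substitution\<close>

definition expand :: "('p \<Rightarrow> 'a letter) \<Rightarrow> ('x \<Rightarrow> 'a word) \<Rightarrow> ('p + 'x \<times> bool) list \<Rightarrow> 'a word" where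
  "expand lam \<alpha> Q =
     concat (map (case_sum (\<lambda>p. [lam p]) (\<lambda>(x, s). if s then \<alpha> x else inv_word (\<alpha> x))) Q)"

text \<open>The old name is kept beside the new number, so forgetting the number recovers the
  original coefficients.\<close>

definition relabel :: "('p \<Rightarrow> nat) \<Rightarrow> ('p \<Rightarrow> 'a letter) \<Rightarrow> 'p \<Rightarrow> ('a \<times> nat) letter" where
  "relabel f lam p = ((fst (lam p), f p), snd (lam p))"

lemma partner_exists:
  assumes "card {i\<in>I. R i} = 2"
  shows "\<exists>p. \<forall>i\<in>I. R i \<longrightarrow> p i \<in> I \<and> R (p i) \<and> p (p i) = i \<and> p i \<noteq> i \<and>
    (\<forall>j\<in>I. R j \<longrightarrow> j = i \<or> j = p i)"
proof -
  obtain a b where ab: "{i\<in>I. R i} = {a, b}" "a \<noteq> b" using assms by (auto simp: card_2_iff)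
  then have "i \<in> I \<and> R i \<longleftrightarrow> i = a \<or> i = b" for i by blast
  then show ?thesis using ab(2) by (intro exI[of _ "id(a := b, b := a)"]) auto
qed

text \<open>Positions in an inverse occurrence are listed backwards, so that one index
  \<open>k\<close> names the same letter of the value in both occurrences of a variable.\<close>

definition pos_of :: "('x \<Rightarrow> nat) \<Rightarrow> 'p + 'x \<times> bool \<Rightarrow> nat list" where
  "pos_of n q = (case q of Inl p \<Rightarrow> [0] | Inr (x, s) \<Rightarrow> if s then [0..<n x] else rev [0..<n x])"

definition positions :: "('x \<Rightarrow> nat) \<Rightarrow> ('p + 'x \<times> bool) list \<Rightarrow> (nat \<times> nat) list" where
  "positions n Q = concat (map (\<lambda>i. map (Pair i) (pos_of n (Q ! i))) [0..<length Q])"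

lemma pos_of_simps [simp]:
  "pos_of n (Inl p) = [0]" "set (pos_of n (Inr (x, s))) = {..<n x}"
  by (auto simp: pos_of_def)

lemma set_positions: "(i, k) \<in> set (positions n Q) \<longleftrightarrow> i < length Q \<and> k \<in> set (pos_of n (Q ! i))"
  by (auto simp: positions_def)

lemma distinct_positions: "distinct (positions n Q)"
proof -
  have "distinct (concat (map (\<lambda>i. map (Pair i) (pos_of n (Q ! i))) [0..<m]))" for m
  proof (induction m)
    case (Suc m)
    have "distinct (pos_of n (Q ! m))" by (simp add: pos_of_def split: sum.split)
    with Suc show ?case by (auto simp: distinct_map inj_on_def)
  qed simp
  then show ?thesis by (simp add: positions_def)
qed

lemma expand_positions:
  assumes l1: "\<And>i p. i < length Q \<Longrightarrow> Q ! i = Inl p \<Longrightarrow> l' (i, 0) = l p"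
    and l2: "\<And>i x s k. i < length Q \<Longrightarrow> Q ! i = Inr (x, s) \<Longrightarrow> k < n x \<Longrightarrow>
      l' (i, k) = (if s then a x ! k else inv_letter (a x ! k))"
    and len: "\<And>x. length (a x) = n x"
  shows "expand l a Q = map l' (positions n Q)"
proof -
  have "map l' (map (Pair i) (pos_of n (Q ! i)))
      = case_sum (\<lambda>p. [l p]) (\<lambda>(x, s). if s then a x else inv_word (a x)) (Q ! i)"
    if i: "i < length Q" for i
  proof (cases "Q ! i")
    case (Inl p)
    then show ?thesis using l1[OF i Inl] by simp
  next
    case (Inr y)
    obtain x s where y: "y = (x, s)" by (cases y)
    note xs = Inr[unfolded y]
    show ?thesis
    proof (cases s)
      case True
      have "map (\<lambda>k. l' (i, k)) [0..<n x] = map (nth (a x)) [0..<length (a x)]"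
        using l2[OF i xs] True len by (intro map_cong) auto
      then have "map (\<lambda>k. l' (i, k)) [0..<n x] = a x" by (simp only: map_nth)
      then show ?thesis using True xs by (simp add: pos_of_def comp_def)
    next
      case False
      have "map (\<lambda>k. l' (i, k)) [0..<n x] = map inv_letter (map (nth (a x)) [0..<length (a x)])"
        using l2[OF i xs] False len by simp
      then have "map (\<lambda>k. l' (i, k)) [0..<n x] = map inv_letter (a x)"
        by (simp only: map_nth)
      then have "map (\<lambda>k. l' (i, k)) (rev [0..<n x]) = inv_word (a x)"
        by (simp only: rev_map[symmetric] inv_word_def)
      then show ?thesis using False xs by (simp add: pos_of_def comp_def)
    qed
  qed
  then have "map (\<lambda>i. map l' (map (Pair i) (pos_of n (Q ! i)))) [0..<length Q] =
      map (\<lambda>i. case_sum (\<lambda>p. [l p]) (\<lambda>(x, s). if s then a x else inv_word (a x)) (Q ! i)) [0..<length Q]"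
    by (intro map_cong) auto
  also have "\<dots> = map (case_sum (\<lambda>p. [l p]) (\<lambda>(x, s). if s then a x else inv_word (a x))) Q"
    by (rule nth_equalityI) simp_all
  finally show ?thesis by (simp only: expand_def positions_def map_concat map_map comp_def)
qed

lemma count_list_unique:
  assumes "count_list xs y \<le> 1" "i < length xs" "j < length xs" "xs ! i = y" "xs ! j = y"
  shows "i = j"
proof -
  have "card {i. i < length xs \<and> xs ! i = y} \<le> 1"
    using assms(1) by (simp add: count_list_eq_length_filter length_filter_conv_card eq_commute)
  moreover have "finite {i. i < length xs \<and> xs ! i = y}" by simp
  ultimately show ?thesis using assms(2-) by (auto simp: card_le_Suc0_iff_eq)
qed

text \<open>\<tau> pairs the positions that cancel, \<sigma> those of equal index in the two
  occurrences of a variable, and the fixed points of \<sigma> are the coefficient letters. Numbering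
  the letters by common orbits keeps both occurrences of each variable consistent and keeps all
  cancellations, while each number and old name belong to none or two of the coefficient
  letters.\<close>

lemma labelling:
  fixes Q :: "('p + 'x \<times> bool) list" and lam :: "'p \<Rightarrow> 'a letter"
  assumes zero: "cls (expand lam \<alpha> Q) = 0"
    and coefs: "\<And>p. count_list Q (Inl p) \<le> 1"
    and vars: "\<And>x. card {i\<in>{..<length Q}. \<exists>s. Q ! i = Inr (x, s)} \<in> {0, 2}"
  shows "\<exists>(f :: 'p \<Rightarrow> nat) \<alpha>'. cls (expand (relabel f lam) \<alpha>' Q) = 0 \<and>
    (\<forall>n a. card {p. Inl p \<in> set Q \<and> f p = n \<and> fst (lam p) = a} \<in> {0, 2})"
proof -
  let ?I = "{..<length Q}"
  define n where "n x = length (\<alpha> x)" for x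
  define ps where "ps = positions n Q"
  define lam2 where "lam2 = (\<lambda>(i, k). case Q ! i of Inl p \<Rightarrow> lam p | Inr (x, s) \<Rightarrow>
    if s then \<alpha> x ! k else inv_letter (\<alpha> x ! k))"
  have lam2_simps: "Q ! i = Inl p \<Longrightarrow> lam2 (i, k) = lam p"
    "Q ! i = Inr (x, s) \<Longrightarrow> lam2 (i, k) = (if s then \<alpha> x ! k else inv_letter (\<alpha> x ! k))" for i k p x s
    by (simp_all add: lam2_def)
  have "expand lam \<alpha> Q = map lam2 ps"
    unfolding ps_def by (rule expand_positions) (simp_all add: lam2_simps n_def)
  with zero have "cls (map lam2 ps) = 0" by simp
  with distinct_positions obtain \<tau> where
    \<tau>: "\<forall>p\<in>set ps. \<tau> p \<in> set ps \<and> \<tau> p \<noteq> p \<and> \<tau> (\<tau> p) = p \<and> lam2 (\<tau> p) = inv_letter (lam2 p)"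
    and \<tau>': "\<forall>lam' :: nat \<times> nat \<Rightarrow> ('a \<times> nat) letter.
       (\<forall>p\<in>set ps. lam' (\<tau> p) = inv_letter (lam' p)) \<longrightarrow> cls (map lam' ps) = 0"
    using cancellation_matching[of ps lam2] unfolding ps_def by blast
  let ?R = "\<lambda>x i. \<exists>s. Q ! i = Inr (x, s)"
  let ?partner = "\<lambda>x p. \<forall>i\<in>?I. ?R x i \<longrightarrow> p i \<in> ?I \<and> ?R x (p i) \<and> p (p i) = i \<and> p i \<noteq> i \<and>
    (\<forall>j\<in>?I. ?R x j \<longrightarrow> j = i \<or> j = p i)"
  have "\<exists>p. ?partner x p" for x
  proof (cases "card {i\<in>?I. ?R x i} = 2")
    case True
    then show ?thesis by (rule partner_exists)
  next
    case False
    then have "card {i\<in>?I. ?R x i} = 0" using vars[of x] by blast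
    then have "{i\<in>?I. ?R x i} = {}" by simp
    then show ?thesis by blast
  qed
  then have "\<exists>pt. \<forall>x. ?partner x (pt x)" by (intro choice allI)
  then obtain pt where pt_all: "\<forall>x. ?partner x (pt x)" ..
  have pt: "pt x i < length Q" "\<exists>t. Q ! pt x i = Inr (x, t)" "pt x (pt x i) = i" "pt x i \<noteq> i"
    "\<And>j t. j < length Q \<Longrightarrow> Q ! j = Inr (x, t) \<Longrightarrow> j = i \<or> j = pt x i"
    if "i < length Q" "Q ! i = Inr (x, s)" for x i s
    using pt_all[THEN spec[of _ x]] that by auto
  define oth where "oth i = (case Q ! i of Inl p \<Rightarrow> i | Inr (x, s) \<Rightarrow> pt x i)" for i
  define \<sigma> where "\<sigma> = (\<lambda>(i, k :: nat). (oth i, k))"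
  have \<sigma>_Inl: "\<sigma> (i, k) = (i, k)" if "Q ! i = Inl p" for i k p
    using that by (simp add: \<sigma>_def oth_def)
  have \<sigma>_Inr: "\<sigma> (i, k) = (pt x i, k)" if "Q ! i = Inr (x, s)" for i k x s
    using that by (simp add: \<sigma>_def oth_def)
  have \<sigma>: "\<sigma> p \<in> set ps \<and> \<sigma> (\<sigma> p) = p \<and> fst (lam2 (\<sigma> p)) = fst (lam2 p)" if p: "p \<in> set ps" for p
  proof -
    obtain i k where ik: "p = (i, k)" by (cases p)
    then have i: "i < length Q" and k: "k \<in> set (pos_of n (Q ! i))"
      using p by (simp_all add: ps_def set_positions)
    show ?thesis
    proof (cases "Q ! i")
      case (Inl q)
      then show ?thesis using p ik by (simp add: \<sigma>_Inl)
    next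
      case (Inr y)
      obtain x s where y: "y = (x, s)" by (cases y)
      note q = Inr[unfolded y]
      note pt = pt[OF i q]
      obtain t where t: "Q ! pt x i = Inr (x, t)" using pt(2) by blast
      show ?thesis
        using pt(1,3) k q t ik
          by (simp add: \<sigma>_Inr[OF q] \<sigma>_Inr[OF t] ps_def set_positions lam2_simps)
    qed
  qed
  have "\<exists>f :: nat \<times> nat \<Rightarrow> nat. (\<forall>p\<in>set ps. f (\<tau> p) = f p \<and> f (\<sigma> p) = f p) \<and>
      (\<forall>n a. card {p\<in>set ps. \<sigma> p = p \<and> f p = n \<and> fst (lam2 p) = a} \<in> {0, 2})"
    by (rule orbit_labelling) (use \<tau> \<sigma> in simp_all)
  then show ?thesis
  proof (elim exE conjE)
    fix f2 :: "nat \<times> nat \<Rightarrow> nat"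
    assume f2: "\<forall>p\<in>set ps. f2 (\<tau> p) = f2 p \<and> f2 (\<sigma> p) = f2 p"
      and card: "\<forall>n a. card {p\<in>set ps. \<sigma> p = p \<and> f2 p = n \<and> fst (lam2 p) = a} \<in> {0, 2}"
    define lam3 where "lam3 p = ((fst (lam2 p), f2 p), snd (lam2 p))" for p
    have "lam3 (\<tau> p) = inv_letter (lam3 p)" if "p \<in> set ps" for p
      using \<tau> f2 that by (simp add: lam3_def inv_letter_def)
    then have zero3: "cls (map lam3 ps) = 0" using \<tau>' by blast
    define idx where "idx p = (SOME i. i < length Q \<and> Q ! i = Inl p)" for p
    define first where "first x = (SOME i. i < length Q \<and> (\<exists>s. Q ! i = Inr (x, s)))" for x
    define f where "f p = f2 (idx p, 0)" for p
    \<comment> \<open>The numbers are read off at one chosen occurrence of \<open>x\<close>; the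
      other has the same ones because \<open>f2\<close> is invariant under \<sigma>.\<close>
    define \<alpha>' where "\<alpha>' x = map (\<lambda>k. ((fst (\<alpha> x ! k), f2 (first x, k)), snd (\<alpha> x ! k))) [0..<n x]" for x
    have idx: "idx p = i" if "i < length Q" "Q ! i = Inl p" for i p
    proof -
      have "idx p < length Q \<and> Q ! idx p = Inl p"
        unfolding idx_def by (rule someI[of _ i]) (use that in simp)
      then show ?thesis using count_list_unique[OF coefs[of p]] that by blast
    qed
    have first: "f2 (first x, k) = f2 (i, k)" if i: "i < length Q" "Q ! i = Inr (x, s)" "k < n x" for i x s k
    proof -
      have "first x < length Q \<and> (\<exists>s. Q ! first x = Inr (x, s))"
        unfolding first_def by (rule someI[of _ i]) (use i in blast)
      then obtain t where "first x < length Q" "Q ! first x = Inr (x, t)" by blast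
      from pt(5)[OF i(1,2) this] show ?thesis
      proof
        assume "first x = pt x i"
        moreover have "(i, k) \<in> set ps" using i by (simp add: ps_def set_positions)
        ultimately show ?thesis using f2 \<sigma>_Inr[OF i(2), of k] by fastforce
      qed simp
    qed
    have "expand (relabel f lam) \<alpha>' Q = map lam3 ps"
      unfolding ps_def
    proof (rule expand_positions)
      fix i p assume "i < length Q" "Q ! i = Inl p"
      then show "lam3 (i, 0) = relabel f lam p"
        by (simp add: lam3_def relabel_def lam2_simps f_def idx)
    next
      fix i x s k assume i: "i < length Q" "Q ! i = Inr (x, s)" "k < n x"
      show "lam3 (i, k) = (if s then \<alpha>' x ! k else inv_letter (\<alpha>' x ! k))"
        using i first[OF i] by (simp add: lam3_def lam2_simps \<alpha>'_def inv_letter_def)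
    next
      fix x show "length (\<alpha>' x) = n x" by (simp add: \<alpha>'_def)
    qed
    with zero3 have 1: "cls (expand (relabel f lam) \<alpha>' Q) = 0" by simp
    have 2: "card {p. Inl p \<in> set Q \<and> f p = m \<and> fst (lam p) = a} \<in> {0, 2}" for m a
    proof -
      let ?S = "{p. Inl p \<in> set Q \<and> f p = m \<and> fst (lam p) = a}"
      let ?T = "{p\<in>set ps. \<sigma> p = p \<and> f2 p = m \<and> fst (lam2 p) = a}"
      have img: "(\<lambda>p. (idx p, 0 :: nat)) ` ?S = ?T"
      proof (intro equalityI subsetI)
        fix z assume "z \<in> (\<lambda>p. (idx p, 0 :: nat)) ` ?S"
        then obtain p where p: "Inl p \<in> set Q" "f p = m" "fst (lam p) = a" "z = (idx p, 0)" by blast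
        then obtain i where i: "i < length Q" "Q ! i = Inl p" by (auto simp: in_set_conv_nth)
        with p idx[OF i] show "z \<in> ?T"
          by (simp add: ps_def set_positions \<sigma>_Inl lam2_simps f_def)
      next
        fix z assume z: "z \<in> ?T"
        obtain i k where ik: "z = (i, k)" by (cases z)
        then have i: "i < length Q" and k: "k \<in> set (pos_of n (Q ! i))"
          using z by (simp_all add: ps_def set_positions)
        show "z \<in> (\<lambda>p. (idx p, 0 :: nat)) ` ?S"
        proof (cases "Q ! i")
          case (Inl p)
          then have "Inl p \<in> set Q" using i by (metis nth_mem)
          then show ?thesis
            using z ik k Inl idx[OF i Inl]
              by (intro image_eqI[of _ _ p]) (simp_all add: f_def lam2_simps)
        next
          case (Inr y)
          obtain x s where y: "y = (x, s)" by (cases y)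
          note q = Inr[unfolded y]
          then show ?thesis using pt(4)[OF i q] z ik by (simp add: \<sigma>_Inr[OF q])
        qed
      qed
      have "inj_on (\<lambda>p. (idx p, 0 :: nat)) ?S"
      proof (rule inj_onI)
        fix p q assume p: "p \<in> ?S" and q: "q \<in> ?S" and e: "(idx p, 0 :: nat) = (idx q, 0)"
        obtain i j where "i < length Q" "Q ! i = Inl p" "j < length Q" "Q ! j = Inl q"
          using p q by (auto simp: in_set_conv_nth)
        with e idx show "p = q" by auto
      qed
      from card_image[OF this] have "card ?T = card ?S" unfolding img .
      with card[rule_format, of m a] show ?thesis by (simp only:)
    qed
    from 1 2 show ?thesis by (intro exI[of _ f] exI[of _ \<alpha>'] conjI allI)
  qed
qed

section \<open>The equation as a formal quadratic word\<close>

datatype var = VZ nat | VS nat | VA nat | VB nat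

definition conj_items :: "(nat \<Rightarrow> nat) \<Rightarrow> nat \<Rightarrow> (nat \<times> nat + var \<times> bool) list" where
  "conj_items len m = concat (map (\<lambda>i.
     Inr (VZ i, False) # map (\<lambda>j. Inl (i, j)) [0..<len i] @ [Inr (VZ i, True)]) [0..<m])"

definition square_items :: "nat \<Rightarrow> (nat \<times> nat + var \<times> bool) list" where
  "square_items k = concat (map (\<lambda>i. [Inr (VS i, True), Inr (VS i, True)]) [0..<k])"

definition comm_items :: "nat \<Rightarrow> (nat \<times> nat + var \<times> bool) list" where
  "comm_items h = concat (map (\<lambda>i.
     [Inr (VA i, False), Inr (VB i, False), Inr (VA i, True), Inr (VB i, True)]) [0..<h])"

lemma expand_append: "expand lam \<alpha> (Q @ R) = expand lam \<alpha> Q @ expand lam \<alpha> R"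
  by (simp add: expand_def)

lemma expand_Inl: "expand lam \<alpha> (map (\<lambda>j. Inl (g j)) js) = map (\<lambda>j. lam (g j)) js"
  by (induction js) (simp_all add: expand_def)

lemma expand_Cons: "expand lam \<alpha> (q # Q) = expand lam \<alpha> [q] @ expand lam \<alpha> Q"
  by (simp add: expand_def)

lemma expand_single: "expand lam \<alpha> [Inr (x, s)] = (if s then \<alpha> x else inv_word (\<alpha> x))"
  by (simp add: expand_def)

lemma cls_expand_conj:
  "cls (expand lam \<alpha> (conj_items len m)) =
    CJ (map (\<lambda>i. cls (map (\<lambda>j. lam (i, j)) [0..<len i])) [0..<m]) (map (\<lambda>i. cls (\<alpha> (VZ i))) [0..<m])"
proof (induction m)
  case 0
  then show ?case by (simp add: conj_items_def expand_def)
next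
  case (Suc m)
  have "conj_items len (Suc m) = conj_items len m @
      Inr (VZ m, False) # map (\<lambda>j. Inl (m, j)) [0..<len m] @ [Inr (VZ m, True)]"
    by (simp add: conj_items_def)
  then show ?case
    using Suc expand_Cons[of lam \<alpha> "Inr (VZ m, False)" "map (\<lambda>j. Inl (m, j)) [0..<len m] @ [Inr (VZ m, True)]"]
    by (simp add: expand_append expand_single expand_Inl cls_append cls_inv_word CJ_snoc conjg_def add.assoc)
qed

lemma cls_expand_square: "cls (expand lam \<alpha> (square_items k)) = SQ (map (\<lambda>i. cls (\<alpha> (VS i))) [0..<k])"
proof (induction k)
  case (Suc k)
  then show ?case
    by (simp add: square_items_def expand_append cls_append) (simp add: expand_def cls_append)
qed (simp add: square_items_def expand_def)

lemma cls_expand_comm: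
  "cls (expand lam \<alpha> (comm_items h)) = CM (map (\<lambda>i. (cls (\<alpha> (VA i)), cls (\<alpha> (VB i)))) [0..<h])"
proof (induction h)
  case (Suc h)
  then show ?case
    by (simp add: comm_items_def expand_append cls_append)
      (simp add: expand_def cls_append cls_inv_word comm_def group_word_simps
        del: add_uminus_conv_diff)
qed (simp add: comm_items_def expand_def)

lemma length_filter_concat:
  "length (filter R (concat (map F [0..<m]))) = (\<Sum>i<m. length (filter R (F i)))"
  by (induction m) simp_all

lemma count_list_concat_upt: "count_list (concat (map F [0..<m])) y = (\<Sum>i<m. count_list (F i) y)"
  by (induction m) simp_all

lemma items_vars:
  "card {i\<in>{..<length Q}. \<exists>s. Q ! i = Inr (x, s)} \<in> {0, 2}"
  if Q: "Q = conj_items len m @ square_items k @ comm_items h"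
proof -
  let ?R = "\<lambda>q. \<exists>s. q = Inr (x, s)"
  have "card {i\<in>{..<length Q}. ?R (Q ! i)} = length (filter ?R Q)"
    by (simp add: length_filter_conv_card)
  also have "\<dots> = (\<Sum>i<m. if VZ i = x then 2 else 0) + ((\<Sum>i<k. if VS i = x then 2 else 0)
      + (\<Sum>i<h. (if VA i = x then 2 else 0) + (if VB i = x then 2 else 0)))"
    unfolding Q filter_append length_append conj_items_def square_items_def comm_items_def
      length_filter_concat
    by (intro arg_cong2[where f = "(+)"] sum.cong refl) (simp_all add: filter_map comp_def ex_bool_eq)
  also have "\<dots> \<in> {0, 2}"
    by (cases x) (simp_all add: sum.delta)
  finally show ?thesis .
qed

lemma items_coefs:
  assumes Q: "Q = conj_items len m @ square_items k @ comm_items h"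
  shows "count_list Q (Inl p) \<le> 1" "Inl p \<in> set Q \<longleftrightarrow> fst p < m \<and> snd p < len (fst p)"
proof -
  obtain a b where p: "p = (a, b)" by (cases p)
  have 1: "count_list (map (\<lambda>j. Inl (i, j)) [0..<n]) (Inl (a, b)) = of_bool (i = a \<and> b < n)"
    for i n by (induction n) auto
  have "count_list Q (Inl p) \<le> (\<Sum>i<m. of_bool (i = a))"
    unfolding Q count_list_append conj_items_def square_items_def comm_items_def
      count_list_concat_upt p
    by (simp add: 1) (intro card_mono, auto)
  also have "\<dots> \<le> 1" by (simp add: of_bool_def sum.delta)
  finally show "count_list Q (Inl p) \<le> 1" .
  show "Inl p \<in> set Q \<longleftrightarrow> fst p < m \<and> snd p < len (fst p)"
    by (auto simp: Q p conj_items_def square_items_def comm_items_def intro!: bexI[of _ a])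
qed

lemma occ_filter: "occ w b = length (filter (\<lambda>l. fst l = b) w)"
  by (induction w) auto

text \<open>The equation is the image of a generic one in which every coefficient letter has exactly
  one partner. Short solutions of the generic equation map to short solutions of the given one, and
  the numbers of squares and commutators agree.\<close>

lemma core_labelling:
  fixes cs :: "'a word list"
  assumes len: "length zs = length cs"
    and zero: "CJ (map cls cs) zs + SQ xs + CM ps = 0"
  shows "\<exists>(cs' :: ('a \<times> nat) word list) zs' xs' ps'.
    length zs' = length cs \<and> length xs' = length xs \<and> length ps' = length ps \<and>
    map (map (map_prod fst id)) cs' = cs \<and> fully_quadratic (concat cs') \<and>
    CJ (map cls cs') zs' + SQ xs' + CM ps' = 0"
proof -
  let ?m = "length cs" and ?k = "length xs" and ?h = "length ps"
  let ?len = "\<lambda>i. length (cs ! i)"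
  let ?Q = "conj_items ?len ?m @ square_items ?k @ comm_items ?h"
  define lam where "lam = (\<lambda>(i, j). cs ! i ! j)"
  define \<alpha> where "\<alpha> x = rep_fg (case x of VZ i \<Rightarrow> zs ! i | VS i \<Rightarrow> xs ! i | VA i \<Rightarrow> fst (ps ! i) | VB i \<Rightarrow> snd (ps ! i))" for x
  have cs: "map (\<lambda>i. map (\<lambda>j. lam (i, j)) [0..<?len i]) [0..<?m] = cs"
    by (intro nth_equalityI) (auto simp: lam_def intro: nth_equalityI)
  have "cls (expand lam \<alpha> ?Q) = CJ (map (\<lambda>i. cls (map (\<lambda>j. lam (i, j)) [0..<?len i])) [0..<?m]) zs + (SQ xs + CM ps)"
    unfolding expand_append cls_append cls_expand_conj cls_expand_square cls_expand_comm
    using map_nth[of zs] map_nth[of xs] map_nth[of ps] len by (simp add: \<alpha>_def)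
  also have "map (\<lambda>i. cls (map (\<lambda>j. lam (i, j)) [0..<?len i])) [0..<?m] = map cls cs"
    using arg_cong[OF cs, of "map cls"] by (simp add: comp_def)
  finally have "cls (expand lam \<alpha> ?Q) = 0" using zero by (simp add: add.assoc)
  from labelling[OF this items_coefs(1)[OF refl] items_vars[OF refl]]
  obtain f \<alpha>' where f0: "cls (expand (relabel f lam) \<alpha>' ?Q) = 0"
    and f: "\<forall>n a. card {p. Inl p \<in> set ?Q \<and> f p = n \<and> fst (lam p) = a} \<in> {0, 2}"
    by (elim exE conjE) (rule that)
  define cs' where "cs' = map (\<lambda>i. map (\<lambda>j. relabel f lam (i, j)) [0..<?len i]) [0..<?m]"
  have "fully_quadratic (concat cs')"
    unfolding fully_quadratic_def
  proof
    fix b :: "'a \<times> nat"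
    obtain a n where b: "b = (a, n)" by (cases b)
    have "occ (concat cs') b = (\<Sum>i<?m. card {j. j < ?len i \<and> f (i, j) = n \<and> fst (lam (i, j)) = a})"
      unfolding occ_filter cs'_def length_filter_concat
      by (intro sum.cong refl)
        (simp add: length_filter_conv_card relabel_def b, intro arg_cong[where f = card], auto)
    also have "\<dots> = card (SIGMA i:{..<?m}. {j. j < ?len i \<and> f (i, j) = n \<and> fst (lam (i, j)) = a})"
      by simp
    also have "(SIGMA i:{..<?m}. {j. j < ?len i \<and> f (i, j) = n \<and> fst (lam (i, j)) = a})
        = {p. Inl p \<in> set ?Q \<and> f p = n \<and> fst (lam p) = a}"
      unfolding items_coefs(2)[OF refl] by auto
    finally have "occ (concat cs') b \<in> {0, 2}" using f[rule_format, of n a] by (simp only:)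
    then show "occ (concat cs') b = 0 \<or> occ (concat cs') b = 2" by blast
  qed
  moreover have "map (map (map_prod fst id)) cs' = cs"
    by (intro nth_equalityI) (auto simp: cs'_def relabel_def lam_def prod_eq_iff intro: nth_equalityI)
  moreover have "CJ (map cls cs') (map (\<lambda>i. cls (\<alpha>' (VZ i))) [0..<?m]) + SQ (map (\<lambda>i. cls (\<alpha>' (VS i))) [0..<?k])
      + CM (map (\<lambda>i. (cls (\<alpha>' (VA i)), cls (\<alpha>' (VB i)))) [0..<?h]) = 0"
    using f0 unfolding expand_append cls_append cls_expand_conj cls_expand_square cls_expand_comm
    by (simp add: cs'_def comp_def add.assoc)
  ultimately show ?thesis
    by (intro exI[of _ cs'] exI[of _ "map (\<lambda>i. cls (\<alpha>' (VZ i))) [0..<?m]"]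
        exI[of _ "map (\<lambda>i. cls (\<alpha>' (VS i))) [0..<?k]"]
        exI[of _ "map (\<lambda>i. (cls (\<alpha>' (VA i)), cls (\<alpha>' (VB i)))) [0..<?h]"]) simp
qed

section \<open>Splitting off squares and commutators\<close>

text \<open>Two linked pairs, the pattern that yields a handle. As \<open>k\<close> and
  \<open>l\<close> are signed letters, all orientations of two linked pairs of opposite letters are
  covered.\<close>

definition crossing :: "'b set \<Rightarrow> 'b word \<Rightarrow> bool" where
  "crossing X w \<longleftrightarrow>
     (\<exists>k l. fst k \<in> X \<and> fst l \<in> X \<and> subseq [inv_letter k, inv_letter l, k, l] w)"

definition oriented_on :: "'b set \<Rightarrow> 'b word \<Rightarrow> bool" where
  "oriented_on X w \<longleftrightarrow>
     (\<forall>x\<in>X. count_list w (x, True) = count_list w (x, False) \<and> count_list w (x, True) \<le> 1)"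

lemma oriented_on_letter:
  assumes "oriented_on X w" "fst k \<in> X"
  shows "count_list w (inv_letter k) = count_list w k" "count_list w k \<le> 1"
  using assms by (cases k; cases "snd k"; force simp: oriented_on_def inv_letter_def)+

lemma subseq_ConsD: "subseq (x # xs) w \<Longrightarrow> \<exists>u v. w = u @ x # v \<and> subseq xs v"
  by (drule list_emb_ConsD) auto

lemma inv_letter_eq [simp]: "inv_letter k = inv_letter l \<longleftrightarrow> k = l"
  by (metis inv_letter_invol)

lemma crossing_split:
  assumes "crossing X w"
  obtains T k P l Q R S where
    "w = T @ inv_letter k # P @ inv_letter l # Q @ k # R @ l # S" "fst k \<in> X" "fst l \<in> X"
proof -
  obtain k l where kl: "fst k \<in> X" "fst l \<in> X" "subseq [inv_letter k, inv_letter l, k, l] w"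
    using assms by (auto simp: crossing_def)
  from subseq_ConsD[OF kl(3)] obtain T w1
    where 1: "w = T @ inv_letter k # w1" "subseq [inv_letter l, k, l] w1" by blast
  from subseq_ConsD[OF 1(2)] obtain P w2
    where 2: "w1 = P @ inv_letter l # w2" "subseq [k, l] w2" by blast
  from subseq_ConsD[OF 2(2)] obtain Q w3 where 3: "w2 = Q @ k # w3" "subseq [l] w3" by blast
  from subseq_ConsD[OF 3(2)] obtain R S where "w3 = R @ l # S" by blast
  with 1 2 3 kl that show thesis by blast
qed

lemma subseq_ConsI: "subseq xs w2 \<Longrightarrow> subseq (x # xs) (w1 @ x # w2)"
  by (intro list_emb_append2 list_emb_Cons2) auto

text \<open>Induction on the distance between the two letters of a pair. A variable between them has
  its partner between them as well, which gives a shorter pair, or outside, which gives two linked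
  pairs.\<close>

lemma innermost_or_crossing:
  assumes or: "oriented_on X w"
  shows "w = A @ k # P @ inv_letter k # B \<Longrightarrow> fst k \<in> X \<Longrightarrow>
    crossing X w \<or> (\<exists>A k P B. w = A @ k # P @ inv_letter k # B \<and> fst k \<in> X \<and> fst ` set P \<inter> X = {})"
proof (induction "length P" arbitrary: A k P B rule: less_induct)
  case less
  show ?case
  proof (cases "fst ` set P \<inter> X = {}")
    case True
    with less.prems show ?thesis by blast
  next
    case False
    then obtain l where l: "l \<in> set P" "fst l \<in> X" by auto
    then obtain P1 P2 where P: "P = P1 @ l # P2" by (meson split_list)
    have cnt: "count_list w (inv_letter l) = count_list w l" "count_list w l \<le> 1" "count_list w k \<le> 1"
      "count_list w (inv_letter k) \<le> 1"
      using oriented_on_letter[OF or] l less.prems(2) by simp_all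
    have "l \<in> set w" using less.prems(1) P by simp
    then have "inv_letter l \<in> set w" using cnt(1) by (metis count_list_0_iff)
    moreover have "inv_letter l \<noteq> k" "inv_letter l \<noteq> inv_letter k"
      using cnt less.prems(1) P by (auto split: if_splits)
    moreover have "l \<noteq> inv_letter l" by (cases l) (simp add: inv_letter_def)
    ultimately consider "inv_letter l \<in> set A" | "inv_letter l \<in> set P1" | "inv_letter l \<in> set P2"
      | "inv_letter l \<in> set B"
      using less.prems(1) P by auto
    then show ?thesis
    proof cases
      case 1
      then obtain A1 A2 where A: "A = A1 @ inv_letter l # A2" by (meson split_list)
      have "subseq [inv_letter l, k, l, inv_letter k]
          (A1 @ inv_letter l # A2 @ k # P1 @ l # P2 @ inv_letter k # B)"
        by (intro subseq_ConsI) simp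
      then have "crossing X w"
        unfolding crossing_def using less.prems l P A
        by (intro exI[of _ l] exI[of _ "inv_letter k"]) simp
      then show ?thesis ..
    next
      case 2
      then obtain P11 P12 where P1: "P1 = P11 @ inv_letter l # P12" by (meson split_list)
      show ?thesis
        by (rule less.hyps[of P12 "A @ k # P11" "inv_letter l" "P2 @ inv_letter k # B"])
          (use P P1 less.prems l in simp_all)
    next
      case 3
      then obtain P21 P22 where P2: "P2 = P21 @ inv_letter l # P22" by (meson split_list)
      show ?thesis
        by (rule less.hyps[of P21 "A @ k # P1" l "P22 @ inv_letter k # B"])
          (use P P2 less.prems l in simp_all)
    next
      case 4
      then obtain B1 B2 where B: "B = B1 @ inv_letter l # B2" by (meson split_list)
      have "subseq [k, l, inv_letter k, inv_letter l]
          (A @ k # P1 @ l # P2 @ inv_letter k # B1 @ inv_letter l # B2)"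
        by (intro subseq_ConsI) simp
      then have "crossing X w"
        unfolding crossing_def using less.prems l P B
        by (intro exI[of _ "inv_letter k"] exI[of _ "inv_letter l"]) simp
      then show ?thesis ..
    qed
  qed
qed

lemma oriented_cases:
  assumes or: "oriented_on X w" and "fst ` set w \<inter> X \<noteq> {}"
  obtains (crossing) T k P l Q R S where
      "w = T @ inv_letter k # P @ inv_letter l # Q @ k # R @ l # S" "fst k \<in> X" "fst l \<in> X" "crossing X w"
    | (innermost) A k P B where
      "w = A @ k # P @ inv_letter k # B" "fst k \<in> X" "fst ` set P \<inter> X = {}" "\<not> crossing X w"
proof -
  obtain k where k: "k \<in> set w" "fst k \<in> X" using assms(2) by auto
  then obtain A B where w: "w = A @ k # B" by (meson split_list)
  have ne: "k \<noteq> inv_letter k" by (cases k) (simp add: inv_letter_def)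
  have "inv_letter k \<in> set w"
    using oriented_on_letter(1)[OF or k(2)] k(1) by (metis count_list_0_iff)
  then consider "inv_letter k \<in> set A" | "inv_letter k \<in> set B" using w ne by auto
  then have "\<exists>A k P B. w = A @ k # P @ inv_letter k # B \<and> fst k \<in> X"
  proof cases
    case 1
    then obtain A1 A2 where "A = A1 @ inv_letter k # A2" by (meson split_list)
    with w k show ?thesis
      by (intro exI[of _ A1] exI[of _ "inv_letter k"] exI[of _ A2] exI[of _ B]) simp
  next
    case 2
    then obtain B1 B2 where "B = B1 @ inv_letter k # B2" by (meson split_list)
    with w k show ?thesis
      by (intro exI[of _ A] exI[of _ k] exI[of _ B1] exI[of _ B2]) simp
  qed
  then show thesis
    using innermost_or_crossing[OF or] crossing_split[of X w] crossing innermost by metis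
qed

text \<open>The cut and paste that removes a handle in the classification of surfaces, with the
  commutator brought to the front. The entries \<open>a\<close> and \<open>b\<close> consist of
  pieces of the word itself.\<close>

lemma crossing_identity:
  fixes T k P l Q R S :: "'h :: group_add"
  defines "a \<equiv> T + R + Q + k - T" and "b \<equiv> T + R + l - (T + R + Q + P)"
  shows "T + (- k + (P + (- l + (Q + (k + (R + (l + S))))))) = comm a b + (T + (R + (Q + (P + S))))"
  unfolding a_def b_def comm_def
  by (simp add: group_word_simps del: add_uminus_conv_diff)

text \<open>The same for a crosscap; what lay between the two equal letters is left
  inverted.\<close>

lemma square_identity:
  fixes U l P W :: "'h :: group_add"
  defines "x \<equiv> U + l + P - U"
  shows "U + (l + (P + (l + W))) = x + x + (U + (- P + W))"
  unfolding x_def by (simp add: group_word_simps del: add_uminus_conv_diff)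

abbreviation cls2 :: "'b word \<times> 'b word \<Rightarrow> 'b fg \<times> 'b fg" where
  "cls2 \<equiv> map_prod cls cls"

abbreviation ev2 :: "('b \<Rightarrow> 'h :: group_add) \<Rightarrow> 'b word \<times> 'b word \<Rightarrow> 'h \<times> 'h" where
  "ev2 u \<equiv> map_prod (ev u) (ev u)"

lemma cls_Cons: "cls (l # w) = lev gen l + cls w"
  using ev_simps(3)[of gen l w] by (simp only: ev_gen)

lemma ev2_cong:
  "(\<And>x. x \<in> fst ` set (fst p) \<union> fst ` set (snd p) \<Longrightarrow> u x = v x) \<Longrightarrow> ev2 u p = ev2 v p"
  by (cases p) (auto intro!: ev_cong)

lemma count_list_letter: "count_list (l # w) y = of_bool (l = y) + count_list w y"
  by simp

lemma of_bool_letter: "of_bool (k = (x, s)) + of_bool (inv_letter k = (x, s)) = (of_bool (fst k = x) :: nat)"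
  by (cases k; cases s) (auto simp: inv_letter_def)

lemma oriented_on_delete:
  assumes "oriented_on X w" "\<And>x s. x \<in> X \<Longrightarrow> count_list w (x, s) = count_list v (x, s) + f x"
  shows "oriented_on X v"
  using assms unfolding oriented_on_def by fastforce

lemma names_inv_word [simp]: "fst ` set (inv_word w) = fst ` set w"
  by (simp add: inv_word_def image_image)

text \<open>The last condition says that the words in \<open>xs\<close> and \<open>ps\<close> are linearly independent
  modulo 2.\<close>

definition splits :: "'b word \<Rightarrow> 'b word list \<Rightarrow> ('b word \<times> 'b word) list \<Rightarrow> bool" where
  "splits V xs ps \<longleftrightarrow>
     cls V = SQ (map cls xs) + CM (map cls2 ps) \<and>
     (\<forall>w\<in>set xs \<union> fst ` set ps \<union> snd ` set ps.
        length w \<le> 2 * length V \<and> fst ` set w \<subseteq> fst ` set V) \<and>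
     (\<forall>ss ts. length ss = length xs \<longrightarrow> length ts = length ps \<longrightarrow>
        (\<exists>u :: 'b \<Rightarrow> bit. map (ev u) xs = ss \<and> map (ev2 u) ps = ts))"

lemma splits_words:
  assumes "splits V xs ps" "w \<in> set xs \<union> fst ` set ps \<union> snd ` set ps"
  shows "length w \<le> 2 * length V" "fst ` set w \<subseteq> fst ` set V"
proof -
  from assms(1) have "\<forall>w\<in>set xs \<union> fst ` set ps \<union> snd ` set ps.
      length w \<le> 2 * length V \<and> fst ` set w \<subseteq> fst ` set V"
    unfolding splits_def by (elim conjE)
  then show "length w \<le> 2 * length V" "fst ` set w \<subseteq> fst ` set V" using assms(2) by blast+
qed

lemma splits_values:
  assumes "splits V xs ps" "length ss = length xs" "length ts = length ps"
  obtains u :: "'b \<Rightarrow> bit" where "map (ev u) xs = ss" "map (ev2 u) ps = ts"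
  using assms unfolding splits_def by blast

lemma splits_cong:
  assumes "splits V xs ps" "\<And>a. a \<in> fst ` set V \<Longrightarrow> u a = v a"
  shows "map (ev u) xs = map (ev v) xs" "map (ev2 u) ps = map (ev2 v) ps"
proof -
  show "map (ev u) xs = map (ev v) xs"
    using splits_words(2)[OF assms(1)] assms(2) by (intro map_cong ev_cong refl) blast
  show "map (ev2 u) ps = map (ev2 v) ps"
    using splits_words(2)[OF assms(1)] assms(2) by (intro map_cong ev2_cong refl) blast
qed

lemma splits_cancel:
  assumes sp: "splits (A @ B) xs ps"
  shows "splits (A @ k # inv_letter k # B) xs ps"
  unfolding splits_def
proof (intro conjI ballI)
  let ?V = "A @ k # inv_letter k # B"
  have "cls ?V = cls (A @ B)" by (simp add: cls_append cls_Cons)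
  then show "cls ?V = SQ (map cls xs) + CM (map cls2 ps)" using sp by (simp only: splits_def)
  show "length w \<le> 2 * length ?V" "fst ` set w \<subseteq> fst ` set ?V"
    if "w \<in> set xs \<union> fst ` set ps \<union> snd ` set ps" for w
    using splits_words[OF sp that] by auto
qed (use sp[unfolded splits_def] in \<open>elim conjE\<close>)

text \<open>The letter \<open>k\<close> occurs once in \<open>a\<close>, \<open>l\<close> once in
  \<open>b\<close>, and neither of them in any other of the words; so the values of \<open>a\<close>
  and \<open>b\<close> can be prescribed without disturbing those of \<open>ps\<close>. Both new
  words use \<open>T\<close> at most twice, whence the factor 2 in the length bound, which does not
  grow under iteration because \<open>V1\<close> is shorter than \<open>V\<close>.\<close>

lemma splits_crossing:
  fixes T P Q R S :: "'b word" and k l :: "'b letter"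
  defines "V \<equiv> T @ inv_letter k # P @ inv_letter l # Q @ k # R @ l # S"
    and "V1 \<equiv> T @ R @ Q @ P @ S"
  assumes kl: "fst k \<noteq> fst l" and occ0: "occ V1 (fst k) = 0" "occ V1 (fst l) = 0"
    and sp: "splits V1 [] ps"
  shows "\<exists>p. splits V [] (p # ps)"
proof -
  define a where "a = T @ R @ Q @ k # inv_word T"
  define b where "b = T @ R @ l # inv_word (T @ R @ Q @ P)"
  have "cls V = comm (cls a) (cls b) + cls V1"
    using crossing_identity[of "cls T" "lev gen k" "cls P" "lev gen l" "cls Q" "cls R" "cls S"]
    by (simp add: V_def V1_def a_def b_def cls_append cls_Cons cls_inv_word group_word_simps
        del: add_uminus_conv_diff)
  then have 1: "cls V = SQ (map cls []) + CM (map cls2 ((a, b) # ps))"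
    using sp by (simp add: splits_def)
  have 2: "length w \<le> 2 * length V \<and> fst ` set w \<subseteq> fst ` set V"
    if w: "w \<in> set [] \<union> fst ` set ((a, b) # ps) \<union> snd ` set ((a, b) # ps)" for w
  proof (cases "w = a \<or> w = b")
    case True
    moreover have "fst ` set a \<subseteq> fst ` set V" "fst ` set b \<subseteq> fst ` set V"
      by (simp_all add: a_def b_def V_def image_Un) blast+
    moreover have "length a \<le> 2 * length V" "length b \<le> 2 * length V"
      by (simp_all add: a_def b_def V_def)
    ultimately show ?thesis by blast
  next
    case False
    then have "w \<in> set [] \<union> fst ` set ps \<union> snd ` set ps" using w by auto
    then have "length w \<le> 2 * length V1" "fst ` set w \<subseteq> fst ` set V1"
      by (rule splits_words[OF sp])+
    moreover have "length V1 \<le> length V" "fst ` set V1 \<subseteq> fst ` set V" by (auto simp: V_def V1_def)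
    ultimately show ?thesis by (intro conjI) (simp, blast)
  qed
  have 3: "\<exists>u :: 'b \<Rightarrow> bit. map (ev u) [] = ss \<and> map (ev2 u) ((a, b) # ps) = ts"
    if len: "length ss = length ([] :: 'b word list)" "length ts = length ((a, b) # ps)" for ss ts
  proof -
    obtain s t ts' where ts': "ts = (s, t) # ts'" "length ts' = length ps"
      using len by (cases ts) auto
    obtain u' where u': "map (ev2 u') ps = ts'" using splits_values[OF sp _ ts'(2)] len(1) by blast
    define u where "u = u'(fst k := s + ev u' R + ev u' Q, fst l := t + ev u' Q + ev u' P)"
    have u_kl: "u (fst k) = s + ev u' R + ev u' Q" "u (fst l) = t + ev u' Q + ev u' P"
      using kl by (simp_all add: u_def)
    have same: "u x = u' x" if "x \<in> fst ` set V1" for x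
    proof -
      have "x \<noteq> fst k" "x \<noteq> fst l" using that occ0[unfolded occ_eq_0] by blast+
      then show ?thesis by (simp add: u_def)
    qed
    have "ev u T = ev u' T" "ev u P = ev u' P" "ev u Q = ev u' Q" "ev u R = ev u' R"
      by (rule ev_cong, rule same, force simp: V1_def)+
    then have "ev u a = s" "ev u b = t"
      by (simp_all add: a_def b_def u_kl ac_simps bit_add_self bit_add_self2)
    moreover have "map (ev2 u) ps = map (ev2 u') ps" by (rule splits_cong(2)[OF sp]) (rule same)
    ultimately show ?thesis using u' ts' len(1) by (intro exI[of _ u]) simp
  qed
  show ?thesis
    unfolding splits_def
    by (intro exI[of _ "(a, b)"] conjI ballI allI impI)
      (rule 1 | erule 2[THEN conjunct1] | erule 2[THEN conjunct2] | erule (1) 3)+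
qed

lemma splits_square:
  fixes U P W :: "'b word" and l :: "'b letter"
  defines "V \<equiv> U @ l # P @ l # W" and "V1 \<equiv> U @ inv_word P @ W"
  assumes occ0: "occ V1 (fst l) = 0" and sp: "splits V1 xs ps"
  shows "\<exists>x. splits V (x # xs) ps"
proof -
  define x where "x = U @ l # P @ inv_word U"
  have "cls V = cls x + cls x + cls V1"
    using square_identity[of "cls U" "lev gen l" "cls P" "cls W"]
    by (simp add: V_def V1_def x_def cls_append cls_Cons cls_inv_word group_word_simps
        del: add_uminus_conv_diff)
  then have 1: "cls V = SQ (map cls (x # xs)) + CM (map cls2 ps)"
    using sp by (simp add: splits_def add.assoc)
  have 2: "length w \<le> 2 * length V \<and> fst ` set w \<subseteq> fst ` set V"
    if w: "w \<in> set (x # xs) \<union> fst ` set ps \<union> snd ` set ps" for w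
  proof (cases "w = x")
    case True
    moreover have "fst ` set x \<subseteq> fst ` set V" by (simp add: x_def V_def image_Un) blast
    moreover have "length x \<le> 2 * length V" by (simp add: x_def V_def)
    ultimately show ?thesis by blast
  next
    case False
    then have "w \<in> set xs \<union> fst ` set ps \<union> snd ` set ps" using w by auto
    then have "length w \<le> 2 * length V1" "fst ` set w \<subseteq> fst ` set V1"
      by (rule splits_words[OF sp])+
    moreover have "length V1 \<le> length V" "fst ` set V1 \<subseteq> fst ` set V"
      by (simp_all add: V_def V1_def image_Un) blast
    ultimately show ?thesis by (intro conjI) (simp, blast)
  qed
  have 3: "\<exists>u :: 'b \<Rightarrow> bit. map (ev u) (x # xs) = ss \<and> map (ev2 u) ps = ts"
    if len: "length ss = length (x # xs)" "length ts = length ps" for ss ts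
  proof -
    obtain t ss' where ss: "ss = t # ss'" "length ss' = length xs" using len(1) by (cases ss) auto
    obtain u' where u': "map (ev u') xs = ss'" "map (ev2 u') ps = ts"
      using splits_values[OF sp ss(2) len(2)] by blast
    define u where "u = u'(fst l := t + ev u' P)"
    have same: "u a = u' a" if "a \<in> fst ` set V1" for a
    proof -
      have "a \<noteq> fst l" using that occ0[unfolded occ_eq_0] by blast
      then show ?thesis by (simp add: u_def)
    qed
    have "ev u P = ev u' P"
      by (rule ev_cong, rule same) (simp add: V1_def image_Un)
    then have "ev u x = t" by (simp add: x_def u_def ac_simps bit_add_self bit_add_self2)
    moreover have "map (ev u) xs = map (ev u') xs" "map (ev2 u) ps = map (ev2 u') ps"
      by (rule splits_cong[OF sp]; rule same; assumption)+
    ultimately show ?thesis using u' ss by (intro exI[of _ u]) simp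
  qed
  show ?thesis
    unfolding splits_def
    by (intro exI[of _ x] conjI ballI allI impI)
      (rule 1 | erule 2[THEN conjunct1] | erule 2[THEN conjunct2] | erule (1) 3)+
qed

lemma oriented_splitting: "oriented_on UNIV V \<Longrightarrow> \<exists>ps. splits V [] ps"
proof (induction "length V" arbitrary: V rule: less_induct)
  case less
  show ?case
  proof (cases "V = []")
    case True
    then show ?thesis by (intro exI[of _ "[]"]) (simp add: splits_def)
  next
    case False
    then have "fst ` set V \<inter> UNIV \<noteq> {}" by simp
    with less.prems show ?thesis
    proof (cases rule: oriented_cases)
      \<comment> \<open>Every name counts as a variable here, so an innermost pair is adjacent and
        cancels.\<close>
      case (innermost A k P B)
      then have V: "V = A @ k # inv_letter k # B" by simp
      have "count_list V (x, s) = count_list (A @ B) (x, s) + of_bool (fst k = x)" for x s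
        using of_bool_letter[of k x s] by (simp add: V count_list_letter del: count_list.simps(2))
      with less.prems have "oriented_on UNIV (A @ B)" by (rule oriented_on_delete)
      moreover have "length (A @ B) < length V" by (simp add: V)
      ultimately show ?thesis using less.hyps splits_cancel unfolding V by blast
    next
      case (crossing T k P l Q R S)
      note V = crossing(1)
      let ?V1 = "T @ R @ Q @ P @ S"
      have cV: "count_list V (x, s) = count_list ?V1 (x, s) + (of_bool (fst k = x) + of_bool (fst l = x))" for x s
        using of_bool_letter[of k x s] of_bool_letter[of l x s]
        by (simp add: V count_list_letter del: count_list.simps(2))
      with less.prems have "oriented_on UNIV ?V1" by (rule oriented_on_delete)
      moreover have "length ?V1 < length V" by (simp add: V)
      ultimately obtain ps where sp: "splits ?V1 [] ps" using less.hyps by blast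
      have "count_list V (x, s) \<le> 1" for x s
        using less.prems by (cases s; simp add: oriented_on_def; metis)
      from this[of "fst k"] this[of "fst l"]
      have "fst k \<noteq> fst l" "occ ?V1 (fst k) = 0" "occ ?V1 (fst l) = 0"
        unfolding cV occ_def by fastforce+
      from splits_crossing[OF this sp] show ?thesis unfolding V by blast
    qed
  qed
qed

lemma repeated_letter:
  assumes "occ w x = 2" "count_list w (x, s) = 2"
  obtains U P W where "w = U @ (x, s) # P @ (x, s) # W" "occ (U @ inv_word P @ W) x = 0"
proof -
  have "(x, s) \<in> set w" using assms(2) by (metis count_list_0_iff zero_neq_numeral)
  then obtain U V where V: "w = U @ (x, s) # V" "(x, s) \<notin> set U" by (meson split_list_first)
  then have "count_list V (x, s) = 1" using assms(2) by (simp add: count_list_0_iff)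
  then have "(x, s) \<in> set V" by (metis count_list_0_iff zero_neq_one)
  then obtain P W where "V = P @ (x, s) # W" by (meson split_list)
  with V assms(1) that show thesis by simp
qed

text \<open>Crosscaps are cut off as long as some name occurs twice with the same sign; the balanced
  word that remains contains handles only.\<close>

lemma splitting:
  "fully_quadratic V \<Longrightarrow> \<exists>xs ps. splits V xs ps \<and> (balanced V \<longrightarrow> xs = [])"
proof (induction "length V" arbitrary: V rule: less_induct)
  case less
  show ?case
  proof (cases "balanced V")
    case True
    have "count_list V (x, True) \<le> 1" for x
      using occ_le_2[OF less.prems, of x] True by (auto simp: balanced_def occ_def)
    with True have "oriented_on UNIV V" by (simp add: oriented_on_def balanced_def)
    then show ?thesis using oriented_splitting by blast
  next
    case False
    then obtain c where "count_list V (c, True) \<noteq> count_list V (c, False)"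
      by (auto simp: balanced_def)
    moreover have occ: "occ V c = 0 \<or> occ V c = 2"
      using less.prems by (simp add: fully_quadratic_def)
    ultimately have "count_list V (c, True) = 2 \<or> count_list V (c, False) = 2" and occ2: "occ V c = 2"
      unfolding occ_def by arith+
    then obtain s where "count_list V (c, s) = 2" by blast
    with occ2 obtain U P W where V: "V = U @ (c, s) # P @ (c, s) # W"
      and occ0: "occ (U @ inv_word P @ W) c = 0" by (rule repeated_letter)
    let ?V1 = "U @ inv_word P @ W"
    have "occ V b = occ ?V1 b \<or> occ ?V1 b = 0" for b
      using occ0 by (cases "b = c") (simp_all add: V)
    then have "fully_quadratic ?V1" using less.prems unfolding fully_quadratic_def by metis
    moreover have "length ?V1 < length V" by (simp add: V)
    ultimately obtain xs ps where "splits ?V1 xs ps" using less.hyps by blast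
    with splits_square[of U P W "(c, s)" xs ps] occ0 False show ?thesis unfolding V by auto
  qed
qed

section \<open>Counting squares and commutators modulo 2\<close>

text \<open>A Heisenberg group over the field with two elements: the third coordinate of the image of
  a word, as a function of two homomorphisms to that field, is the bilinear form that counts
  squares and commutators.\<close>

datatype heis = Heis (h1: bit) (h2: bit) (h3: bit)

instantiation heis :: group_add
begin
definition "0 = Heis 0 0 0"
definition "x + y = Heis (h1 x + h1 y) (h2 x + h2 y) (h3 x + h3 y + h1 x * h2 y)"
definition "- x = Heis (h1 x) (h2 x) (h3 x + h1 x * h2 x)"
definition "x - y = x + - (y :: heis)"
instance
proof
  fix x y z :: heis
  show "x + y + z = x + (y + z)" by (simp add: plus_heis_def algebra_simps)
  show "0 + x = x" "x + 0 = x" by (simp_all add: plus_heis_def zero_heis_def)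
  show "- x + x = 0"
    by (simp add: plus_heis_def uminus_heis_def zero_heis_def bit_add_self)
  show "x + - y = x - y" by (simp add: minus_heis_def)
qed
end

lemma heis_simps [simp]:
  "Heis a b c + Heis a' b' c' = Heis (a + a') (b + b') (c + c' + a * b')"
  "- Heis a b c = Heis a b (c + a * b)"
  "Heis a b c - Heis a' b' c' = Heis a b c + - Heis a' b' c'"
  by (simp_all add: plus_heis_def uminus_heis_def minus_heis_def)

lemma zero_heis: "0 = Heis 0 0 0"
  by (simp add: zero_heis_def)

definition into_heis :: "('b \<Rightarrow> bit) \<Rightarrow> ('b \<Rightarrow> bit) \<Rightarrow> 'b fg \<Rightarrow> heis" where
  "into_heis u v = lift (\<lambda>b. Heis (u b) (v b) 0)"

lemma into_heis_hom:
  "into_heis u v 0 = 0" "into_heis u v (a + b) = into_heis u v a + into_heis u v b"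
  "into_heis u v (- a) = - into_heis u v a" "into_heis u v (a - b) = into_heis u v a - into_heis u v b"
  by (simp_all add: into_heis_def)

lemma ev_heis: "\<exists>t. ev (\<lambda>b. Heis (u b) (v b) 0) w = Heis (ev u w) (ev v w) t"
  by (induction w) (auto simp: zero_heis lev_def)

lemma into_heis_eq: "\<exists>t. into_heis u v g = Heis (lift u g) (lift v g) t"
  unfolding into_heis_def lift_def by (rule ev_heis)

text \<open>A square contributes a form of rank one, a commutator a hyperbolic plane.\<close>

definition form :: "'b fg list \<Rightarrow> ('b fg \<times> 'b fg) list \<Rightarrow> ('b \<Rightarrow> bit) \<Rightarrow> ('b \<Rightarrow> bit) \<Rightarrow> bit" where
  "form xs ps u v = (\<Sum>x\<leftarrow>xs. lift u x * lift v x) +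
     (\<Sum>p\<leftarrow>ps. lift u (fst p) * lift v (snd p) + lift u (snd p) * lift v (fst p))"

lemma into_heis_square: "into_heis u v (x + x) = Heis 0 0 (lift u x * lift v x)"
  using into_heis_eq[of u v x] by (auto simp: into_heis_hom bit_add_self)

lemma into_heis_comm:
  "into_heis u v (comm a b) = Heis 0 0 (lift u a * lift v b + lift u b * lift v a)"
  using into_heis_eq[of u v a] into_heis_eq[of u v b]
  by (cases "lift u a"; cases "lift v a"; cases "lift u b"; cases "lift v b")
    (auto simp: comm_def into_heis_hom bit_add_self)

lemma into_heis_form: "into_heis u v (SQ xs + CM ps) = Heis 0 0 (form xs ps u v)"
proof -
  have "into_heis u v (SQ xs) = Heis 0 0 (\<Sum>x\<leftarrow>xs. lift u x * lift v x)"
  proof (induction xs)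
    case (Cons x xs)
    then show ?case
      using into_heis_square[of u v x] by (simp add: into_heis_hom)
  qed (simp add: into_heis_def zero_heis)
  moreover have "into_heis u v (CM ps)
      = Heis 0 0 (\<Sum>p\<leftarrow>ps. lift u (fst p) * lift v (snd p) + lift u (snd p) * lift v (fst p))"
  proof (induction ps)
    case (Cons p ps)
    then show ?case
      using into_heis_comm[of u v "fst p" "snd p"] by (simp add: into_heis_hom)
  qed (simp add: into_heis_def zero_heis)
  ultimately show ?thesis by (simp add: into_heis_hom(2) form_def)
qed

text \<open>If \<open>u\<close> and \<open>v\<close> vanish on \<open>c\<close>, then the image of
  \<open>c\<close> is central, and the conjugator is not seen.\<close>

lemma into_heis_conjg:
  assumes "lift u c = 0" "lift v c = 0"
  shows "into_heis u v (conjg c z) = Heis 0 0 (h3 (into_heis u v c))"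
  using into_heis_eq[of u v c] into_heis_eq[of u v z] assms
  by (cases "lift u z"; cases "lift v z")
    (auto simp: conjg_def into_heis_hom bit_add_self bit_add_self2 ac_simps)

lemma into_heis_CJ:
  assumes "length cs = length zs" "\<And>c. c \<in> set cs \<Longrightarrow> lift u c = 0 \<and> lift v c = 0"
  shows "into_heis u v (CJ cs zs) = Heis 0 0 (\<Sum>c\<leftarrow>cs. h3 (into_heis u v c))"
  using assms
proof (induction cs zs rule: list_induct2)
  case Nil
  then show ?case by (simp add: into_heis_def zero_heis)
next
  case (Cons c cs z zs)
  then show ?case using into_heis_conjg[of u c v z] by (simp add: into_heis_hom)
qed

text \<open>The correction term in the Heisenberg inverse has the factor \<open>lift u c\<close>, so
  inverted coefficients contribute the same.\<close>

lemma into_heis_flip: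
  assumes "lift u c = 0"
  shows "h3 (into_heis u v (- c)) = h3 (into_heis u v c)"
  using into_heis_eq[of u v c] assms by (auto simp: into_heis_hom)

lemma lift_add_fun:
  fixes u w :: "'b \<Rightarrow> bit"
  shows "lift (\<lambda>b. u b + w b) g = lift u g + lift w g"
proof -
  have "ev (\<lambda>b. u b + w b) x = ev u x + ev w x" for x
    by (induction x) (simp_all add: ac_simps)
  then show ?thesis by (simp add: lift_def)
qed

lemma sum_list_single:
  fixes f :: "nat \<Rightarrow> bit"
  assumes "i < n" "\<And>j. j < n \<Longrightarrow> j \<noteq> i \<Longrightarrow> f j = 0"
  shows "(\<Sum>j<n. f j) = f i"
proof -
  have "(\<Sum>j<n. f j) = (\<Sum>j<n. if j = i then f i else 0)"
    using assms by (intro sum.cong) auto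
  then show ?thesis using assms(1) by simp
qed

section \<open>Comparing ranks by counting\<close>

definition coords :: "'b fg list \<Rightarrow> ('b fg \<times> 'b fg) list \<Rightarrow> ('b \<Rightarrow> bit) \<Rightarrow> bit list \<times> (bit \<times> bit) list" where
  "coords xs ps u = (map (lift u) xs, map (map_prod (lift u) (lift u)) ps)"

lemma form_coords_zero:
  assumes "\<forall>x\<in>set xs. lift u x = 0" "\<forall>p\<in>set ps. lift u (fst p) = 0 \<and> lift u (snd p) = 0"
  shows "form xs ps u v = 0"
proof -
  have "map (\<lambda>x. lift u x * lift v x) xs = map (\<lambda>_. 0) xs"
    "map (\<lambda>p. lift u (fst p) * lift v (snd p) + lift u (snd p) * lift v (fst p)) ps = map (\<lambda>_. 0) ps"
    using assms by (auto intro!: map_cong)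
  then show ?thesis unfolding form_def by (simp only:) simp
qed

text \<open>A functional \<open>v\<close> that is 1 on one entry and 0 on all others isolates a
  single value of \<open>u\<close>: at the same entry for a square, at the other entry of the pair
  for a commutator.\<close>

lemma form_nondegenerate:
  assumes surj: "\<And>ss ts. length ss = length xs \<Longrightarrow> length ts = length ps \<Longrightarrow> \<exists>v\<in>Z. coords xs ps v = (ss, ts)"
    and zero: "\<And>v. v \<in> Z \<Longrightarrow> form xs ps u v = 0"
  shows "\<forall>x\<in>set xs. lift u x = 0" "\<forall>p\<in>set ps. lift u (fst p) = 0 \<and> lift u (snd p) = 0"
proof -
  have form: "form xs ps u v = (\<Sum>j<length xs. lift u (xs ! j) * lift v (xs ! j))
      + (\<Sum>j<length ps. lift u (fst (ps ! j)) * lift v (snd (ps ! j)) + lift u (snd (ps ! j)) * lift v (fst (ps ! j)))" for v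
    by (simp add: form_def sum_list_sum_nth atLeast0LessThan)
  have "lift u (xs ! i) = 0" if i: "i < length xs" for i
  proof -
    obtain v where v: "v \<in> Z" "coords xs ps v = ((replicate (length xs) 0)[i := 1], replicate (length ps) (0, 0))"
      using surj[of "(replicate (length xs) 0)[i := 1]" "replicate (length ps) (0, 0)"] by auto
    have 1: "lift v (xs ! j) = (if j = i then 1 else 0)" if "j < length xs" for j
      using v(2) that i unfolding coords_def
      by (auto dest!: arg_cong[where f = "\<lambda>l. l ! j"] simp: nth_list_update)
    have 2: "lift v (fst (ps ! j)) = 0 \<and> lift v (snd (ps ! j)) = 0" if "j < length ps" for j
      using v(2) that unfolding coords_def
      by (auto dest!: arg_cong[where f = "\<lambda>l. l ! j" and y = "replicate _ _"] simp: prod_eq_iff)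
    have "form xs ps u v = lift u (xs ! i)"
      unfolding form using 1 2 i by (subst sum_list_single[OF i]) auto
    with zero[OF v(1)] show ?thesis by simp
  qed
  then show "\<forall>x\<in>set xs. lift u x = 0" by (auto simp: in_set_conv_nth)
  have "lift u (fst (ps ! i)) = 0 \<and> lift u (snd (ps ! i)) = 0" if i: "i < length ps" for i
  proof -
    have *: "lift u (fst (ps ! i)) * s + lift u (snd (ps ! i)) * t = 0" for s t
    proof -
      obtain v where v: "v \<in> Z" "coords xs ps v = (replicate (length xs) 0, (replicate (length ps) (0, 0))[i := (t, s)])"
        using surj[of "replicate (length xs) 0" "(replicate (length ps) (0, 0))[i := (t, s)]"]
          by auto
      have 1: "lift v (xs ! j) = 0" if "j < length xs" for j
        using v(2) that unfolding coords_def
        by (auto dest!: arg_cong[where f = "\<lambda>l. l ! j" and y = "replicate _ _"])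
      have 2: "(lift v (fst (ps ! j)), lift v (snd (ps ! j))) = (if j = i then (t, s) else (0, 0))" if "j < length ps" for j
        using v(2) that i unfolding coords_def
        by (auto dest!: arg_cong[where f = "\<lambda>l. l ! j" and y = "list_update _ _ _"]
            simp: nth_list_update map_prod_def split: prod.splits)
      have 3: "lift v (fst (ps ! i)) = t" "lift v (snd (ps ! i)) = s" using 2[OF i] by simp_all
      have 4: "lift v (fst (ps ! j)) = 0" "lift v (snd (ps ! j)) = 0" if "j < length ps" "j \<noteq> i" for j
        using 2[OF that(1)] that(2) by simp_all
      have "(\<Sum>j<length ps. lift u (fst (ps ! j)) * lift v (snd (ps ! j)) + lift u (snd (ps ! j)) * lift v (fst (ps ! j)))
          = lift u (fst (ps ! i)) * s + lift u (snd (ps ! i)) * t"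
        by (subst sum_list_single[OF i]) (simp_all add: 3 4)
      then have "form xs ps u v = lift u (fst (ps ! i)) * s + lift u (snd (ps ! i)) * t"
        unfolding form using 1 by simp
      with zero[OF v(1)] show ?thesis by simp
    qed
    from *[of 1 0] *[of 0 1] show ?thesis by simp
  qed
  then show "\<forall>p\<in>set ps. lift u (fst p) = 0 \<and> lift u (snd p) = 0" by (metis in_set_conv_nth)
qed

lemma card_coords:
  "finite {(ss :: bit list, ts :: (bit \<times> bit) list). length ss = k \<and> length ts = h}"
  "card {(ss :: bit list, ts :: (bit \<times> bit) list). length ss = k \<and> length ts = h} = 2 ^ (k + 2 * h)"
proof -
  have e: "{(ss :: bit list, ts :: (bit \<times> bit) list). length ss = k \<and> length ts = h}
      = {ss. set ss \<subseteq> UNIV \<and> length ss = k} \<times> {ts. set ts \<subseteq> UNIV \<and> length ts = h}"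
    by auto
  have U: "(UNIV :: bit set) = {0, 1}" using bit.exhaust by auto
  have fin: "finite (UNIV :: bit set)" "card (UNIV :: bit set) = 2" unfolding U by simp_all
  have fin2: "finite (UNIV :: (bit \<times> bit) set)" "card (UNIV :: (bit \<times> bit) set) = 4"
    using fin by (simp_all add: finite_prod card_cartesian_product flip: UNIV_Times_UNIV)
  show "finite {(ss :: bit list, ts :: (bit \<times> bit) list). length ss = k \<and> length ts = h}"
    unfolding e using finite_lists_length_eq[OF fin(1), of k] finite_lists_length_eq[OF fin2(1), of h]
    by blast
  show "card {(ss :: bit list, ts :: (bit \<times> bit) list). length ss = k \<and> length ts = h} = 2 ^ (k + 2 * h)"
    unfolding e card_cartesian_product card_lists_length_eq[OF fin(1)] card_lists_length_eq[OF fin2(1)]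
    by (simp add: fin fin2 power_add power_mult)
qed

text \<open>Two functionals that agree on \<open>xs\<close> and \<open>ps\<close> differ by an
  element of the radical, which vanishes on \<open>xs'\<close> and \<open>ps'\<close> by
  non-degeneracy. So the coordinates on the primed side are a function of those on the other side,
  and counting both compares the exponents of 2. If there are no primed squares, the common form is
  alternating; this imposes a linear relation on the coordinates of \<open>xs\<close> and saves a
  factor 2.\<close>

lemma form_rank:
  assumes Z: "\<And>u v. u \<in> Z \<Longrightarrow> v \<in> Z \<Longrightarrow> (\<lambda>b. u b + v b) \<in> Z"
    and eq: "\<And>u v. u \<in> Z \<Longrightarrow> v \<in> Z \<Longrightarrow> form xs ps u v = form xs' ps' u v"
    and surj: "\<And>ss ts. length ss = length xs' \<Longrightarrow> length ts = length ps' \<Longrightarrow>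
      \<exists>v\<in>Z. coords xs' ps' v = (ss, ts)"
  shows "length xs' + 2 * length ps' \<le> length xs + 2 * length ps"
    and "xs' = [] \<Longrightarrow> xs \<noteq> [] \<Longrightarrow> 2 * length ps' < length xs + 2 * length ps"
proof -
  let ?B = "\<lambda>k h. {(ss :: bit list, ts :: (bit \<times> bit) list). length ss = k \<and> length ts = h}"
  have determined: "coords xs' ps' u1 = coords xs' ps' u2"
    if u: "u1 \<in> Z" "u2 \<in> Z" and c: "coords xs ps u1 = coords xs ps u2" for u1 u2
  proof -
    let ?w = "\<lambda>b. u1 b + u2 b"
    have 0: "a + b = (0 :: bit) \<longleftrightarrow> a = b" for a b by (cases a; cases b) simp_all
    have "\<forall>x\<in>set xs. lift ?w x = 0" "\<forall>p\<in>set ps. lift ?w (fst p) = 0 \<and> lift ?w (snd p) = 0"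
      using c by (auto simp: coords_def lift_add_fun 0)
    then have "form xs' ps' ?w v = 0" if "v \<in> Z" for v
      using eq[OF Z[OF u] that] form_coords_zero[of xs ?w ps v] by simp
    from form_nondegenerate[OF surj this] show ?thesis
      by (auto simp: coords_def lift_add_fun 0)
  qed
  have img: "coords xs' ps' ` Z = ?B (length xs') (length ps')"
    using surj by (force simp: coords_def image_iff)
  define g where "g c = coords xs' ps' (SOME u. u \<in> Z \<and> coords xs ps u = c)" for c
  have "coords xs' ps' u = g (coords xs ps u)" if "u \<in> Z" for u
    unfolding g_def
    using determined[OF that] someI[of "\<lambda>w. w \<in> Z \<and> coords xs ps w = coords xs ps u" u] that
    by metis
  then have sub: "coords xs' ps' ` Z \<subseteq> g ` coords xs ps ` Z" by auto
  have sub2: "coords xs ps ` Z \<subseteq> ?B (length xs) (length ps)" by (auto simp: coords_def)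
  have le: "2 ^ (length xs' + 2 * length ps') \<le> card W"
    if W: "coords xs ps ` Z \<subseteq> W" "finite W" for W
  proof -
    have "2 ^ (length xs' + 2 * length ps') = card (coords xs' ps' ` Z)"
      unfolding img card_coords ..
    also have "\<dots> \<le> card (g ` coords xs ps ` Z)"
      using sub by (rule card_mono[rotated]) (use W finite_subset in blast)
    also have "\<dots> \<le> card (coords xs ps ` Z)"
      by (rule card_image_le) (use W finite_subset in blast)
    also have "\<dots> \<le> card W" using W by (intro card_mono)
    finally show ?thesis .
  qed
  have "(2 :: nat) ^ (length xs' + 2 * length ps') \<le> 2 ^ (length xs + 2 * length ps)"
    using le[OF sub2] card_coords by metis
  then show "length xs' + 2 * length ps' \<le> length xs + 2 * length ps"
    by (simp add: power_increasing_iff)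
  assume e: "xs' = []" "xs \<noteq> []"
  then obtain y ys where xs: "xs = y # ys" by (cases xs) auto
  \<comment> \<open>On the diagonal each commutator contributes twice the same term, and
    \<open>a * a = a\<close> turns the squares into a linear expression.\<close>
  have diag: "(\<Sum>x\<leftarrow>xs. lift u x) = 0" if "u \<in> Z" for u
  proof -
    have sq: "a * a = a" for a :: bit by (cases a) simp_all
    have "form xs' ps' u u = 0"
      by (simp add: form_def e mult.commute bit_add_self)
    then have "form xs ps u u = 0" using eq that by simp
    then show ?thesis by (simp add: form_def sq mult.commute bit_add_self)
  qed
  \<comment> \<open>By \<open>diag\<close> the first coordinate is the sum of the other ones in
    \<open>ss\<close>.\<close>
  let ?W = "(\<lambda>(ss, ts). (sum_list ss # ss, ts)) ` ?B (length ys) (length ps)"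
  have "coords xs ps ` Z \<subseteq> ?W"
  proof
    fix c assume "c \<in> coords xs ps ` Z"
    then obtain u where u: "u \<in> Z" "c = coords xs ps u" by blast
    have "a + b = 0 \<Longrightarrow> a = b" for a b :: bit by (cases a; cases b) simp_all
    with diag[OF u(1)] have "lift u y = sum_list (map (lift u) ys)" by (simp add: xs)
    with u show "c \<in> ?W"
      by (intro image_eqI[of _ _ "(map (lift u) ys, map (map_prod (lift u) (lift u)) ps)"])
        (auto simp: coords_def xs)
  qed
  from le[OF this] have "2 ^ (length xs' + 2 * length ps') \<le> card ?W"
    using card_coords by blast
  also have "\<dots> \<le> card (?B (length ys) (length ps))"
    by (rule card_image_le) (rule card_coords)
  finally have "(2 :: nat) ^ (length xs' + 2 * length ps') \<le> 2 ^ (length ys + 2 * length ps)"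
    unfolding card_coords .
  then show "2 * length ps' < length xs + 2 * length ps"
    by (simp add: power_increasing_iff e xs)
qed

section \<open>Trading squares for commutators and inverting coefficients\<close>

text \<open>Dyck's relation between surfaces in explicit form: three crosscaps amount to one
  crosscap and one handle. \<open>square_comm\<close> gives the trade in the other
  direction.\<close>

lemma three_squares:
  fixes a x y :: "'h :: group_add"
  defines "d \<equiv> y + x" and "e \<equiv> y + x + a"
  shows "y + (y + (x + (x + (a + a)))) = e + (e + comm (- e - y + e + e) (- e - d + e))"
  unfolding d_def e_def comm_def
  by (simp add: group_word_simps del: add_uminus_conv_diff)

lemma square_comm:
  fixes a b c :: "'h :: group_add"
  defines "f \<equiv> a + a - b - c + b - a" and "g \<equiv> a - b + c + b - a + b - a" and "e \<equiv> a - b"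
  shows "a + (a + comm b c) = f + (f + (g + (g + (e + e))))"
  unfolding f_def g_def e_def comm_def
  by (simp add: group_word_simps del: add_uminus_conv_diff)

text \<open>A disc carried through a crosscap returns with the opposite orientation. The choice of
  \<open>y\<close> makes \<open>B + y = conjg (- c) z + B + x\<close>: the inverted conjugate is
  moved past \<open>B\<close> and absorbed into the root of the square.\<close>

lemma flip_identity:
  fixes c z B x :: "'h :: group_add"
  defines "y \<equiv> - B + conjg (- c) z + B + x"
  shows "conjg c (z + B - y - B) + (B + (y + y)) = conjg (- c) z + (B + (x + x))"
  unfolding y_def conjg_def
  by (simp add: group_word_simps del: add_uminus_conv_diff)

lemma flen_diff: "flen (a - b) \<le> flen a + flen b"
  using flen_add[of a "- b"] by simp

lemma flen_plus: "flen a \<le> m \<Longrightarrow> flen b \<le> n \<Longrightarrow> flen (a + b) \<le> m + n"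
  using flen_add[of a b] by simp

lemma flen_minus2: "flen a \<le> m \<Longrightarrow> flen b \<le> n \<Longrightarrow> flen (a - b) \<le> m + n"
  using flen_diff[of a b] by simp

lemma flen_uminus: "flen a \<le> m \<Longrightarrow> flen (- a) \<le> m"
  by simp

abbreviation bounded :: "nat \<Rightarrow> 'a fg list \<Rightarrow> bool" where
  "bounded s xs \<equiv> \<forall>x\<in>set xs. flen x \<le> s"

abbreviation bounded2 :: "nat \<Rightarrow> ('a fg \<times> 'a fg) list \<Rightarrow> bool" where
  "bounded2 s ps \<equiv> \<forall>p\<in>set ps. flen (fst p) \<le> s \<and> flen (snd p) \<le> s"

text \<open>The last square serves as an accumulator: each trade absorbs the two squares in front of
  it and leaves a commutator behind it. Only the accumulated element grows, by at most
  \<open>2 * s\<close> per trade, so the bounds stay linear in \<open>t\<close>.\<close>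

lemma squares_to_comms:
  "length ys = r + 2 * t \<Longrightarrow> bounded s ys \<Longrightarrow> flen a \<le> \<alpha> \<Longrightarrow>
    \<exists>ys' e qs. length ys' = r \<and> length qs = t \<and> SQ (ys @ [a]) = SQ (ys' @ [e]) + CM qs \<and>
      bounded s ys' \<and> flen e \<le> \<alpha> + 2 * t * s \<and> bounded2 (3 * (\<alpha> + 2 * t * s) + 2 * s) qs"
proof (induction t arbitrary: ys a \<alpha>)
  case 0
  then show ?case by (intro exI[of _ ys] exI[of _ a] exI[of _ "[]"]) simp
next
  case (Suc t)
  obtain ys0 y x where ys: "ys = ys0 @ [y, x]"
  proof -
    obtain ys1 x where 1: "ys = ys1 @ [x]" using Suc.prems(1) by (cases ys rule: rev_cases) auto
    obtain ys0 y where "ys1 = ys0 @ [y]" using Suc.prems(1) 1 by (cases ys1 rule: rev_cases) auto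
    with 1 that show thesis by simp
  qed
  define e where "e = y + x + a"
  define p where "p = - e - y + e + e"
  define q where "q = - e - (y + x) + e"
  have b: "flen y \<le> s" "flen x \<le> s" "bounded s ys0" using Suc.prems(2) by (simp_all add: ys)
  have e: "flen e \<le> \<alpha> + 2 * s"
    unfolding e_def using flen_plus[OF flen_plus[OF b(1,2)] Suc.prems(3)] by simp
  have "flen p \<le> (\<alpha> + 2 * s) + s + (\<alpha> + 2 * s) + (\<alpha> + 2 * s)"
    unfolding p_def by (intro flen_plus flen_minus2 flen_uminus e b)
  then have p: "flen p \<le> 3 * (\<alpha> + 2 * Suc t * s) + 2 * s" by (simp add: algebra_simps)
  have "flen q \<le> (\<alpha> + 2 * s) + (s + s) + (\<alpha> + 2 * s)"
    unfolding q_def by (intro flen_plus flen_minus2 flen_uminus e b)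
  then have q: "flen q \<le> 3 * (\<alpha> + 2 * Suc t * s) + 2 * s" by (simp add: algebra_simps)
  have "length ys0 = r + 2 * t" using Suc.prems(1) by (simp add: ys)
  from Suc.IH[OF this b(3) e] obtain ys' e' qs where IH: "length ys' = r" "length qs = t"
    "SQ (ys0 @ [e]) = SQ (ys' @ [e']) + CM qs" "bounded s ys'" "flen e' \<le> \<alpha> + 2 * s + 2 * t * s"
    "bounded2 (3 * (\<alpha> + 2 * s + 2 * t * s) + 2 * s) qs" by blast
  have "SQ (ys @ [a]) = SQ (ys0 @ [e]) + comm p q"
    using three_squares[of y x a] by (simp add: ys e_def p_def q_def add.assoc)
  also have "\<dots> = SQ (ys' @ [e']) + CM (qs @ [(p, q)])"
    unfolding IH(3) by (simp add: add.assoc)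
  finally show ?case
    using IH p q by (intro exI[of _ ys'] exI[of _ e'] exI[of _ "qs @ [(p, q)]"]) (auto simp: algebra_simps)
qed

text \<open>Each commutator leaves two squares behind and passes one element on to the right, which
  grows by at most \<open>s\<close>; again the bounds stay linear.\<close>

lemma comms_to_squares:
  "bounded2 s ps \<Longrightarrow> flen a \<le> \<alpha> \<Longrightarrow>
    \<exists>ys e. length ys = 2 * length ps \<and> a + a + CM ps = SQ (ys @ [e]) \<and>
      flen e \<le> \<alpha> + length ps * s \<and> bounded (3 * (\<alpha> + length ps * s) + 4 * s) ys"
proof (induction ps arbitrary: a \<alpha>)
  case Nil
  then show ?case by (intro exI[of _ "[]"] exI[of _ a]) simp
next
  case (Cons p ps)
  obtain b c where p: "p = (b, c)" by (cases p)
  define f where "f = a + a - b - c + b - a"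
  define g where "g = a - b + c + b - a + b - a"
  define e where "e = a - b"
  have bc: "flen b \<le> s" "flen c \<le> s" "bounded2 s ps" using Cons.prems(1) by (simp_all add: p)
  have e: "flen e \<le> \<alpha> + s" unfolding e_def by (intro flen_minus2 Cons.prems bc)
  have "flen f \<le> \<alpha> + \<alpha> + s + s + s + \<alpha>"
    unfolding f_def by (intro flen_plus flen_minus2 Cons.prems bc)
  then have f: "flen f \<le> 3 * (\<alpha> + length (p # ps) * s) + 4 * s" by (simp add: algebra_simps)
  have "flen g \<le> \<alpha> + s + s + s + \<alpha> + s + \<alpha>"
    unfolding g_def by (intro flen_plus flen_minus2 Cons.prems bc)
  then have g: "flen g \<le> 3 * (\<alpha> + length (p # ps) * s) + 4 * s" by (simp add: algebra_simps)
  from Cons.IH[OF bc(3) e] obtain ys e' where IH: "length ys = 2 * length ps"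
    "e + e + CM ps = SQ (ys @ [e'])" "flen e' \<le> \<alpha> + s + length ps * s"
    "bounded (3 * (\<alpha> + s + length ps * s) + 4 * s) ys" by blast
  have "a + a + CM (p # ps) = f + (f + (g + (g + (e + e + CM ps))))"
    using arg_cong[OF square_comm[of a b c], of "\<lambda>z. z + CM ps"]
    by (simp only: CM_simps p fst_conv snd_conv add.assoc f_def g_def e_def)
  also have "\<dots> = SQ ((f # g # ys) @ [e'])" unfolding IH(2) by (simp add: add.assoc)
  finally show ?case
    using IH f g by (intro exI[of _ "f # g # ys"] exI[of _ e']) (auto simp: algebra_simps)
qed

lemma SQ_replicate_0 [simp]: "SQ (replicate n (0 :: 'h :: group_add)) = 0"
  by (induction n) simp_all

lemma CM_replicate_0 [simp]: "CM (replicate n (0 :: 'h :: group_add, 0 :: 'h)) = 0"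
  by (induction n) (simp_all add: comm_def)

text \<open>Surplus squares are traded for commutators or surplus commutators for squares, and
  trivial elements fill the remaining places; the rank hypotheses guarantee that the result
  fits.\<close>

lemma reshape:
  fixes xs :: "'a fg list"
  assumes k: "1 \<le> k" and rank: "length xs + 2 * length ps \<le> k + 2 * h"
    "xs = [] \<Longrightarrow> 2 * length ps < k + 2 * h"
    and bnd: "bounded s xs" "bounded2 s ps"
  shows "\<exists>ys qs. length ys = k \<and> length qs = h \<and> SQ xs + CM ps = SQ ys + CM qs \<and>
    bounded (7 * (k + 2 * h) * s) ys \<and> bounded2 (7 * (k + 2 * h) * s) qs"
proof -
  \<comment> \<open>A trade needs one square to start from. If there is none, a trivial one is
    added, for which the strict inequality leaves room.\<close>
  define xs1 where "xs1 = (if xs = [] then [0] else xs)"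
  have xs1: "SQ xs1 = SQ xs" "bounded s xs1" "length xs1 + 2 * length ps \<le> k + 2 * h" "xs1 \<noteq> []"
    using rank bnd by (auto simp: xs1_def)
  have big: "u \<le> 7 * (k + 2 * h) * s" if "u \<le> v * s" "v \<le> 7 * (k + 2 * h)" for u v
    using that by (meson le_trans mult_le_mono1)
  show ?thesis
  proof (cases "k \<le> length xs1")
    case True
    define t where "t = (length xs1 - k + 1) div 2"
    \<comment> \<open>A trade changes the number of squares by two, so a trivial square corrects the
      parity.\<close>
    define xs2 where "xs2 = (if even (length xs1 - k) then xs1 else 0 # xs1)"
    have len2: "length xs2 = k + 2 * t"
    proof -
      obtain d where "length xs1 = k + d" using True by (metis le_iff_add)
      then show ?thesis by (cases "even d") (auto simp: xs2_def t_def elim!: evenE oddE)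
    qed
    have th: "length ps + t \<le> h" using xs1(3) True unfolding t_def by linarith
    have xs2: "SQ xs2 = SQ xs" "bounded s xs2" "xs2 \<noteq> []" using xs1 by (auto simp: xs2_def)
    then obtain ys a where ya: "xs2 = ys @ [a]" by (cases xs2 rule: rev_cases) auto
    have "length ys = (k - 1) + 2 * t" using len2 k by (simp add: ya)
    from squares_to_comms[OF this, of s a s] xs2(2) obtain ys' e qs where c: "length ys' = k - 1"
      "length qs = t" "SQ (ys @ [a]) = SQ (ys' @ [e]) + CM qs" "bounded s ys'"
      "flen e \<le> s + 2 * t * s" "bounded2 (3 * (s + 2 * t * s) + 2 * s) qs" by (auto simp: ya)
    have bs: "s \<le> 7 * (k + 2 * h) * s" by (rule big[of _ 1]) (use k in auto)
    have be: "s + 2 * t * s \<le> 7 * (k + 2 * h) * s"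
      by (rule big[of _ "1 + 2 * t"]) (use k th in \<open>auto simp: algebra_simps\<close>)
    have bq: "3 * (s + 2 * t * s) + 2 * s \<le> 7 * (k + 2 * h) * s"
      by (rule big[of _ "5 + 6 * t"]) (use k th in \<open>auto simp: algebra_simps\<close>)
    let ?zs = "replicate (h - t - length ps) (0, 0)"
    have "SQ xs + CM ps = SQ (ys' @ [e]) + CM (qs @ ps @ ?zs)"
      unfolding xs2(1)[symmetric] ya c(3) by (simp add: add.assoc)
    moreover have "bounded (7 * (k + 2 * h) * s) (ys' @ [e])"
      using c(4,5) bs be by fastforce
    moreover have "bounded2 (7 * (k + 2 * h) * s) (qs @ ps @ ?zs)"
      using c(6) bnd(2) bq bs by fastforce
    ultimately show ?thesis
      using c(1,2) th k by (intro exI[of _ "ys' @ [e]"] exI[of _ "qs @ ps @ ?zs"]) simp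
  next
    case False
    define t where "t = length ps - h"
    have t: "length xs1 + 2 * t \<le> k" "t \<le> length ps" "length ps - t \<le> h"
      using xs1(3) False by (auto simp: t_def)
    have kt: "1 + 2 * t \<le> k" using t(1) xs1(4) by (cases xs1) auto
    obtain ys a where ya: "xs1 = ys @ [a]" using xs1(4) by (cases xs1 rule: rev_cases) auto
    have a: "flen a \<le> s" "bounded s ys" using xs1(2) by (simp_all add: ya)
    have "bounded2 s (take t ps)" using bnd(2) by (meson in_set_takeD)
    from comms_to_squares[OF this a(1)] t(2) obtain ys2 e where c: "length ys2 = 2 * t"
      "a + a + CM (take t ps) = SQ (ys2 @ [e])" "flen e \<le> s + t * s"
      "bounded (3 * (s + t * s) + 4 * s) ys2" by auto
    have bs: "s \<le> 7 * (k + 2 * h) * s" by (rule big[of _ 1]) (use k in auto)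
    have be: "s + t * s \<le> 7 * (k + 2 * h) * s"
      by (rule big[of _ "1 + t"]) (use k t in \<open>auto simp: algebra_simps\<close>)
    \<comment> \<open>This case fixes the factor 7: three accumulated elements and four more
      \<open>s\<close> make \<open>(7 + 3 * t) * s\<close>, which for \<open>t = 0\<close>,
      \<open>k = 1\<close> and \<open>h = 0\<close> meets the bound.\<close>
    have bq: "3 * (s + t * s) + 4 * s \<le> 7 * (k + 2 * h) * s"
      by (rule big[of _ "7 + 3 * t"]) (use k kt in \<open>auto simp: algebra_simps\<close>)
    let ?zs = "replicate (h - (length ps - t)) (0, 0)" and ?os = "replicate (k - length xs1 - 2 * t) (0 :: 'a fg)"
    have "CM ps = CM (take t ps) + CM (drop t ps)"
      using CM_simps(3)[of "take t ps" "drop t ps"] by simp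
    then have "SQ xs + CM ps = SQ ys + (a + a + CM (take t ps)) + CM (drop t ps)"
      unfolding xs1(1)[symmetric] ya by (simp add: add.assoc)
    also have "\<dots> = SQ (?os @ ys @ ys2 @ [e]) + CM (drop t ps @ ?zs)"
      unfolding c(2) by (simp add: add.assoc)
    finally have "SQ xs + CM ps = SQ (?os @ ys @ ys2 @ [e]) + CM (drop t ps @ ?zs)" .
    moreover have "bounded (7 * (k + 2 * h) * s) (?os @ ys @ ys2 @ [e])"
      using c(3,4) a(2) bs be bq by fastforce
    moreover have "bounded2 (7 * (k + 2 * h) * s) (drop t ps @ ?zs)"
    proof
      fix p assume "p \<in> set (drop t ps @ ?zs)"
      then have "p \<in> set ps \<or> p = (0, 0)" by (auto dest: in_set_dropD)
      then have "flen (fst p) \<le> s \<and> flen (snd p) \<le> s" using bnd(2) by auto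
      with bs show "flen (fst p) \<le> 7 * (k + 2 * h) * s \<and> flen (snd p) \<le> 7 * (k + 2 * h) * s"
        by (meson le_trans)
    qed
    ultimately show ?thesis
      using c(1) t by (intro exI[of _ "?os @ ys @ ys2 @ [e]"] exI[of _ "drop t ps @ ?zs"]) (simp add: ya)
  qed
qed

abbreviation invert_at :: "bool list \<Rightarrow> 'h :: group_add list \<Rightarrow> 'h list" where
  "invert_at fl cs \<equiv> map2 (\<lambda>f c. if f then - c else c) fl cs"

text \<open>The coefficients are treated from left to right, so the product \<open>B\<close> to the
  right of the current one, and also the suffix beginning with it, still consist of original data
  and are bounded by \<beta>. Each inversion therefore adds only \<open>2 * \<beta>\<close> to the
  root of the square, which is passed on to the next.\<close>

lemma flips:
  fixes cs zs :: "'a fg list"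
  assumes "length cs = length zs" "length zs = length fl"
  shows "(\<And>j. flen (CJ (drop j (invert_at fl cs)) (drop j zs)) \<le> \<beta>) \<Longrightarrow>
    bounded \<zeta> zs \<Longrightarrow> flen x \<le> \<xi> \<Longrightarrow>
    \<exists>zs' x'. length zs' = length zs \<and>
      CJ cs zs' + (x' + x') = CJ (invert_at fl cs) zs + (x + x) \<and>
      (\<forall>i<length zs. \<not> fl ! i \<longrightarrow> zs' ! i = zs ! i) \<and>
      flen x' \<le> \<xi> + 2 * \<beta> * count_list fl True \<and>
      bounded (\<zeta> + 2 * \<beta> + \<xi> + 2 * \<beta> * count_list fl True) zs'"
  using assms
proof (induction cs zs fl arbitrary: x \<xi> rule: list_induct3)
  case Nil
  then show ?case by (intro exI[of _ "[]"] exI[of _ x]) simp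
next
  case (Cons c cs z zs f fl)
  have suf: "flen (CJ (drop j (invert_at fl cs)) (drop j zs)) \<le> \<beta>" for j
    using Cons.prems(1)[of "Suc j"] by simp
  have zb: "flen z \<le> \<zeta>" "bounded \<zeta> zs" using Cons.prems(2) by simp_all
  define B where "B = CJ (invert_at fl cs) zs"
  have B: "flen B \<le> \<beta>" using suf[of 0] by (simp add: B_def)
  show ?case
  proof (cases f)
    case False
    from Cons.IH[OF suf zb(2) Cons.prems(3)] obtain zs' x' where IH: "length zs' = length zs"
      "CJ cs zs' + (x' + x') = CJ (invert_at fl cs) zs + (x + x)"
      "\<forall>i<length zs. \<not> fl ! i \<longrightarrow> zs' ! i = zs ! i"
      "flen x' \<le> \<xi> + 2 * \<beta> * count_list fl True"
      "bounded (\<zeta> + 2 * \<beta> + \<xi> + 2 * \<beta> * count_list fl True) zs'" by blast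
    have "CJ (c # cs) (z # zs') + (x' + x') = CJ (invert_at (f # fl) (c # cs)) (z # zs) + (x + x)"
      using IH(2) False by (simp add: add.assoc)
    then show ?thesis
      using IH zb False by (intro exI[of _ "z # zs'"] exI[of _ x']) (auto simp: nth_Cons split: nat.splits)
  next
    case True
    define y where "y = - B + conjg (- c) z + B + x"
    define z' where "z' = z + B - y - B"
    have cB: "flen (conjg (- c) z + B) \<le> \<beta>" using Cons.prems(1)[of 0] True by (simp add: B_def)
    have "flen y \<le> \<beta> + \<beta> + \<xi>"
      unfolding y_def using flen_plus[OF flen_plus[OF flen_uminus[OF B] cB] Cons.prems(3)]
      by (simp add: add.assoc)
    then have y: "flen y \<le> \<xi> + 2 * \<beta>" by simp
    have z': "flen z' \<le> \<zeta> + \<beta> + (\<xi> + 2 * \<beta>) + \<beta>"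
      unfolding z'_def by (intro flen_plus flen_minus2 zb B y)
    from Cons.IH[OF suf zb(2) y] obtain zs' x' where IH: "length zs' = length zs"
      "CJ cs zs' + (x' + x') = CJ (invert_at fl cs) zs + (y + y)"
      "\<forall>i<length zs. \<not> fl ! i \<longrightarrow> zs' ! i = zs ! i"
      "flen x' \<le> \<xi> + 2 * \<beta> + 2 * \<beta> * count_list fl True"
      "bounded (\<zeta> + 2 * \<beta> + (\<xi> + 2 * \<beta>) + 2 * \<beta> * count_list fl True) zs'" by blast
    have "CJ (c # cs) (z' # zs') + (x' + x') = conjg c z' + (B + (y + y))"
      using IH(2) by (simp add: add.assoc B_def)
    also have "\<dots> = CJ (invert_at (f # fl) (c # cs)) (z # zs) + (x + x)"
      unfolding z'_def y_def flip_identity using True by (simp add: B_def add.assoc)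
    finally show ?thesis
      using IH z' True
      by (intro exI[of _ "z' # zs'"] exI[of _ x']) (auto simp: nth_Cons algebra_simps split: nat.splits)
  qed
qed

section \<open>Short solutions of equations in standard form\<close>

lemma map2_upt:
  "length fl = length cs \<Longrightarrow> map2 f fl cs = map (\<lambda>j. f (fl ! j) (cs ! j)) [0..<length cs]"
  by (intro nth_equalityI) simp_all

lemma CJ_take_drop:
  assumes "length cs = length zs"
  shows "CJ cs zs = CJ (take j cs) (take j zs) + CJ (drop j cs) (drop j zs)"
  using assms
proof (induction cs zs arbitrary: j rule: list_induct2)
  case (Cons c cs z zs)
  then show ?case by (cases j) (simp_all add: add.assoc)
qed simp

lemma cls_flipw: "cls (flipw f c) = (if f then - cls c else cls c)"
  by (simp add: flipw_def cls_inv_word)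

text \<open>The given solution and the one from gluing and splitting share their coefficients up to
  conjugation and inversion, so both induce the same form on the functionals \<open>Z\<close> that
  vanish on the coefficients. Independence of the words split from \<open>V\<close>, together with
  the extension of functionals from \<open>V\<close> to \<open>Z\<close>, supplies the surjectivity
  that the rank comparison asks for.\<close>

lemma glued_solution:
  fixes cs :: "'b word list"
  assumes fq: "fully_quadratic (concat cs)" and \<rho>: "\<rho> < length cs"
    and len: "length zs = length cs"
    and zero: "CJ (map cls cs) zs + SQ xs + CM ps = 0"
  defines "C \<equiv> length (concat cs)"
  obtains fl zs' V xs' ps' where
    "length zs' = length cs" "length fl = length cs" "zs' ! \<rho> = 0" "\<not> fl ! \<rho>"
    "balanced (concat cs) \<Longrightarrow> True \<notin> set fl" "balanced (concat cs) \<Longrightarrow> xs' = []"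
    "CJ (invert_at fl (map cls cs)) zs' = - (SQ xs' + CM ps')"
    "\<And>j. flen (CJ (drop j (invert_at fl (map cls cs))) (drop j zs')) \<le> 3 * C"
    "bounded (3 * C) zs'" "bounded (2 * C) xs'" "bounded2 (2 * C) ps'"
    "length xs' + 2 * length ps' \<le> length xs + 2 * length ps"
    "xs' = [] \<Longrightarrow> xs \<noteq> [] \<Longrightarrow> 2 * length ps' < length xs + 2 * length ps"
proof -
  obtain fl zs' V where gl: "length zs' = length cs" "zs' ! \<rho> = 0" "\<not> fl \<rho>"
    "balanced (concat cs) \<Longrightarrow> \<forall>j. \<not> fl j"
    "fully_quadratic V" "balanced (concat cs) \<Longrightarrow> balanced V" "length V \<le> C"
    "CJ (map (\<lambda>j. cls (flipw (fl j) (cs ! j))) [0..<length cs]) zs' = cls V"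
    "\<And>k. k \<le> length cs \<Longrightarrow>
       flen (CJ (map (\<lambda>j. cls (flipw (fl j) (cs ! j))) [0..<k]) (take k zs')) \<le> 2 * C"
    "\<And>z. z \<in> set zs' \<Longrightarrow> flen z \<le> 3 * C"
    "\<And>u0 :: 'b \<Rightarrow> bit. \<exists>u. (\<forall>b\<in>fst ` set V. u b = u0 b) \<and> (\<forall>c\<in>set cs. ev u c = 0)"
    by (rule gluing[OF fq \<rho>, folded C_def]) (rule that)
  define fs where "fs = map fl [0..<length cs]"
  define ecs where "ecs = invert_at fs (map cls cs)"
  have lenf: "length fs = length cs" by (simp add: fs_def)
  have ecs: "ecs = map (\<lambda>j. cls (flipw (fl j) (cs ! j))) [0..<length cs]"
    unfolding ecs_def by (subst map2_upt) (auto simp: fs_def cls_flipw)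
  \<comment> \<open>Squares and commutators have to cancel the product of the conjugates, hence the
    inverse of \<open>V\<close>.\<close>
  let ?W = "inv_word V"
  have fqW: "fully_quadratic ?W" using gl(5) by (simp add: fully_quadratic_def)
  have balW: "balanced ?W" if "balanced (concat cs)"
    using gl(6)[OF that] by (simp add: balanced_def)
  obtain xw pw where sp: "splits ?W xw pw" and sp_bal: "balanced ?W \<longrightarrow> xw = []"
    using splitting[OF fqW] by blast
  have sp_eq: "cls ?W = SQ (map cls xw) + CM (map cls2 pw)" using sp by (simp add: splits_def)
  define xs' where "xs' = map cls xw"
  define ps' where "ps' = map cls2 pw"
  have tot: "CJ ecs zs' = - (SQ xs' + CM ps')"
    using gl(8) unfolding ecs xs'_def ps'_def sp_eq[symmetric] cls_inv_word by simp
  \<comment> \<open>A suffix is the inverse of a prefix, of length at most \<open>2 * C\<close>,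
    times the whole product, of length at most \<open>C\<close>.\<close>
  have suffix: "flen (CJ (drop j ecs) (drop j zs')) \<le> 3 * C" for j
  proof -
    have "CJ (drop j ecs) (drop j zs') = - CJ (take j ecs) (take j zs') + CJ ecs zs'"
      using CJ_take_drop[of ecs zs' j] gl(1) by (simp add: ecs add.assoc[symmetric])
    moreover have "flen (CJ (take j ecs) (take j zs')) \<le> 2 * C"
    proof (cases "j \<le> length cs")
      case True
      then show ?thesis using gl(9)[OF True] by (simp add: ecs take_map)
    next
      case False
      then show ?thesis using gl(9)[of "length cs"] gl(1) by (simp add: ecs)
    qed
    moreover have "flen (CJ ecs zs') \<le> C"
      using gl(7,8) flen_cls[of V] by (simp add: ecs)
    ultimately show ?thesis
      using flen_add[of "- CJ (take j ecs) (take j zs')" "CJ ecs zs'"] by simp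
  qed
  define Z where "Z = {u :: 'b \<Rightarrow> bit. \<forall>c\<in>set cs. lift u (cls c) = 0}"
  have Z: "(\<lambda>b. u b + v b) \<in> Z" if "u \<in> Z" "v \<in> Z" for u v
    using that unfolding Z_def mem_Collect_eq lift_add_fun by simp
  have form_eq: "form xs ps u v = form xs' ps' u v" if uv: "u \<in> Z" "v \<in> Z" for u v
  proof -
    let ?\<phi> = "into_heis u v"
    have bit0: "a + b = (0 :: bit) \<longleftrightarrow> a = b" for a b by (cases a; cases b) simp_all
    have 1: "?\<phi> (CJ (map cls cs) zs) = Heis 0 0 (\<Sum>c\<leftarrow>map cls cs. h3 (?\<phi> c))"
      using uv len by (intro into_heis_CJ) (auto simp: Z_def)
    have 2: "?\<phi> (CJ ecs zs') = Heis 0 0 (\<Sum>c\<leftarrow>ecs. h3 (?\<phi> c))"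
      using uv gl(1) by (intro into_heis_CJ) (auto simp: Z_def ecs ev_flipw)
    have "h3 (?\<phi> (cls (flipw (fl j) (cs ! j)))) = h3 (?\<phi> (cls (cs ! j)))" if "j < length cs" for j
      using uv that into_heis_flip[of u "cls (cs ! j)" v] by (simp add: cls_flipw Z_def)
    then have "map (\<lambda>c. h3 (?\<phi> c)) ecs = map (\<lambda>c. h3 (?\<phi> c)) (map cls cs)"
      by (intro nth_equalityI) (simp_all add: ecs)
    then have 3: "?\<phi> (CJ ecs zs') = ?\<phi> (CJ (map cls cs) zs)" unfolding 1 2 by simp
    have "?\<phi> (CJ (map cls cs) zs + (SQ xs + CM ps)) = 0"
      using zero by (simp add: add.assoc into_heis_hom(1))
    then have 4: "h3 (?\<phi> (CJ (map cls cs) zs)) = form xs ps u v"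
      unfolding into_heis_hom(2)[of _ _ _ "SQ xs + CM ps"] into_heis_form 1
        by (simp add: zero_heis bit0)
    have "?\<phi> (CJ ecs zs' + (SQ xs' + CM ps')) = 0"
      using tot by (simp add: into_heis_hom(1))
    then have "h3 (?\<phi> (CJ (map cls cs) zs)) = form xs' ps' u v"
      unfolding into_heis_hom(2)[of _ _ _ "SQ xs' + CM ps'"] into_heis_form 3 1
        by (simp add: zero_heis bit0)
    with 4 show ?thesis by simp
  qed
  have surj: "\<exists>v\<in>Z. coords xs' ps' v = (ss, ts)"
    if l: "length ss = length xs'" "length ts = length ps'" for ss ts
  proof -
    obtain u0 :: "'b \<Rightarrow> bit" where u0: "map (ev u0) xw = ss" "map (ev2 u0) pw = ts"
      using splits_values[OF sp, of ss ts] l by (auto simp: xs'_def ps'_def)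
    obtain u where u: "\<forall>b\<in>fst ` set V. u b = u0 b" "\<forall>c\<in>set cs. ev u c = 0"
      using gl(11) by blast
    have same: "u a = u0 a" if "a \<in> fst ` set ?W" for a
      using u(1) that unfolding names_inv_word by blast
    have "map (ev u) xw = map (ev u0) xw" "map (ev2 u) pw = map (ev2 u0) pw"
      by (rule splits_cong[OF sp]; rule same; assumption)+
    moreover have "coords xs' ps' u = (map (ev u) xw, map (ev2 u) pw)"
      by (auto simp: coords_def xs'_def ps'_def)
    moreover have "u \<in> Z" using u(2) by (simp add: Z_def)
    ultimately show ?thesis using u0 by auto
  qed
  have lW: "2 * length ?W \<le> 2 * C" using gl(7) by simp
  have lw: "length w \<le> 2 * C" if "w \<in> set xw \<union> fst ` set pw \<union> snd ` set pw" for w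
    using splits_words(1)[OF sp that] lW by simp
  show thesis
  proof (rule that[of zs' fs xs' ps'])
    show "length zs' = length cs" "length fs = length cs" "zs' ! \<rho> = 0" by (fact gl lenf)+
    show "\<not> fs ! \<rho>" using gl(3) \<rho> by (simp add: fs_def)
    show "balanced (concat cs) \<Longrightarrow> True \<notin> set fs" using gl(4) by (auto simp: fs_def)
    show "balanced (concat cs) \<Longrightarrow> xs' = []" using balW sp_bal by (simp add: xs'_def)
    show "CJ (invert_at fs (map cls cs)) zs' = - (SQ xs' + CM ps')"
      using tot by (simp add: ecs_def)
    show "\<And>j. flen (CJ (drop j (invert_at fs (map cls cs))) (drop j zs')) \<le> 3 * C"
      using suffix by (simp add: ecs_def)
    show "bounded (3 * C) zs'" using gl(10) by blast
    show "bounded (2 * C) xs'"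
      unfolding xs'_def using lw by (auto intro: le_trans[OF flen_cls])
    show "bounded2 (2 * C) ps'"
      unfolding ps'_def using lw by (force intro: le_trans[OF flen_cls])
    show "length xs' + 2 * length ps' \<le> length xs + 2 * length ps"
      by (rule form_rank(1)[OF Z form_eq surj])
    show "xs' = [] \<Longrightarrow> xs \<noteq> [] \<Longrightarrow> 2 * length ps' < length xs + 2 * length ps"
      by (rule form_rank(2)[OF Z form_eq surj])
  qed
qed

lemma forget_labels:
  fixes cs :: "'a word list" and cs' :: "('a \<times> nat) word list"
  assumes cs: "map (map (map_prod fst id)) cs' = cs" and len: "length zs = length cs'"
    and zero: "CJ (map cls cs') zs + SQ xs + CM ps = 0"
  defines "\<pi> \<equiv> lift (\<lambda>b. gen (fst b))"
  shows "CJ (map cls cs) (map \<pi> zs) + SQ (map \<pi> xs) + CM (map (map_prod \<pi> \<pi>) ps) = 0"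
    and "flen (\<pi> g) \<le> flen g"
proof -
  have "ev (\<lambda>b. gen (fst b)) w = ev gen (map (map_prod fst id) w)" for w :: "('a \<times> nat) word"
    by (induction w) (simp_all add: lev_def)
  then have "map (lift (\<lambda>b. gen (fst b))) (map cls cs') = map cls cs"
    unfolding cs[symmetric] by (simp add: comp_def)
  then show "CJ (map cls cs) (map \<pi> zs) + SQ (map \<pi> xs) + CM (map (map_prod \<pi> \<pi>) ps) = 0"
    using arg_cong[OF zero, of \<pi>] len by (simp add: \<pi>_def lift_SQ lift_CM lift_CJ)
  show "flen (\<pi> g) \<le> flen g"
    unfolding \<pi>_def
  proof (rule flen_lift)
    show "flen (gen (fst b)) \<le> 1" for b :: "'a \<times> nat"
      using flen_cls[of "[(fst b, True)]"] by (simp add: gen_def)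
  qed
qed

lemma bounded_map:
  assumes "\<And>g. flen (\<pi> g) \<le> flen g" "n \<le> L"
  shows "bounded n xs \<Longrightarrow> bounded L (map \<pi> xs)"
    and "bounded2 n ps \<Longrightarrow> bounded2 L (map (map_prod \<pi> \<pi>) ps)"
proof -
  have *: "flen g \<le> n \<Longrightarrow> flen (\<pi> g) \<le> L" for g
    using assms by (meson le_trans)
  show "bounded n xs \<Longrightarrow> bounded L (map \<pi> xs)"
    and "bounded2 n ps \<Longrightarrow> bounded2 L (map (map_prod \<pi> \<pi>) ps)"
    using * by auto
qed

lemma length_concat_labelled: "map (map f) cs' = cs \<Longrightarrow> length (concat cs') = length (concat cs)"
  by (auto simp: length_concat comp_def)

text \<open>Let \<open>N\<close> be the number of entries of squares and commutators. Reshaping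
  elements of length \<open>2 * C\<close> costs \<open>14 * N * C\<close>, conjugators start with
  \<open>3 * C\<close>, and inverting adds \<open>6 * C\<close> once and \<open>6 * C\<close> for
  each inverted coefficient. The factor in \<open>L\<close> is the number of variables, since
  \<open>\<rho>\<close> has no conjugator; nor is \<open>\<rho>\<close> ever inverted.\<close>

theorem short_solution_nonorientable:
  fixes cs :: "'a word list"
  assumes \<rho>: "\<rho> < length cs" and len: "length zs = length cs" and k: "xs \<noteq> []"
    and zero: "CJ (map cls cs) zs + SQ xs + CM ps = 0"
  defines "L \<equiv> 29 * (length xs + 2 * length ps + length cs - 1) * length (concat cs)"
  shows "\<exists>zs' xs' ps'. length zs' = length cs \<and> length xs' = length xs \<and> length ps' = length ps \<and>
    zs' ! \<rho> = 0 \<and> CJ (map cls cs) zs' + SQ xs' + CM ps' = 0 \<and>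
    bounded L zs' \<and> bounded L xs' \<and> bounded2 L ps'"
proof -
  let ?m = "length cs" and ?N = "length xs + 2 * length ps"
  from core_labelling[OF len zero] obtain cs' :: "('a \<times> nat) word list" and zl xl pl where
    lab: "length zl = length cs" "length xl = length xs" "length pl = length ps"
      "map (map (map_prod fst id)) cs' = cs" "fully_quadratic (concat cs')"
      "CJ (map cls cs') zl + SQ xl + CM pl = 0"
    by blast
  have m: "length cs' = ?m" using arg_cong[OF lab(4), of length] by simp
  define C where "C = length (concat cs')"
  have C: "C = length (concat cs)" using length_concat_labelled[OF lab(4)] by (simp add: C_def)
  obtain fl z1 x1 p1 where gs:
    "length z1 = length cs'" "length fl = length cs'" "z1 ! \<rho> = 0" "\<not> fl ! \<rho>"
    "CJ (invert_at fl (map cls cs')) z1 = - (SQ x1 + CM p1)"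
    "\<And>j. flen (CJ (drop j (invert_at fl (map cls cs'))) (drop j z1)) \<le> 3 * C"
    "bounded (3 * C) z1" "bounded (2 * C) x1" "bounded2 (2 * C) p1"
    "length x1 + 2 * length p1 \<le> length xl + 2 * length pl"
    "x1 = [] \<Longrightarrow> xl \<noteq> [] \<Longrightarrow> 2 * length p1 < length xl + 2 * length pl"
    by (rule glued_solution[OF lab(5) _ _ lab(6), folded C_def, of \<rho>])
      (use \<rho> lab(1) m in simp, use lab(1) m in simp, rule that)
  have "xl \<noteq> []" "1 \<le> length xs" using k lab(2) by (auto simp: Suc_le_eq)
  from reshape[OF this(2) _ _ gs(8,9), of "length ps"] gs(10,11) this lab(2,3)
  obtain x2 p2 where rs: "length x2 = length xs" "length p2 = length ps"
    "SQ x1 + CM p1 = SQ x2 + CM p2" "bounded (7 * ?N * (2 * C)) x2" "bounded2 (7 * ?N * (2 * C)) p2"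
    by auto
  \<comment> \<open>The first square stands next to the conjugates, so it is the one through which
    coefficients are carried.\<close>
  obtain x x3 where x3: "x2 = x # x3" using rs(1) k by (cases x2) auto
  let ?q = "count_list fl True"
  have "\<exists>zs' x'. length zs' = length z1 \<and>
      CJ (map cls cs') zs' + (x' + x') = CJ (invert_at fl (map cls cs')) z1 + (x + x) \<and>
      (\<forall>i<length z1. \<not> fl ! i \<longrightarrow> zs' ! i = z1 ! i) \<and>
      flen x' \<le> 7 * ?N * (2 * C) + 2 * (3 * C) * ?q \<and>
      bounded (3 * C + 2 * (3 * C) + 7 * ?N * (2 * C) + 2 * (3 * C) * ?q) zs'"
    by (rule flips) (use gs(1,2,6,7) rs(4) x3 in auto)
  then obtain z4 x4 where f: "length z4 = length z1"
    "CJ (map cls cs') z4 + (x4 + x4) = CJ (invert_at fl (map cls cs')) z1 + (x + x)"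
    "\<forall>i<length z1. \<not> fl ! i \<longrightarrow> z4 ! i = z1 ! i"
    "flen x4 \<le> 7 * ?N * (2 * C) + 2 * (3 * C) * ?q"
    "bounded (3 * C + 2 * (3 * C) + 7 * ?N * (2 * C) + 2 * (3 * C) * ?q) z4"
    by blast
  have "?q + 1 \<le> ?m"
  proof -
    have "?q + count_list fl False = length fl" by (induction fl) auto
    moreover have "count_list fl False \<noteq> 0"
      using gs(2,4) \<rho> m by (metis (full_types) count_list_0_iff nth_mem)
    ultimately show ?thesis using gs(2) m by simp
  qed
  then have q: "?q \<le> ?m - 1" by simp
  have N: "?N \<ge> 1" using k by (cases xs) auto
  have "6 * C * ?q \<le> 6 * C * (?m - 1)" using q by simp
  moreover have L: "L = 29 * ?N * C + 29 * C * (?m - 1)"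
    using \<rho> unfolding L_def C[symmetric] by (cases ?m) (simp_all add: algebra_simps)
  moreover have "9 * C \<le> 9 * ?N * C" using N by simp
  moreover have "6 * C * (?m - 1) \<le> 29 * C * (?m - 1)" by simp
  ultimately have b1: "3 * C + 2 * (3 * C) + 7 * ?N * (2 * C) + 2 * (3 * C) * ?q \<le> L"
    by (simp add: algebra_simps)
  then have b2: "7 * ?N * (2 * C) + 2 * (3 * C) * ?q \<le> L" "7 * ?N * (2 * C) \<le> L" by simp_all
  have "CJ (map cls cs') z4 + SQ (x4 # x3) + CM p2 = (CJ (map cls cs') z4 + (x4 + x4)) + (SQ x3 + CM p2)"
    by (simp add: add.assoc)
  also have "\<dots> = - (SQ x1 + CM p1) + (SQ x2 + CM p2)"
    unfolding f(2) gs(5) by (simp add: x3 add.assoc)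
  also have "\<dots> = 0" by (simp add: rs(3))
  finally have zero4: "CJ (map cls cs') z4 + SQ (x4 # x3) + CM p2 = 0" .
  let ?\<pi> = "lift (\<lambda>b :: 'a \<times> nat. gen (fst b))"
  have "length z4 = length cs'" using f(1) gs(1) by simp
  note fin = forget_labels[OF lab(4) this zero4]
  have "map ?\<pi> z4 ! \<rho> = 0" using f(1,3) gs(1,3,4) \<rho> m by simp
  moreover have "bounded L (map ?\<pi> z4)" by (rule bounded_map(1)[OF fin(2) b1 f(5)])
  moreover have "bounded L (map ?\<pi> (x4 # x3))"
    by (rule bounded_map(1)[OF fin(2) order_refl]) (use f(4) rs(4) b2 in \<open>auto simp: x3\<close>)
  moreover have "bounded2 L (map (map_prod ?\<pi> ?\<pi>) p2)"
    by (rule bounded_map(2)[OF fin(2) b2(2) rs(5)])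
  ultimately show ?thesis
    using fin(1) f(1) gs(1) m rs(1,2) x3
    by (intro exI[of _ "map ?\<pi> z4"] exI[of _ "map ?\<pi> (x4 # x3)"] exI[of _ "map (map_prod ?\<pi> ?\<pi>) p2"]) simp
qed

lemma sum_list_conjg_int: "length cs = length zs \<Longrightarrow> CJ cs zs = (sum_list cs :: int)"
  by (induction cs zs rule: list_induct2) (simp_all add: conjg_def)

lemma CM_int: "CM ps = (0 :: int)"
  by (induction ps) (simp_all add: comm_def)

lemma ev_indicator:
  "ev (\<lambda>a. if a = b then 1 else 0 :: int) w = int (count_list w (b, True)) - int (count_list w (b, False))"
  by (induction w) (auto simp: lev_def)

text \<open>Under the exponent sum of one letter conjugators disappear and commutators vanish, so
  the coefficients alone must add up to 0.\<close>

lemma solvable_balanced: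
  fixes cs :: "'b word list"
  assumes "length cs = length zs" "CJ (map cls cs) zs + CM ps = 0"
  shows "balanced (concat cs)"
  unfolding balanced_def
proof
  fix b :: 'b
  let ?e = "\<lambda>a :: 'b. if a = b then 1 else 0 :: int"
  have "ev ?e (concat cs) = sum_list (map (ev ?e) cs)"
    by (induction cs) simp_all
  also have "\<dots> = lift ?e (CJ (map cls cs) zs + CM ps)"
    using assms(1) by (simp add: lift_CJ lift_CM sum_list_conjg_int CM_int comp_def)
  also have "\<dots> = 0" unfolding assms(2) by simp
  finally show "count_list (concat cs) (b, True) = count_list (concat cs) (b, False)"
    by (simp add: ev_indicator)
qed

text \<open>Once the letters are named, solvability forces balanced coefficients; so nothing is
  inverted and no squares arise. Conjugators give the bound \<open>3 * C\<close>, commutators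
  \<open>2 * C\<close>, and missing commutators are replaced by trivial ones.\<close>

theorem short_solution_orientable:
  fixes cs :: "'a word list"
  assumes \<rho>: "\<rho> < length cs" and len: "length zs = length cs"
    and zero: "CJ (map cls cs) zs + CM ps = 0"
  defines "L \<equiv> 3 * length (concat cs)"
  shows "\<exists>zs' ps'. length zs' = length cs \<and> length ps' = length ps \<and>
    zs' ! \<rho> = 0 \<and> CJ (map cls cs) zs' + CM ps' = 0 \<and> bounded L zs' \<and> bounded2 L ps'"
proof -
  have "CJ (map cls cs) zs + SQ [] + CM ps = 0" using zero by simp
  from core_labelling[OF len this] obtain cs' :: "('a \<times> nat) word list" and zl xl pl where
    lab: "length zl = length cs" "length xl = length ([] :: 'a fg list)" "length pl = length ps"
      "map (map (map_prod fst id)) cs' = cs" "fully_quadratic (concat cs')"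
      "CJ (map cls cs') zl + SQ xl + CM pl = 0"
    by blast
  have m: "length cs' = length cs" using arg_cong[OF lab(4), of length] by simp
  define C where "C = length (concat cs')"
  have C: "L = 3 * C" using length_concat_labelled[OF lab(4)] by (simp add: C_def L_def)
  have bal: "balanced (concat cs')" using lab(1,2,6) m by (intro solvable_balanced) auto
  obtain fl z1 x1 p1 where gs:
    "length z1 = length cs'" "length fl = length cs'" "z1 ! \<rho> = 0" "True \<notin> set fl" "x1 = []"
    "CJ (invert_at fl (map cls cs')) z1 = - (SQ x1 + CM p1)"
    "bounded (3 * C) z1" "bounded2 (2 * C) p1"
    "length x1 + 2 * length p1 \<le> length xl + 2 * length pl"
    by (rule glued_solution[OF lab(5) _ _ lab(6), folded C_def, of \<rho>])
      (use \<rho> lab(1) m in simp, use lab(1) m in simp, rule that, use bal in auto)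
  have "invert_at fl (map cls cs') = map cls cs'"
    using gs(2,4) by (intro nth_equalityI) (auto simp: in_set_conv_nth)
  with gs(6) have eq: "CJ (map cls cs') z1 = - CM p1" by (simp add: gs(5))
  let ?ps = "p1 @ replicate (length ps - length p1) (0, 0)"
  have "CJ (map cls cs') z1 + SQ [] + CM ?ps = 0" by (simp add: eq)
  note fin = forget_labels[OF lab(4) gs(1) this]
  let ?\<pi> = "lift (\<lambda>b :: 'a \<times> nat. gen (fst b))"
  have "map ?\<pi> z1 ! \<rho> = 0" using gs(1,3) \<rho> m by simp
  moreover have "bounded L (map ?\<pi> z1)"
    unfolding C by (rule bounded_map(1)[OF fin(2) order_refl gs(7)])
  moreover have "bounded2 L (map (map_prod ?\<pi> ?\<pi>) ?ps)"
  proof -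
    have "bounded2 (3 * C) ?ps" using gs(8) by fastforce
    then show ?thesis unfolding C by (rule bounded_map(2)[OF fin(2) order_refl])
  qed
  ultimately show ?thesis
    using fin(1) gs(1,9) m lab(2,3)
    by (intro exI[of _ "map ?\<pi> z1"] exI[of _ "map (map_prod ?\<pi> ?\<pi>) ?ps"]) simp
qed

section \<open>Reduction of quadratic words to standard form\<close>

definition sub :: "'g set \<Rightarrow> ('g \<Rightarrow> 'g fg) \<Rightarrow> 'g \<Rightarrow> 'g fg" where
  "sub X \<beta> y = (if y \<in> X then \<beta> y else gen y)"

text \<open>The value is prescribed for the signed letter \<open>k\<close>, which spares the
  reductions a case distinction on its sign.\<close>

definition assign :: "('g \<Rightarrow> 'g fg) \<Rightarrow> 'g letter \<Rightarrow> 'g fg \<Rightarrow> 'g \<Rightarrow> 'g fg" where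
  "assign \<beta> k v = \<beta>(fst k := if snd k then v else - v)"

lemma lev_assign: "fst k \<in> X \<Longrightarrow> lev (sub X (assign \<beta> k v)) k = v"
  by (simp add: lev_def sub_def assign_def)

lemma lev_assign_other: "fst l \<noteq> fst k \<Longrightarrow> lev (sub X (assign \<beta> k v)) l = lev (sub X \<beta>) l"
  by (simp add: lev_def sub_def assign_def)

lemma ev_assign: "occ w (fst k) = 0 \<Longrightarrow> ev (sub X (assign \<beta> k v)) w = ev (sub X \<beta>) w"
proof (rule ev_cong)
  fix y assume "occ w (fst k) = 0" "y \<in> fst ` set w"
  then have "y \<noteq> fst k" unfolding occ_eq_0 by blast
  then show "sub X (assign \<beta> k v) y = sub X \<beta> y" by (simp add: sub_def assign_def)
qed

lemma ev_sub_coef: "fst ` set w \<inter> X = {} \<Longrightarrow> ev (sub X \<beta>) w = cls w"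
  unfolding ev_gen[symmetric] by (rule ev_cong) (auto simp: sub_def)

section \<open>Bounds for all prefixes of a word\<close>

fun prefix_bound :: "('g \<Rightarrow> 'g fg) \<Rightarrow> nat \<Rightarrow> 'g fg \<Rightarrow> 'g word \<Rightarrow> bool" where
  "prefix_bound \<gamma> D g [] \<longleftrightarrow> flen g \<le> D"
| "prefix_bound \<gamma> D g (l # w) \<longleftrightarrow> flen g \<le> D \<and> prefix_bound \<gamma> D (g + lev \<gamma> l) w"

lemma prefix_bound_start: "prefix_bound \<gamma> D g w \<Longrightarrow> flen g \<le> D"
  by (cases w) simp_all

lemma prefix_bound_append [simp]:
  "prefix_bound \<gamma> D g (u @ v) \<longleftrightarrow> prefix_bound \<gamma> D g u \<and> prefix_bound \<gamma> D (g + ev \<gamma> u) v"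
  by (induction u arbitrary: g) (auto simp: add.assoc dest: prefix_bound_start)

text \<open>A factor on the left moves all prefixes alike, so it costs its own length once, however
  long \<open>w\<close> is.\<close>

lemma prefix_bound_shift:
  "prefix_bound \<gamma> D g w \<Longrightarrow> flen h + D \<le> D' \<Longrightarrow> prefix_bound \<gamma> D' (h + g) w"
proof (induction w arbitrary: g)
  case Nil
  then show ?case using flen_add[of h g] by simp
next
  case (Cons l w)
  then show ?case using flen_add[of h g] by (simp add: add.assoc)
qed

lemma prefix_bound_mono: "prefix_bound \<gamma> D g w \<Longrightarrow> D \<le> D' \<Longrightarrow> prefix_bound \<gamma> D' g w"
  using prefix_bound_shift[of \<gamma> D g w 0 D'] by simp

lemma prefix_bound_end: "prefix_bound \<gamma> D g w \<Longrightarrow> flen (g + ev \<gamma> w) \<le> D"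
  by (induction w arbitrary: g) (auto simp: add.assoc[symmetric])

text \<open>The inverse word passes through the same points in the opposite order.\<close>

lemma prefix_bound_inv: "prefix_bound \<gamma> D g (inv_word w) \<longleftrightarrow> prefix_bound \<gamma> D (g - ev \<gamma> w) w"
proof (induction w arbitrary: g)
  case (Cons l w)
  have "g - ev \<gamma> w - lev \<gamma> l + lev \<gamma> l = g - ev \<gamma> w" by simp
  moreover have "g - (lev \<gamma> l + ev \<gamma> w) = g - ev \<gamma> w - lev \<gamma> l"
    by (simp add: group_word_simps del: add_uminus_conv_diff)
  ultimately show ?case
    using Cons[of g] by (auto dest: prefix_bound_start)
qed simp

lemma prefix_bound_coef:
  assumes "fst ` set w \<inter> X = {}"
  shows "flen g + length w \<le> D \<Longrightarrow> prefix_bound (sub X \<beta>) D g w"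
  using assms
proof (induction w arbitrary: g)
  case (Cons l w)
  have "lev (sub X \<beta>) l = cls [l]" using ev_sub_coef[of "[l]" X \<beta>] Cons.prems(2) by simp
  then have "flen (g + lev (sub X \<beta>) l) \<le> flen g + 1"
    using flen_add[of g "cls [l]"] flen_cls[of "[l]"] by simp
  then show ?case using Cons by simp
qed simp

text \<open>A letter is the quotient of two consecutive prefixes.\<close>

lemma prefix_bound_letter:
  "prefix_bound \<gamma> D g w \<Longrightarrow> y \<in> fst ` set w \<Longrightarrow> flen (\<gamma> y) \<le> 2 * D"
proof (induction w arbitrary: g)
  case (Cons l w)
  show ?case
  proof (cases "y = fst l")
    case True
    have "lev \<gamma> l = - g + (g + lev \<gamma> l)" by simp
    then have "flen (lev \<gamma> l) \<le> flen g + flen (g + lev \<gamma> l)"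
      using flen_add[of "- g" "g + lev \<gamma> l"] by simp
    moreover have "flen (g + lev \<gamma> l) \<le> D" "flen g \<le> D"
      using Cons.prems(1) prefix_bound_start by auto
    ultimately show ?thesis using True by (simp add: lev_def split: if_splits)
  qed (use Cons in auto)
qed simp

lemma prefix_bound_assign:
  "occ w (fst k) = 0 \<Longrightarrow> prefix_bound (sub X (assign \<beta> k v)) D g w \<longleftrightarrow> prefix_bound (sub X \<beta>) D g w"
  by (induction w arbitrary: g) (auto simp: lev_assign_other split: if_splits)

definition nvars :: "'g set \<Rightarrow> 'g word \<Rightarrow> nat" where
  "nvars X w = card (X \<inter> fst ` set w)"

definition ncoefs :: "'g set \<Rightarrow> 'g word \<Rightarrow> nat" where
  "ncoefs X w = length (filter (\<lambda>l. fst l \<notin> X) w)"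

lemma nvars_Suc:
  assumes "fst ` set w = insert x (fst ` set v)" "x \<in> X" "occ v x = 0"
  shows "nvars X w = Suc (nvars X v)"
proof -
  have "X \<inter> fst ` set w = insert x (X \<inter> fst ` set v)" using assms by auto
  moreover have "x \<notin> X \<inter> fst ` set v" using assms(3) by (auto simp: occ_eq_0)
  ultimately show ?thesis by (simp add: nvars_def)
qed

text \<open>Bounding the values of all prefixes of \<open>Q\<close>, rather than those of the variables, is what
  makes the bounds add up, instead of multiply, along a chain of reductions.\<close>

definition reduces :: "'g set \<Rightarrow> 'g word \<Rightarrow> nat \<Rightarrow> nat \<Rightarrow> 'g word list \<Rightarrow> bool" where
  "reduces X Q k h cs \<longleftrightarrow>
     cs \<noteq> [] \<and> k + 2 * h + length cs = Suc (nvars X Q) \<and> length (concat cs) = ncoefs X Q \<and>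
     (\<forall>\<beta>. \<exists>xs ps zs. length xs = k \<and> length ps = h \<and> length zs = length cs \<and> last zs = 0 \<and>
        ev (sub X \<beta>) Q = SQ xs + CM ps + CJ (map cls cs) zs) \<and>
     (\<forall>xs ps zs L. length xs = k \<longrightarrow> length ps = h \<longrightarrow> length zs = length cs \<longrightarrow> last zs = 0 \<longrightarrow>
        bounded L xs \<longrightarrow> bounded2 L ps \<longrightarrow> bounded L zs \<longrightarrow>
        (\<exists>\<beta>. ev (sub X \<beta>) Q = SQ xs + CM ps + CJ (map cls cs) zs \<and>
           prefix_bound (sub X \<beta>) (2 * nvars X Q * L + ncoefs X Q) 0 Q))"

lemma reduces_forward:
  assumes "reduces X Q k h cs"
  obtains xs ps zs where "length xs = k" "length ps = h" "length zs = length cs" "last zs = 0"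
    "ev (sub X \<beta>) Q = SQ xs + CM ps + CJ (map cls cs) zs"
  using assms unfolding reduces_def by blast

lemma reduces_backward:
  assumes "reduces X Q k h cs" "length xs = k" "length ps = h" "length zs = length cs" "last zs = 0"
    "bounded L xs" "bounded2 L ps" "bounded L zs"
  obtains \<beta> where "ev (sub X \<beta>) Q = SQ xs + CM ps + CJ (map cls cs) zs"
    "prefix_bound (sub X \<beta>) (2 * nvars X Q * L + ncoefs X Q) 0 Q"
  using assms unfolding reduces_def by blast

section \<open>Single reduction steps and their costs\<close>

lemma reduces_coef:
  assumes "fst ` set Q \<inter> X = {}"
  shows "reduces X Q 0 0 [Q]"
proof -
  have "ncoefs X Q = length Q"
  proof -
    have "filter (\<lambda>l. fst l \<notin> X) Q = Q" using assms by (auto simp: filter_id_conv)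
    then show ?thesis by (simp add: ncoefs_def)
  qed
  moreover have "nvars X Q = 0" using assms by (simp add: nvars_def Int_commute)
  moreover have "CJ [cls Q] zs = cls Q" if "length zs = 1" "last zs = 0" for zs
    using that by (cases zs) (auto simp: conjg_def)
  ultimately show ?thesis
    using assms prefix_bound_coef[OF assms, of 0]
    by (auto simp: reduces_def ev_sub_coef conjg_def[of _ 0] intro!: exI[of _ "[0]"])
qed

text \<open>A pair that encloses only coefficients turns them into a new coefficient
  \<open>P\<close>, conjugated by the freed value \<open>z\<close>. The prefixes after it are
  shifted by \<open>conjg (cls P) z\<close>, of length at most \<open>2 * L + length P\<close>: the
  shares of one variable and of \<open>P\<close> in the bound.\<close>

lemma reduces_planar:
  assumes Q: "Q = A @ k # P @ inv_letter k # B" and k: "fst k \<in> X" and P: "fst ` set P \<inter> X = {}"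
    and occ: "occ Q (fst k) = 2" and red: "reduces X (A @ B) 0 0 cs"
  shows "reduces X Q 0 0 (P # cs)"
proof -
  have occ0: "occ A (fst k) = 0" "occ P (fst k) = 0" "occ B (fst k) = 0"
    using occ by (simp_all add: Q)
  have nQ: "nvars X Q = Suc (nvars X (A @ B))"
  proof -
    have "X \<inter> fst ` set Q = X \<inter> fst ` set (A @ k # B)" using P by (auto simp: Q)
    then have "nvars X Q = nvars X (A @ k # B)" by (simp add: nvars_def)
    also have "\<dots> = Suc (nvars X (A @ B))" using k occ0 by (intro nvars_Suc[of _ "fst k"]) auto
    finally show ?thesis .
  qed
  have cP: "ncoefs X P = length P"
  proof -
    have "filter (\<lambda>l. fst l \<notin> X) P = P" using P by (auto simp: filter_id_conv)
    then show ?thesis by (simp add: ncoefs_def)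
  qed
  have cQ: "ncoefs X Q = length P + ncoefs X (A @ B)"
    using k cP by (simp add: ncoefs_def Q)
  have cs: "cs \<noteq> []" "length cs = Suc (nvars X (A @ B))" "length (concat cs) = ncoefs X (A @ B)"
    using red by (simp_all add: reduces_def)
  have ev: "ev (sub X \<beta>) Q = conjg (cls P) z + ev (sub X \<beta>) (A @ B)"
    if "lev (sub X \<beta>) k = - ev (sub X \<beta>) A - z" for \<beta> z
    unfolding Q by (simp add: that ev_sub_coef[OF P] conjg_def group_word_simps del: add_uminus_conv_diff)
  show ?thesis
    unfolding reduces_def
  proof (intro conjI allI impI)
    show "P # cs \<noteq> []" "0 + 2 * 0 + length (P # cs) = Suc (nvars X Q)"
      "length (concat (P # cs)) = ncoefs X Q"
      using cs nQ cQ by simp_all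
  next
    fix \<beta>
    obtain zs where zs: "length zs = length cs" "last zs = 0"
      "ev (sub X \<beta>) (A @ B) = CJ (map cls cs) zs"
      by (rule reduces_forward[OF red, of \<beta>]) auto
    let ?z = "- lev (sub X \<beta>) k - ev (sub X \<beta>) A"
    have "ev (sub X \<beta>) Q = conjg (cls P) ?z + CJ (map cls cs) zs"
      unfolding zs(3)[symmetric]
      by (rule ev) (simp add: group_word_simps del: add_uminus_conv_diff)
    then show "\<exists>xs ps zs. length xs = 0 \<and> length ps = 0 \<and> length zs = length (P # cs) \<and> last zs = 0 \<and>
        ev (sub X \<beta>) Q = SQ xs + CM ps + CJ (map cls (P # cs)) zs"
      using zs(1,2) cs by (intro exI[of _ "[]"] exI[of _ "?z # zs"]) auto
  next
    fix xs :: "'a fg list" and ps :: "('a fg \<times> 'a fg) list" and zs :: "'a fg list" and L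
    assume l: "length xs = 0" "length ps = 0" "length zs = length (P # cs)" "last zs = 0" "bounded L zs"
    obtain z zs1 where z: "zs = z # zs1" using l by (cases zs) auto
    have "length zs1 = length cs" "bounded L zs1" "flen z \<le> L"
      using l z by auto
    moreover from this have "last zs1 = 0" using l(4) z cs(1) by (cases zs1) auto
    ultimately obtain \<beta>1 where \<beta>1: "ev (sub X \<beta>1) (A @ B) = CJ (map cls cs) zs1"
      "prefix_bound (sub X \<beta>1) (2 * nvars X (A @ B) * L + ncoefs X (A @ B)) 0 (A @ B)"
      using reduces_backward[OF red, of "[]" "[]" zs1 L] by auto
    let ?D1 = "2 * nvars X (A @ B) * L + ncoefs X (A @ B)" and ?D = "2 * nvars X Q * L + ncoefs X Q"
    let ?v = "- ev (sub X \<beta>1) A - z"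
    define \<beta> where "\<beta> = assign \<beta>1 k ?v"
    have kv: "lev (sub X \<beta>) k = ?v" using k by (simp add: \<beta>_def lev_assign)
    have e: "ev (sub X \<beta>) A = ev (sub X \<beta>1) A" "ev (sub X \<beta>) B = ev (sub X \<beta>1) B"
      using occ0 by (simp_all add: \<beta>_def ev_assign)
    have "ev (sub X \<beta>) Q = CJ (map cls (P # cs)) zs"
      using ev[of \<beta> z] kv e \<beta>1(1) by (simp add: z)
    moreover have "prefix_bound (sub X \<beta>) ?D 0 Q"
    proof -
      have D: "?D = 2 * L + length P + ?D1" by (simp add: nQ cQ algebra_simps)
      have A: "prefix_bound (sub X \<beta>) ?D1 0 A" and B: "prefix_bound (sub X \<beta>) ?D1 (ev (sub X \<beta>) A) B"
        using \<beta>1(2) occ0 e by (simp_all add: \<beta>_def prefix_bound_assign)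
      have A': "prefix_bound (sub X \<beta>) ?D 0 A" using A D by (auto intro: prefix_bound_mono)
      have g1: "ev (sub X \<beta>) A + lev (sub X \<beta>) k = - z"
        using kv e by (simp add: group_word_simps del: add_uminus_conv_diff)
      have P': "prefix_bound (sub X \<beta>) ?D (- z) P"
        using \<open>flen z \<le> L\<close> D by (intro prefix_bound_coef[OF P]) simp
      let ?h = "conjg (cls P) z"
      have g2: "- z + ev (sub X \<beta>) P - lev (sub X \<beta>) k = ?h + ev (sub X \<beta>) A"
        using kv e by (simp add: ev_sub_coef[OF P] conjg_def group_word_simps del: add_uminus_conv_diff)
      have "flen ?h \<le> L + length P + L"
        unfolding conjg_def using \<open>flen z \<le> L\<close> by (intro flen_plus flen_uminus flen_cls)
      then have B': "prefix_bound (sub X \<beta>) ?D (?h + ev (sub X \<beta>) A) B"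
        using D by (intro prefix_bound_shift[OF B]) simp
      have "prefix_bound (sub X \<beta>) D 0 Q" if D: "D = ?D" for D
        unfolding Q using A'[folded D] P'[folded D] B'[folded D] g1 g2
          prefix_bound_start[OF B', folded D] prefix_bound_end[OF P', folded D]
          prefix_bound_end[OF A', folded D] by simp
      then show ?thesis by blast
    qed
    ultimately show "\<exists>\<beta>. ev (sub X \<beta>) Q = SQ xs + CM ps + CJ (map cls (P # cs)) zs \<and>
           prefix_bound (sub X \<beta>) ?D 0 Q"
      using l(1,2) by (intro exI[of _ \<beta>]) simp
  qed
qed

text \<open>The pieces \<open>T\<close>, \<open>P\<close>, \<open>M\<close>, \<open>R\<close>,
  \<open>S\<close> start from the same values as in the shorter word, shifted on the left by the
  successive prefixes of the commutator of \<open>a\<close> and \<open>b\<close>. These have length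
  at most \<open>4 * L\<close>, which is \<open>2 * L\<close> for each of the two variables.\<close>

lemma reduces_crossing:
  assumes Q: "Q = T @ inv_letter k # P @ inv_letter l # M @ k # R @ l # S"
    and k: "fst k \<in> X" "fst l \<in> X"
    and occ: "occ Q (fst k) = 2" "occ Q (fst l) = 2" and red: "reduces X (T @ R @ M @ P @ S) 0 h cs"
  shows "reduces X Q 0 (Suc h) cs"
proof -
  let ?Q1 = "T @ R @ M @ P @ S"
  have kl: "fst k \<noteq> fst l" using occ by (auto simp: Q)
  have occ0: "occ w (fst k) = 0" "occ w (fst l) = 0" if "w \<in> {T, P, M, R, S}" for w
    using occ kl that by (auto simp: Q)
  have nQ: "nvars X Q = nvars X ?Q1 + 2"
  proof -
    have "nvars X Q = Suc (nvars X (k # ?Q1))"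
      using occ0 kl k by (intro nvars_Suc[of _ "fst l"]) (auto simp: Q)
    also have "nvars X (k # ?Q1) = Suc (nvars X ?Q1)"
      using occ0 k by (intro nvars_Suc[of _ "fst k"]) auto
    finally show ?thesis by simp
  qed
  have cQ: "ncoefs X Q = ncoefs X ?Q1" using k by (simp add: ncoefs_def Q)
  have cs: "cs \<noteq> []" "2 * h + length cs = Suc (nvars X ?Q1)" "length (concat cs) = ncoefs X ?Q1"
    using red by (simp_all add: reduces_def)
  show ?thesis
    unfolding reduces_def
  proof (intro conjI allI impI)
    show "cs \<noteq> []" "0 + 2 * Suc h + length cs = Suc (nvars X Q)" "length (concat cs) = ncoefs X Q"
      using cs nQ cQ by simp_all
  next
    fix \<beta>
    let ?e = "ev (sub X \<beta>)" and ?k = "lev (sub X \<beta>) k" and ?l = "lev (sub X \<beta>) l"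
    obtain xs ps zs where zs: "length xs = 0" "length ps = h" "length zs = length cs" "last zs = 0"
      "?e ?Q1 = SQ xs + CM ps + CJ (map cls cs) zs"
      by (rule reduces_forward[OF red, of \<beta>])
    define a where "a = ?e T + ?e R + ?e M + ?k - ?e T"
    define b where "b = ?e T + ?e R + ?l - (?e T + ?e R + ?e M + ?e P)"
    have "?e Q = comm a b + ?e ?Q1"
      using crossing_identity[of "?e T" ?k "?e P" ?l "?e M" "?e R" "?e S"]
      by (simp add: Q a_def b_def)
    then have "?e Q = SQ xs + CM ((a, b) # ps) + CJ (map cls cs) zs"
      using zs(1,5) by (simp add: add.assoc)
    then show "\<exists>xs ps zs. length xs = 0 \<and> length ps = Suc h \<and> length zs = length cs \<and> last zs = 0 \<and>
        ?e Q = SQ xs + CM ps + CJ (map cls cs) zs"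
      using zs(1-4) by (intro exI[of _ xs] exI[of _ "(a, b) # ps"] exI[of _ zs]) simp
  next
    fix xs :: "'a fg list" and ps :: "('a fg \<times> 'a fg) list" and zs :: "'a fg list" and L
    assume len: "length xs = 0" "length ps = Suc h" "length zs = length cs" "last zs = 0"
      "bounded L xs" "bounded2 L ps" "bounded L zs"
    obtain a b ps1 where p: "ps = (a, b) # ps1" using len(2) by (cases ps) auto
    have "length ps1 = h" "bounded2 L ps1" and ab: "flen a \<le> L" "flen b \<le> L"
      using len p by auto
    with len obtain \<beta>1 where \<beta>1: "ev (sub X \<beta>1) ?Q1 = SQ xs + CM ps1 + CJ (map cls cs) zs"
      "prefix_bound (sub X \<beta>1) (2 * nvars X ?Q1 * L + ncoefs X ?Q1) 0 ?Q1"
      using reduces_backward[OF red, of xs ps1 zs L] by blast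
    let ?D1 = "2 * nvars X ?Q1 * L + ncoefs X ?Q1" and ?D = "2 * nvars X Q * L + ncoefs X Q"
    let ?f = "ev (sub X \<beta>1)"
    \<comment> \<open>\<open>vk\<close> and \<open>vl\<close> come from solving the definitions of
      \<open>a\<close> and \<open>b\<close> in \<open>crossing_identity\<close> for \<open>k\<close>
      and \<open>l\<close>.\<close>
    define vk where "vk = - (?f T + ?f R + ?f M) + a + ?f T"
    define vl where "vl = - (?f T + ?f R) + b + (?f T + ?f R + ?f M + ?f P)"
    define \<beta> where "\<beta> = assign (assign \<beta>1 k vk) l vl"
    have kv: "lev (sub X \<beta>) k = vk" "lev (sub X \<beta>) l = vl"
      using k kl by (simp_all add: \<beta>_def lev_assign lev_assign_other)
    have e: "ev (sub X \<beta>) w = ?f w" if "w \<in> {T, P, M, R, S}" for w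
      using occ0[OF that] by (simp add: \<beta>_def ev_assign)
    have e': "ev (sub X \<beta>) T = ?f T" "ev (sub X \<beta>) P = ?f P" "ev (sub X \<beta>) M = ?f M"
      "ev (sub X \<beta>) R = ?f R" "ev (sub X \<beta>) S = ?f S"
      by (simp_all add: e)
    have "ev (sub X \<beta>) Q = comm a b + ?f ?Q1"
      by (simp add: Q kv e' vk_def vl_def comm_def group_word_simps del: add_uminus_conv_diff)
    then have "ev (sub X \<beta>) Q = SQ xs + CM ps + CJ (map cls cs) zs"
      using \<beta>1(1) len(1) by (simp add: p add.assoc)
    moreover have "prefix_bound (sub X \<beta>) ?D 0 Q"
    proof -
      have D: "?D = 4 * L + ?D1" by (simp add: nQ cQ algebra_simps)
      have pb: "prefix_bound (sub X \<beta>) ?D (h + g) w"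
        if "prefix_bound (sub X \<beta>1) ?D1 g w" "w \<in> {T, P, M, R, S}" "flen h \<le> 4 * L" for h g w
      proof (rule prefix_bound_shift)
        show "prefix_bound (sub X \<beta>) ?D1 g w"
          using that(1) occ0[OF that(2)] by (simp add: \<beta>_def prefix_bound_assign)
      qed (use that D in simp)
      have 1: "prefix_bound (sub X \<beta>1) ?D1 0 T" "prefix_bound (sub X \<beta>1) ?D1 (?f T) R"
        "prefix_bound (sub X \<beta>1) ?D1 (?f T + ?f R) M"
        "prefix_bound (sub X \<beta>1) ?D1 (?f T + ?f R + ?f M) P"
        "prefix_bound (sub X \<beta>1) ?D1 (?f T + ?f R + ?f M + ?f P) S"
        using \<beta>1(2) by simp_all
      have T: "prefix_bound (sub X \<beta>) ?D 0 T" using pb[OF 1(1), of 0] by simp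
      have "flen (- a) \<le> 4 * L" using ab by simp
      then have P: "prefix_bound (sub X \<beta>) ?D (- a + (?f T + ?f R + ?f M)) P"
        by (intro pb 1) simp_all
      have "flen (- a - b) \<le> L + L" by (intro flen_minus2 flen_uminus ab)
      then have M: "prefix_bound (sub X \<beta>) ?D (- a - b + (?f T + ?f R)) M"
        by (intro pb 1) simp_all
      have "flen (- a - b + a) \<le> L + L + L" by (intro flen_plus flen_minus2 flen_uminus ab)
      then have R: "prefix_bound (sub X \<beta>) ?D (- a - b + a + ?f T) R"
        by (intro pb 1) simp_all
      have "flen (- a - b + a + b) \<le> L + L + L + L" by (intro flen_plus flen_minus2 flen_uminus ab)
      then have S: "prefix_bound (sub X \<beta>) ?D (- a - b + a + b + (?f T + ?f R + ?f M + ?f P)) S"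
        by (intro pb 1) simp_all
      have g1: "?f T - vk = - a + (?f T + ?f R + ?f M)"
        and g2: "- a + (?f T + ?f R + ?f M) + ?f P - vl = - a - b + (?f T + ?f R)"
        and g3: "- a - b + (?f T + ?f R) + ?f M + vk = - a - b + a + ?f T"
        and g4: "- a - b + a + ?f T + ?f R + vl = - a - b + a + b + (?f T + ?f R + ?f M + ?f P)"
        by (simp_all add: vk_def vl_def group_word_simps del: add_uminus_conv_diff)
      note ends = T[THEN prefix_bound_end] P[THEN prefix_bound_end] M[THEN prefix_bound_end]
        R[THEN prefix_bound_end]
      have "prefix_bound (sub X \<beta>) D 0 Q" if D: "D = ?D" for D
        unfolding Q prefix_bound_append prefix_bound.simps lev_inv_letter kv e' add_0_left
          add_uminus_conv_diff g1 g2 g3 g4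
        using T[folded D] P[folded D] M[folded D] R[folded D] S[folded D] ends[unfolded e', folded D]
        by (simp only: simp_thms add_0_left)
      then show ?thesis by blast
    qed
    ultimately show "\<exists>\<beta>. ev (sub X \<beta>) Q = SQ xs + CM ps + CJ (map cls cs) zs \<and>
           prefix_bound (sub X \<beta>) ?D 0 Q" by (intro exI[of _ \<beta>] conjI)
  qed
qed

text \<open>\<open>P\<close> is traversed against its direction in the shorter word, through the
  same points; these are shifted by \<open>x\<close>, and those of \<open>W\<close> by
  \<open>x + x\<close>, of length at most \<open>2 * L\<close>.\<close>

lemma reduces_square:
  assumes Q: "Q = U @ l # P @ l # W" and l: "fst l \<in> X"
    and occ: "occ Q (fst l) = 2" and red: "reduces X (U @ inv_word P @ W) k h cs"
  shows "reduces X Q (Suc k) h cs"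
proof -
  let ?Q1 = "U @ inv_word P @ W"
  have occ0: "occ U (fst l) = 0" "occ P (fst l) = 0" "occ W (fst l) = 0"
    using occ by (simp_all add: Q)
  have nQ: "nvars X Q = Suc (nvars X ?Q1)"
    using occ0 l by (intro nvars_Suc[of _ "fst l"]) (simp_all add: Q image_Un)
  have "ncoefs X (inv_word P) = ncoefs X P"
    by (simp add: ncoefs_def inv_word_def rev_filter[symmetric] filter_map comp_def)
  then have cQ: "ncoefs X Q = ncoefs X ?Q1" using l by (simp add: ncoefs_def Q)
  have cs: "cs \<noteq> []" "k + 2 * h + length cs = Suc (nvars X ?Q1)" "length (concat cs) = ncoefs X ?Q1"
    using red by (simp_all add: reduces_def)
  show ?thesis
    unfolding reduces_def
  proof (intro conjI allI impI)
    show "cs \<noteq> []" "Suc k + 2 * h + length cs = Suc (nvars X Q)" "length (concat cs) = ncoefs X Q"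
      using cs nQ cQ by simp_all
  next
    fix \<beta>
    let ?e = "ev (sub X \<beta>)" and ?l = "lev (sub X \<beta>) l"
    obtain xs ps zs where zs: "length xs = k" "length ps = h" "length zs = length cs" "last zs = 0"
      "?e ?Q1 = SQ xs + CM ps + CJ (map cls cs) zs"
      by (rule reduces_forward[OF red, of \<beta>])
    define x where "x = ?e U + ?l + ?e P - ?e U"
    have "?e Q = x + x + ?e ?Q1"
      using square_identity[of "?e U" ?l "?e P" "?e W"] by (simp add: Q x_def)
    then have "?e Q = SQ (x # xs) + CM ps + CJ (map cls cs) zs"
      using zs(5) by (simp add: add.assoc)
    then show "\<exists>xs ps zs. length xs = Suc k \<and> length ps = h \<and> length zs = length cs \<and> last zs = 0 \<and>
        ?e Q = SQ xs + CM ps + CJ (map cls cs) zs"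
      using zs(1-4) by (intro exI[of _ "x # xs"] exI[of _ ps] exI[of _ zs]) simp
  next
    fix xs :: "'a fg list" and ps :: "('a fg \<times> 'a fg) list" and zs :: "'a fg list" and L
    assume len: "length xs = Suc k" "length ps = h" "length zs = length cs" "last zs = 0"
      "bounded L xs" "bounded2 L ps" "bounded L zs"
    obtain x xs1 where x: "xs = x # xs1" using len(1) by (cases xs) auto
    have "length xs1 = k" "bounded L xs1" and xL: "flen x \<le> L" using len x by auto
    with len obtain \<beta>1 where \<beta>1: "ev (sub X \<beta>1) ?Q1 = SQ xs1 + CM ps + CJ (map cls cs) zs"
      "prefix_bound (sub X \<beta>1) (2 * nvars X ?Q1 * L + ncoefs X ?Q1) 0 ?Q1"
      using reduces_backward[OF red, of xs1 ps zs L] by blast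
    let ?D1 = "2 * nvars X ?Q1 * L + ncoefs X ?Q1" and ?D = "2 * nvars X Q * L + ncoefs X Q"
    let ?f = "ev (sub X \<beta>1)"
    define v where "v = - ?f U + x + ?f U - ?f P"
    define \<beta> where "\<beta> = assign \<beta>1 l v"
    have kv: "lev (sub X \<beta>) l = v" using l by (simp add: \<beta>_def lev_assign)
    have e: "ev (sub X \<beta>) U = ?f U" "ev (sub X \<beta>) P = ?f P" "ev (sub X \<beta>) W = ?f W"
      using occ0 by (simp_all add: \<beta>_def ev_assign)
    have "ev (sub X \<beta>) Q = x + x + ?f ?Q1"
      by (simp add: Q kv e v_def group_word_simps del: add_uminus_conv_diff)
    then have "ev (sub X \<beta>) Q = SQ xs + CM ps + CJ (map cls cs) zs"
      using \<beta>1(1) by (simp add: x add.assoc)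
    moreover have "prefix_bound (sub X \<beta>) ?D 0 Q"
    proof -
      have D: "?D = 2 * L + ?D1" by (simp add: nQ cQ algebra_simps)
      have pb: "prefix_bound (sub X \<beta>) ?D (h + g) w"
        if "prefix_bound (sub X \<beta>1) ?D1 g w" "w \<in> {U, P, W}" "flen h \<le> 2 * L" for h g w
      proof (rule prefix_bound_shift)
        show "prefix_bound (sub X \<beta>) ?D1 g w"
          using that(1,2) occ0 by (auto simp: \<beta>_def prefix_bound_assign)
      qed (use that D in simp)
      have 1: "prefix_bound (sub X \<beta>1) ?D1 0 U" "prefix_bound (sub X \<beta>1) ?D1 (?f U - ?f P) P"
        "prefix_bound (sub X \<beta>1) ?D1 (?f U - ?f P) W"
        using \<beta>1(2) by (simp_all add: prefix_bound_inv)
      have U: "prefix_bound (sub X \<beta>) ?D 0 U" using pb[OF 1(1), of 0] by simp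
      have P: "prefix_bound (sub X \<beta>) ?D (x + (?f U - ?f P)) P"
        using xL by (intro pb 1) simp_all
      have "flen (x + x) \<le> L + L" by (intro flen_plus xL)
      then have W: "prefix_bound (sub X \<beta>) ?D (x + x + (?f U - ?f P)) W"
        by (intro pb 1) simp_all
      have g1: "?f U + v = x + (?f U - ?f P)"
        and g2: "x + (?f U - ?f P) + ?f P + v = x + x + (?f U - ?f P)"
        by (simp_all add: v_def group_word_simps del: add_uminus_conv_diff)
      note ends = U[THEN prefix_bound_end] P[THEN prefix_bound_end]
      have "prefix_bound (sub X \<beta>) D 0 Q" if D: "D = ?D" for D
        unfolding Q prefix_bound_append prefix_bound.simps kv e add_0_left g1 g2
        using U[folded D] P[folded D] W[folded D] ends[unfolded e, folded D]
        by (simp only: simp_thms add_0_left)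
      then show ?thesis by blast
    qed
    ultimately show "\<exists>\<beta>. ev (sub X \<beta>) Q = SQ xs + CM ps + CJ (map cls cs) zs \<and>
           prefix_bound (sub X \<beta>) ?D 0 Q" by (intro exI[of _ \<beta>] conjI)
  qed
qed

lemma crossing_mono: "crossing X v \<Longrightarrow> subseq v w \<Longrightarrow> crossing X w"
  unfolding crossing_def by (meson subseq_order.order_trans)

lemma oriented_on_occ:
  assumes "oriented_on X w" "x \<in> X" "x \<in> fst ` set w"
  shows "occ w x = 2"
proof -
  have "occ w x \<noteq> 0" using assms(3) unfolding occ_eq_0 by simp
  then show ?thesis using assms(1,2) by (auto simp: oriented_on_def occ_def)
qed

text \<open>Without linked pairs an innermost pair encloses only coefficients, and deleting it
  creates no linked pairs.\<close>

lemma reduces_planar_ex: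
  "oriented_on X Q \<Longrightarrow> \<not> crossing X Q \<Longrightarrow> \<exists>cs. reduces X Q 0 0 cs"
proof (induction "length Q" arbitrary: Q rule: less_induct)
  case less
  show ?case
  proof (cases "fst ` set Q \<inter> X = {}")
    case True
    then show ?thesis using reduces_coef by blast
  next
    case False
    with less.prems(1) show ?thesis
    proof (cases rule: oriented_cases)
      case (innermost A k P B)
      note Q = innermost(1) and k = innermost(2) and P = innermost(3)
      have "subseq (A @ B) Q"
        unfolding Q by (intro list_emb_append_mono list_emb_append2 list_emb_Cons) auto
      then have "\<not> crossing X (A @ B)" using less.prems(2) crossing_mono by blast
      moreover have "oriented_on X (A @ B)"
      proof (rule oriented_on_delete[OF less.prems(1)])
        fix x s assume "x \<in> X"
        then have "occ P x = 0" using P unfolding occ_eq_0 by blast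
        then have "count_list P (x, s) = 0" by (cases s) (simp_all add: occ_def)
        then show "count_list Q (x, s) = count_list (A @ B) (x, s) + of_bool (fst k = x)"
          using of_bool_letter[of k x s] by (simp add: Q count_list_letter del: count_list.simps(2))
      qed
      moreover have "length (A @ B) < length Q" by (simp add: Q)
      ultimately obtain cs where "reduces X (A @ B) 0 0 cs" using less.hyps by blast
      moreover have "occ Q (fst k) = 2" using oriented_on_occ[OF less.prems(1) k] by (simp add: Q)
      ultimately show ?thesis using reduces_planar[OF Q k P] by blast
    qed (use less.prems(2) in blast)
  qed
qed

text \<open>Every reduction puts its factor in front, and the order aimed at is squares,
  commutators, conjugates. So all handles are cut before the first planar pair is removed, and
  likewise all crosscaps before the first handle.\<close>

lemma reduces_oriented_ex: "oriented_on X Q \<Longrightarrow> \<exists>h cs. reduces X Q 0 h cs"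
proof (induction "length Q" arbitrary: Q rule: less_induct)
  case less
  show ?case
  proof (cases "crossing X Q")
    case False
    then show ?thesis using reduces_planar_ex[OF less.prems] by blast
  next
    case True
    then obtain T k P l M R S where
      Q: "Q = T @ inv_letter k # P @ inv_letter l # M @ k # R @ l # S" and kl: "fst k \<in> X" "fst l \<in> X"
      by (rule crossing_split)
    let ?Q1 = "T @ R @ M @ P @ S"
    have "count_list Q (x, s) = count_list ?Q1 (x, s) + (of_bool (fst k = x) + of_bool (fst l = x))" for x s
      using of_bool_letter[of k x s] of_bool_letter[of l x s]
      by (simp add: Q count_list_letter del: count_list.simps(2))
    with less.prems have "oriented_on X ?Q1" by (rule oriented_on_delete)
    moreover have "length ?Q1 < length Q" by (simp add: Q)
    ultimately obtain h cs where "reduces X ?Q1 0 h cs" using less.hyps by blast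
    moreover have "occ Q (fst k) = 2" "occ Q (fst l) = 2"
      by (rule oriented_on_occ[OF less.prems]; use kl in \<open>simp add: Q\<close>)+
    ultimately show ?thesis using reduces_crossing[OF Q kl] by blast
  qed
qed

lemma reduces_ex:
  "\<forall>x\<in>X. occ Q x = 0 \<or> occ Q x = 2 \<Longrightarrow>
    \<exists>k h cs. reduces X Q k h cs \<and> (k = 0 \<longrightarrow> oriented_on X Q)"
proof (induction "length Q" arbitrary: Q rule: less_induct)
  case less
  show ?case
  proof (cases "oriented_on X Q")
    case True
    then show ?thesis using reduces_oriented_ex by blast
  next
    case False
    then obtain x where x: "x \<in> X" "count_list Q (x, True) \<noteq> count_list Q (x, False) \<or> count_list Q (x, True) > 1"
      by (auto simp: oriented_on_def)
    have occ: "occ Q x = 0 \<or> occ Q x = 2" using less.prems x(1) by blast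
    have "\<exists>s. count_list Q (x, s) = 2"
    proof (cases "count_list Q (x, True) = 2")
      case False
      then have "count_list Q (x, False) = 2" using x(2) occ unfolding occ_def by arith
      then show ?thesis by blast
    qed blast
    then obtain s where s: "count_list Q (x, s) = 2" by blast
    let ?l = "(x, s)"
    have o2: "occ Q (fst ?l) = 2" using occ s by (cases s) (auto simp: occ_def)
    then obtain U P W where Q: "Q = U @ ?l # P @ ?l # W"
      using repeated_letter[OF _ s] unfolding fst_conv by blast
    let ?Q1 = "U @ inv_word P @ W"
    have "\<forall>y\<in>X. occ ?Q1 y = 0 \<or> occ ?Q1 y = 2"
    proof
      fix y assume "y \<in> X"
      then have "occ Q y = 0 \<or> occ Q y = 2" using less.prems by blast
      then show "occ ?Q1 y = 0 \<or> occ ?Q1 y = 2"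
        using o2 by (cases "y = x") (simp_all add: Q)
    qed
    moreover have "length ?Q1 < length Q" by (simp add: Q)
    ultimately obtain k h cs where "reduces X ?Q1 k h cs" using less.hyps by blast
    from reduces_square[OF Q _ o2 this] x(1) show ?thesis by auto
  qed
qed

section \<open>Solutions as evaluations\<close>

lemma carrier_free_group: "w \<in> carrier (free_group Y) \<longleftrightarrow> freely_reduced w \<and> fst ` set w \<subseteq> Y"
  by (simp add: free_group_def)

lemma mult_free_group: "u \<otimes>\<^bsub>free_group Y\<^esub> v = free_reduction (u @ v)"
  by (simp add: free_group_def)

lemma cls_free_reduction: "cls (free_reduction w) = cls w"
  by (intro cls_cong) (simp add: free_reduction_id freely_reduced_free_reduction)

lemma cls_hom:
  assumes "\<alpha> \<in> hom (free_group Y) (free_group A)" "u \<in> carrier (free_group Y)" "v \<in> carrier (free_group Y)"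
  shows "cls (\<alpha> (free_reduction (u @ v))) = cls (\<alpha> u) + cls (\<alpha> v)"
  using hom_mult[OF assms] unfolding mult_free_group
  by (simp add: cls_free_reduction cls_append)

lemma solution_ev:
  assumes sol: "solution A X Q \<alpha>" and w: "w \<in> carrier (free_group (A \<union> X))"
  shows "cls (\<alpha> w) = ev (sub X (\<lambda>x. cls (\<alpha> [(x, True)]))) w"
  using w
proof (induction w)
  case Nil
  have "\<alpha> [] = []" using sol by (simp add: solution_def carrier_free_group)
  then show ?case by simp
next
  case (Cons l w)
  let ?Y = "A \<union> X"
  have hom: "\<alpha> \<in> hom (free_group ?Y) (free_group A)" using sol by (simp add: solution_def)
  have fix_A: "\<alpha> u = u" if "u \<in> carrier (free_group A)" for u
    using sol that by (simp add: solution_def)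
  have single: "[k] \<in> carrier (free_group ?Y)" if "fst k \<in> ?Y" for k
    using that by (simp add: carrier_free_group)
  have l: "fst l \<in> ?Y" and w: "w \<in> carrier (free_group ?Y)"
    using Cons.prems freely_reduced_tl[of l w] by (auto simp: carrier_free_group)
  have "free_reduction ([l] @ w) = l # w"
    using Cons.prems by (simp add: carrier_free_group free_reduction_id)
  then have "cls (\<alpha> (l # w)) = cls (\<alpha> [l]) + cls (\<alpha> w)"
    using cls_hom[OF hom single[OF l] w] by simp
  moreover have "cls (\<alpha> [l]) = lev (sub X (\<lambda>x. cls (\<alpha> [(x, True)]))) l"
  proof (cases "fst l \<in> X")
    case False
    then have "\<alpha> [l] = [l]" using l by (intro fix_A) (simp add: carrier_free_group)
    moreover have "lev (sub X (\<lambda>x. cls (\<alpha> [(x, True)]))) l = lev gen l"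
      using False by (simp add: lev_def sub_def)
    ultimately show ?thesis by (simp only: lev_gen)
  next
    case True
    show ?thesis
    proof (cases "snd l")
      case True
      then show ?thesis using \<open>fst l \<in> X\<close> by (cases l) (simp add: lev_def sub_def)
    next
      case False
      obtain x where x: "l = (x, False)" using False by (cases l) auto
      have "free_reduction ([l] @ [(x, True)]) = []"
        by (simp add: x free_reduction_def inv_letter_def)
      moreover have "[(x, True)] \<in> carrier (free_group ?Y)" using l x by (intro single) simp
      ultimately have "cls (\<alpha> [l]) + cls (\<alpha> [(x, True)]) = cls (\<alpha> [])"
        using cls_hom[OF hom single[OF l]] by metis
      also have "\<alpha> [] = []" by (rule fix_A) (simp add: carrier_free_group)
      finally have "cls (\<alpha> [l]) = - cls (\<alpha> [(x, True)])" by (simp add: eq_neg_iff_add_eq_0)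
      then show ?thesis using \<open>fst l \<in> X\<close> x by (simp add: lev_def sub_def)
    qed
  qed
  ultimately show ?case using Cons.IH[OF w] by simp
qed

definition over :: "'g set \<Rightarrow> 'g fg \<Rightarrow> bool" where
  "over A g \<longleftrightarrow> fst ` set (rep_fg g) \<subseteq> A"

lemma over_cls: "fst ` set w \<subseteq> A \<Longrightarrow> over A (cls w)"
  using set_free_reduction[of w] by (auto simp: over_def rep_cls)

lemma over_simps: "over A 0" "over A g \<Longrightarrow> over A h \<Longrightarrow> over A (g + h)" "over A g \<Longrightarrow> over A (- g)"
proof -
  show "over A 0" using over_cls[of "[]"] by simp
  show "over A g \<Longrightarrow> over A h \<Longrightarrow> over A (g + h)"
    unfolding plus_fg_def by (intro over_cls) (auto simp: over_def)
  show "over A g \<Longrightarrow> over A (- g)"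
    unfolding uminus_fg_def by (intro over_cls) (auto simp: over_def inv_word_def)
qed

lemma over_ev: "(\<And>y. over A (\<gamma> y)) \<Longrightarrow> over A (ev \<gamma> w)"
  by (induction w) (auto simp: lev_def intro: over_simps)

lemma flen_gen: "flen (gen a) \<le> 1"
  using flen_cls[of "[(a, True)]"] by (simp add: gen_def)

text \<open>The values \<beta> may contain letters outside \<open>A\<close>. The retraction
  \<open>r\<close> kills these, which keeps the equation and lengthens nothing.\<close>

lemma ev_solution:
  assumes disj: "A \<inter> X = {}" and Q: "Q \<in> carrier (free_group (A \<union> X))" and zero: "ev (sub X \<beta>) Q = 0"
  shows "\<exists>\<alpha>. solution A X Q \<alpha> \<and> (\<forall>x\<in>X. length (\<alpha> [(x, True)]) \<le> flen (\<beta> x))"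
proof -
  define r where "r = lift (\<lambda>y. if y \<in> A then gen y else 0)"
  define \<gamma> where "\<gamma> y = (if y \<in> A then gen y else if y \<in> X then r (\<beta> y) else 0)" for y
  define \<alpha> where "\<alpha> w = rep_fg (ev \<gamma> w)" for w
  have over_gen: "over A (if y \<in> A then gen y else 0)" for y
    using over_cls[of "[(y, True)]" A] over_simps(1)[of A] by (simp add: gen_def)
  then have "over A (r g)" for g unfolding r_def lift_def by (rule over_ev)
  then have "over A (\<gamma> y)" for y using over_gen[of y] over_simps(1)[of A] by (auto simp: \<gamma>_def)
  then have over: "over A (ev \<gamma> w)" for w by (rule over_ev)
  have "\<alpha> \<in> hom (free_group (A \<union> X)) (free_group A)"
    unfolding hom_def
  proof (intro CollectI conjI ballI funcsetI)
    fix w show "\<alpha> w \<in> carrier (free_group A)"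
      using over[of w] by (simp add: \<alpha>_def carrier_free_group freely_reduced_rep over_def)
  next
    fix u v
    show "\<alpha> (u \<otimes>\<^bsub>free_group (A \<union> X)\<^esub> v) = \<alpha> u \<otimes>\<^bsub>free_group A\<^esub> \<alpha> v"
      unfolding mult_free_group by (simp add: \<alpha>_def plus_fg_def rep_cls)
  qed
  moreover have "\<alpha> w = w" if "w \<in> carrier (free_group A)" for w
  proof -
    have "ev \<gamma> w = cls w"
      unfolding ev_gen[symmetric]
      by (rule ev_cong) (use that in \<open>auto simp: \<gamma>_def carrier_free_group\<close>)
    then show ?thesis using that by (simp add: \<alpha>_def rep_cls free_reduction_id carrier_free_group)
  qed
  moreover have "\<alpha> Q = []"
  proof -
    have r_ev: "r (ev \<delta> w) = ev (\<lambda>y. r (\<delta> y)) w" for \<delta> :: "'a \<Rightarrow> 'a fg" and w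
      by (induction w) (simp_all add: r_def lev_def)
    have "r (gen y) = gen y" if "y \<in> A" for y
      using that unfolding r_def gen_def lift_cls by (simp add: lev_def gen_def)
    then have "ev \<gamma> Q = ev (\<lambda>y. r (sub X \<beta> y)) Q"
      by (intro ev_cong) (use Q disj in \<open>auto simp: \<gamma>_def sub_def carrier_free_group\<close>)
    also have "\<dots> = r (ev (sub X \<beta>) Q)" unfolding r_ev ..
    also have "\<dots> = 0" by (simp add: zero r_def)
    finally have "\<alpha> Q = rep_fg (cls [])" by (simp add: \<alpha>_def)
    then show ?thesis by (simp only: rep_cls free_reduction_Nil)
  qed
  moreover have "length (\<alpha> [(x, True)]) \<le> flen (\<beta> x)" if "x \<in> X" for x
  proof -
    have "x \<notin> A" using that disj by blast
    then have "length (\<alpha> [(x, True)]) = flen (r (\<beta> x))"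
      using that by (simp add: \<alpha>_def \<gamma>_def lev_def flen_def)
    also have "\<dots> \<le> flen (\<beta> x)"
      unfolding r_def
    proof (rule flen_lift)
      show "flen (if b \<in> A then gen b else 0) \<le> 1" for b using flen_gen[of b] by simp
    qed
    finally show ?thesis .
  qed
  ultimately show ?thesis
    by (intro exI[of _ \<alpha>]) (simp add: solution_def free_group_def)
qed

section \<open>Bounds on solutions\<close>

text \<open>Words in standard form begin with squares and commutators, while the equations with
  short solutions have them at the end.\<close>

lemma rotate_zero: "a + b = 0 \<longleftrightarrow> b + a = (0 :: 'h :: group_add)"
  unfolding eq_neg_iff_add_eq_0[symmetric] by auto

text \<open>A bound \<open>L\<close> in standard form gives \<open>2 * n * L + C\<close> for
  prefixes and \<open>4 * n * L + 2 * C\<close> for variables. With \<open>L = 3 * C\<close> this is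
  at most \<open>14 * n * C\<close>, and with \<open>L = 29 * n * C\<close> at most
  \<open>118 * n\<^sup>2 * C\<close>.\<close>

lemma general_bound:
  fixes Q :: "'g word"
  assumes quad: "\<forall>x\<in>X. occ Q x = 0 \<or> occ Q x = 2" and sol: "ev (sub X \<beta>0) Q = 0"
  defines "n \<equiv> nvars X Q" and "C \<equiv> ncoefs X Q"
  shows "\<exists>\<beta>. ev (sub X \<beta>) Q = 0 \<and> (\<forall>x\<in>X \<inter> fst ` set Q.
    flen (\<beta> x) \<le> (if oriented_on X Q then 40 * n * C else 150 * n\<^sup>2 * C))"
proof -
  have n1: "1 \<le> n" if "x \<in> X \<inter> fst ` set Q" for x
    using that unfolding n_def nvars_def
      by (metis One_nat_def Suc_leI card_gt_0_iff empty_iff finite_Int finite_imageI finite_set)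
  have step: "\<exists>\<beta>. ev (sub X \<beta>) Q = 0 \<and> (\<forall>x\<in>X \<inter> fst ` set Q. flen (\<beta> x) \<le> 4 * n * L + 2 * C)"
    if red: "reduces X Q k h cs" and len: "length xs = k" "length ps = h" "length zs = length cs"
      and z: "zs ! (length cs - 1) = 0" and bnd: "bounded L xs" "bounded2 L ps" "bounded L zs"
      and zero: "CJ (map cls cs) zs + (SQ xs + CM ps) = 0" for k h cs xs ps zs L
  proof -
    have "cs \<noteq> []" using red by (simp add: reduces_def)
    then have "last zs = 0" using z len(3) by (subst last_conv_nth) auto
    from reduces_backward[OF red len this bnd] obtain \<beta> where
      \<beta>: "ev (sub X \<beta>) Q = SQ xs + CM ps + CJ (map cls cs) zs"
      "prefix_bound (sub X \<beta>) (2 * n * L + C) 0 Q" unfolding n_def C_def .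
    have "ev (sub X \<beta>) Q = 0" using \<beta>(1) zero rotate_zero by metis
    moreover have "flen (\<beta> x) \<le> 4 * n * L + 2 * C" if "x \<in> X \<inter> fst ` set Q" for x
      using prefix_bound_letter[OF \<beta>(2), of x] that by (simp add: sub_def)
    ultimately show ?thesis by blast
  qed
  show ?thesis
  proof (cases "oriented_on X Q")
    case True
    then obtain h cs where red: "reduces X Q 0 h cs" using reduces_oriented_ex by blast
    have cs: "cs \<noteq> []" "length (concat cs) = C" using red by (simp_all add: reduces_def C_def)
    from reduces_forward[OF red, of \<beta>0] obtain xs ps zs where f: "length xs = 0" "length ps = h"
      "length zs = length cs" "last zs = 0" "ev (sub X \<beta>0) Q = SQ xs + CM ps + CJ (map cls cs) zs" .
    have "CJ (map cls cs) zs + CM ps = 0"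
      using f(1,5) sol rotate_zero[of "CM ps" "CJ (map cls cs) zs"] by simp
    from short_solution_orientable[OF _ f(3) this, of "length cs - 1"] cs f(2) obtain zs' ps' where
      s: "length zs' = length cs" "length ps' = h" "zs' ! (length cs - 1) = 0"
      "CJ (map cls cs) zs' + CM ps' = 0" "bounded (3 * C) zs'" "bounded2 (3 * C) ps'" by auto
    from step[OF red, of "[]" ps' zs' "3 * C"] s obtain \<beta> where
      \<beta>: "ev (sub X \<beta>) Q = 0" "\<forall>x\<in>X \<inter> fst ` set Q. flen (\<beta> x) \<le> 4 * n * (3 * C) + 2 * C" by auto
    have "flen (\<beta> x) \<le> 40 * n * C" if x: "x \<in> X \<inter> fst ` set Q" for x
    proof -
      have "flen (\<beta> x) \<le> 12 * (n * C) + 2 * C"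
        using bspec[OF \<beta>(2) x] by (simp add: algebra_simps)
      moreover have "C \<le> n * C" using n1[OF x] by simp
      ultimately show ?thesis unfolding mult.assoc by linarith
    qed
    with \<beta>(1) True show ?thesis by auto
  next
    case False
    from reduces_ex[OF quad] False obtain k h cs where red: "reduces X Q k h cs" and k: "k \<noteq> 0"
      by blast
    have cs: "cs \<noteq> []" "length (concat cs) = C" "k + 2 * h + length cs - 1 = n"
      using red by (simp_all add: reduces_def C_def n_def)
    from reduces_forward[OF red, of \<beta>0] obtain xs ps zs where f: "length xs = k" "length ps = h"
      "length zs = length cs" "last zs = 0" "ev (sub X \<beta>0) Q = SQ xs + CM ps + CJ (map cls cs) zs" .
    have xs: "xs \<noteq> []" using f(1) k by auto
    have "CJ (map cls cs) zs + (SQ xs + CM ps) = 0" using f(5) sol rotate_zero by metis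
    then have zero: "CJ (map cls cs) zs + SQ xs + CM ps = 0" by (simp add: add.assoc)
    have "length cs - 1 < length cs" using cs(1) by (cases cs) auto
    from short_solution_nonorientable[OF this f(3) xs zero, unfolded f(1,2) cs(2,3)] obtain zs' xs' ps' where
      s: "length zs' = length cs" "length xs' = k" "length ps' = h" "zs' ! (length cs - 1) = 0"
      "CJ (map cls cs) zs' + SQ xs' + CM ps' = 0" "bounded (29 * n * C) zs'" "bounded (29 * n * C) xs'"
      "bounded2 (29 * n * C) ps'" by blast
    from step[OF red, of xs' ps' zs' "29 * n * C"] s obtain \<beta> where
      \<beta>: "ev (sub X \<beta>) Q = 0" "\<forall>x\<in>X \<inter> fst ` set Q. flen (\<beta> x) \<le> 4 * n * (29 * n * C) + 2 * C"
      by (auto simp: add.assoc)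
    have "flen (\<beta> x) \<le> 150 * n\<^sup>2 * C" if x: "x \<in> X \<inter> fst ` set Q" for x
    proof -
      have "flen (\<beta> x) \<le> 116 * (n\<^sup>2 * C) + 2 * C" 
        using bspec[OF \<beta>(2) x] by (simp add: algebra_simps power2_eq_square)
      moreover have "C \<le> n\<^sup>2 * C" using n1[OF x] by simp
      ultimately show ?thesis unfolding mult.assoc by linarith
    qed
    with \<beta>(1) False show ?thesis by auto
  qed
qed

lemma values_exist:
  assumes "distinct ns" "length ns = length vs"
  shows "\<exists>\<beta>. map \<beta> ns = vs"
  using assms by (intro exI[of _ "\<lambda>x. the (map_of (zip ns vs) x)"] nth_equalityI) (simp_all add: map_of_zip_nth)

definition standard_word where
  "standard_word k n m x y z c =
     concat (map (\<lambda>i. square_word (x i)) [1..<Suc k]) @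
     concat (map (\<lambda>i. comm_word (x i) (y i)) [Suc k..<Suc n]) @ coeff_tail m c z"

lemma ev_squares: "ev \<gamma> (concat (map (\<lambda>i. square_word (x i)) is)) = SQ (map (\<lambda>i. \<gamma> (x i)) is)"
  by (induction "is") (simp_all add: square_word_def lev_def add.assoc)

lemma ev_comms:
  "ev \<gamma> (concat (map (\<lambda>i. comm_word (x i) (y i)) is)) = CM (map (\<lambda>i. (\<gamma> (x i), \<gamma> (y i))) is)"
  by (induction "is")
    (simp_all add: comm_word_def lev_def comm_def group_word_simps del: add_uminus_conv_diff)

lemma ev_conjs:
  "ev \<gamma> (concat (map (\<lambda>i. conj_word (z i) (c i)) is)) = CJ (map (\<lambda>i. ev \<gamma> (c i)) is) (map (\<lambda>i. \<gamma> (z i)) is)"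
  by (induction "is") (simp_all add: conj_word_def lev_def conjg_def add.assoc)

text \<open>The variables are themselves the entries of the squares and commutators and the
  conjugators, so their bounds carry over without the cost of a reduction. The unconjugated
  coefficient is now the first one, hence \<open>\<rho> = 0\<close>, whereas the reductions leave
  the last one unconjugated. The case \<open>k = 0\<close> is that of standard orientable
  words.\<close>

lemma standard_bound:
  fixes A X :: "'g set" and Q :: "'g word" and \<beta>0 :: "'g \<Rightarrow> 'g fg"
    and x y z :: "nat \<Rightarrow> 'g" and c :: "nat \<Rightarrow> 'g word" and k n m :: nat
  notes [simp del] = upt_Suc
  defines "ns \<equiv> map x [1..<Suc n] @ map y [Suc k..<Suc n] @ map z [2..<Suc m]"
  assumes disj: "A \<inter> X = {}" and dist: "distinct ns" and ns: "set ns \<subseteq> X"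
    and c: "\<forall>i\<in>{1..m}. c i \<in> carrier (free_group A)" and k: "k \<le> n"
    and Q: "Q = standard_word k n m x y z c" and sol: "ev (sub X \<beta>0) Q = 0"
  defines "C \<equiv> coeff_length A Q"
  shows "\<exists>\<beta>. ev (sub X \<beta>) Q = 0 \<and>
    (\<forall>v\<in>vars X Q. flen (\<beta> v) \<le> (if k = 0 then 3 * C else 29 * num_vars X Q * C))"
proof (cases "m = 0")
  \<comment> \<open>Without coefficients the trivial values solve the equation.\<close>
  case True
  have "fst ` set Q \<subseteq> set ns"
    using k unfolding Q standard_word_def coeff_tail_def ns_def True
    by (auto simp: square_word_def comm_word_def)
  then have "ev (sub X (\<lambda>_. 0)) Q = 0"
    using ns by (intro ev_zero) (auto simp: sub_def)
  then show ?thesis by (intro exI[of _ "\<lambda>_. 0"]) simp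
next
  case m: False
  define cs where "cs = map c [1..<Suc m]"
  have up: "[1..<Suc m] = 1 # [2..<Suc m]" using m by (simp add: upt_rec numeral_2_eq_2)
  have cs_Cons: "cs = c 1 # map c [2..<Suc m]" unfolding cs_def up by simp
  have cX: "fst ` set (c i) \<inter> X = {}" "fst ` set (c i) \<subseteq> A" if "i \<in> {1..m}" for i
  proof -
    show "fst ` set (c i) \<subseteq> A" using c that by (simp add: carrier_free_group)
    with disj show "fst ` set (c i) \<inter> X = {}" by blast
  qed
  have evQ: "ev (sub X \<beta>) Q = SQ (map (\<lambda>i. \<beta> (x i)) [1..<Suc k])
      + CM (map (\<lambda>i. (\<beta> (x i), \<beta> (y i))) [Suc k..<Suc n])
      + CJ (map cls cs) (0 # map (\<lambda>i. \<beta> (z i)) [2..<Suc m])" for \<beta>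
  proof -
    have sub: "sub X \<beta> v = \<beta> v" if "v \<in> set ns" for v using ns that by (auto simp: sub_def)
    have 1: "map (\<lambda>i. sub X \<beta> (x i)) [1..<Suc k] = map (\<lambda>i. \<beta> (x i)) [1..<Suc k]"
      using k by (intro map_cong refl sub) (auto simp: ns_def)
    have 2: "map (\<lambda>i. (sub X \<beta> (x i), sub X \<beta> (y i))) [Suc k..<Suc n]
        = map (\<lambda>i. (\<beta> (x i), \<beta> (y i))) [Suc k..<Suc n]"
      using k by (intro map_cong refl prod_eqI) (auto simp: ns_def intro!: sub)
    have 3: "map (\<lambda>i. sub X \<beta> (z i)) [2..<Suc m] = map (\<lambda>i. \<beta> (z i)) [2..<Suc m]"
      by (intro map_cong refl sub) (auto simp: ns_def)
    have 4: "map (\<lambda>i. ev (sub X \<beta>) (c i)) [2..<Suc m] = map cls (map c [2..<Suc m])"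
      unfolding map_map comp_def by (intro map_cong refl ev_sub_coef cX) auto
    have 5: "ev (sub X \<beta>) (c 1) = cls (c 1)" using cX m by (intro ev_sub_coef) simp
    show ?thesis
      unfolding Q standard_word_def coeff_tail_def ev_simps ev_squares ev_comms if_not_P[OF m] ev_conjs
        1 2 3 4 5 cs_Cons list.map CJ_simps
      by (simp add: conjg_def add.assoc)
  qed
  have Cc: "length (concat cs) = C"
  proof -
    have nA: "v \<notin> A" if "v \<in> set ns" for v using that ns disj by blast
    have xA: "x i \<notin> A" if "i \<in> {1..n}" for i using that by (intro nA) (auto simp: ns_def)
    have yA: "y i \<notin> A" if "i \<in> {Suc k..n}" for i using that by (intro nA) (auto simp: ns_def)
    have zA: "z i \<notin> A" if "i \<in> {2..m}" for i using that by (intro nA) (auto simp: ns_def)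
    let ?f = "filter (\<lambda>l. fst l \<in> A)"
    have "?f (concat (map (\<lambda>i. square_word (x i)) [1..<Suc k])) = []"
      using xA k by (auto simp: filter_empty_conv square_word_def)
    moreover have "?f (concat (map (\<lambda>i. comm_word (x i) (y i)) [Suc k..<Suc n])) = []"
      using xA yA by (auto simp: filter_empty_conv comm_word_def)
    moreover have fc: "?f (c i) = c i" if "i \<in> {1..m}" for i
      using cX(2)[OF that] by (auto simp: filter_id_conv)
    moreover have "?f (concat (map (\<lambda>i. conj_word (z i) (c i)) [2..<Suc m])) = concat (map c [2..<Suc m])"
    proof -
      have "?f (conj_word (z i) (c i)) = c i" if "i \<in> {2..m}" for i
        using zA[OF that] fc that by (simp add: conj_word_def)
      then have "map (\<lambda>i. ?f (conj_word (z i) (c i))) [2..<Suc m] = map c [2..<Suc m]"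
        by (intro map_cong) auto
      then show ?thesis by (simp only: filter_concat map_map comp_def)
    qed
    ultimately have "?f Q = concat cs"
      using m unfolding Q standard_word_def coeff_tail_def if_not_P[OF m] filter_append cs_Cons
      by simp
    then show ?thesis by (simp add: C_def coeff_length_def)
  qed
  let ?xs0 = "map (\<lambda>i. \<beta>0 (x i)) [1..<Suc k]" and ?ps0 = "map (\<lambda>i. (\<beta>0 (x i), \<beta>0 (y i))) [Suc k..<Suc n]"
    and ?zs0 = "0 # map (\<lambda>i. \<beta>0 (z i)) [2..<Suc m]"
  define L where "L = (if k = 0 then 3 * C else 29 * num_vars X Q * C)"
  have vars: "vars X Q = set ns"
  proof
    show "vars X Q \<subseteq> set ns"
    proof
      fix v assume "v \<in> vars X Q"
      then have v: "v \<in> X" "v \<in> fst ` set Q" by (simp_all add: vars_def)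
      then have "(v, b) \<notin> set (c i)" if "i \<in> {1..m}" for i b using cX(1)[OF that] by force
      with v m k show "v \<in> set ns"
        unfolding Q standard_word_def coeff_tail_def ns_def
        by (auto simp: square_word_def comm_word_def conj_word_def)
    qed
    have "set ns \<subseteq> fst ` set Q"
    proof
      fix v assume "v \<in> set ns"
      moreover have "{1..<Suc n} = {1..k} \<union> {Suc k..n}" using k by auto
      ultimately have "v \<in> x ` {1..k} \<union> x ` {Suc k..n} \<union> y ` {Suc k..n} \<union> z ` {2..m}"
        unfolding ns_def set_append set_map set_upt by auto
      then consider i where "1 \<le> i" "i \<le> k" "v = x i" | i where "Suc k \<le> i" "i \<le> n" "v = x i \<or> v = y i"
        | i where "2 \<le> i" "i \<le> m" "v = z i"
        by auto
      then have "(v, True) \<in> set Q"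
      proof cases
        case 1
        then have "(v, True) \<in> set (concat (map (\<lambda>i. square_word (x i)) [1..<Suc k]))"
          by (auto simp: square_word_def)
        then show ?thesis by (simp add: Q standard_word_def)
      next
        case 2
        then have "(v, True) \<in> set (concat (map (\<lambda>i. comm_word (x i) (y i)) [Suc k..<Suc n]))"
          by (auto simp: comm_word_def)
        then show ?thesis by (simp add: Q standard_word_def)
      next
        case 3
        then have "(v, True) \<in> set (concat (map (\<lambda>i. conj_word (z i) (c i)) [2..<Suc m]))"
          by (auto simp: conj_word_def)
        then show ?thesis using m by (simp add: Q standard_word_def coeff_tail_def)
      qed
      then show "v \<in> fst ` set Q" by force
    qed
    with ns show "set ns \<subseteq> vars X Q" by (auto simp: vars_def)
  qed
  have nv: "num_vars X Q = k + 2 * (n - k) + m - 1"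
    unfolding num_vars_def vars distinct_card[OF dist] using k m by (simp add: ns_def)
  have zero: "CJ (map cls cs) ?zs0 + (SQ ?xs0 + CM ?ps0) = 0"
    using sol unfolding evQ by (simp only: rotate_zero)
  have "\<exists>zs xs ps. length zs = m \<and> length xs = k \<and> length ps = n - k \<and> zs ! 0 = 0 \<and>
      CJ (map cls cs) zs + (SQ xs + CM ps) = 0 \<and> bounded L zs \<and> bounded L xs \<and> bounded2 L ps"
  proof (cases "k = 0")
    case True
    then have "CJ (map cls cs) ?zs0 + CM ?ps0 = 0" using zero by simp
    from short_solution_orientable[OF _ _ this, of 0] m True
    show ?thesis unfolding Cc L_def by (auto simp: cs_def)
  next
    case False
    then have "?xs0 \<noteq> []" by simp
    moreover have "CJ (map cls cs) ?zs0 + SQ ?xs0 + CM ?ps0 = 0" using zero by (simp add: add.assoc)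
    ultimately have "\<exists>zs' xs' ps'. length zs' = length cs \<and> length xs' = length ?xs0 \<and> length ps' = length ?ps0 \<and>
      zs' ! 0 = 0 \<and> CJ (map cls cs) zs' + SQ xs' + CM ps' = 0 \<and>
      bounded (29 * (length ?xs0 + 2 * length ?ps0 + length cs - 1) * length (concat cs)) zs' \<and>
      bounded (29 * (length ?xs0 + 2 * length ?ps0 + length cs - 1) * length (concat cs)) xs' \<and>
      bounded2 (29 * (length ?xs0 + 2 * length ?ps0 + length cs - 1) * length (concat cs)) ps'"
      using m by (intro short_solution_nonorientable[where zs = ?zs0]) (auto simp: cs_def)
    moreover have "length ?xs0 + 2 * length ?ps0 + length cs - 1 = num_vars X Q"
      unfolding nv by (simp add: cs_def)
    ultimately show ?thesis
      using False unfolding Cc L_def by (auto simp: cs_def add.assoc)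
  qed
  then obtain zs xs ps where s: "length zs = m" "length xs = k" "length ps = n - k" "zs ! 0 = 0"
    "CJ (map cls cs) zs + (SQ xs + CM ps) = 0" "bounded L zs" "bounded L xs" "bounded2 L ps"
      by blast
  have zs: "zs = 0 # tl zs" using s(1,4) m by (cases zs) auto
  have "\<exists>\<beta>. map \<beta> ns = (xs @ map fst ps) @ map snd ps @ tl zs"
    using k m s by (intro values_exist dist) (simp add: ns_def)
  then obtain \<beta> where \<beta>: "map \<beta> ns = (xs @ map fst ps) @ map snd ps @ tl zs" by blast
  have split: "[1..<Suc n] = [1..<Suc k] @ [Suc k..<Suc n]"
    using k by (metis Suc_le_mono le_add_diff_inverse plus_1_eq_Suc le_add1 upt_add_eq_append)
  have \<beta>_eqs: "map (\<lambda>i. \<beta> (x i)) [1..<Suc k] = xs" "map (\<lambda>i. \<beta> (x i)) [Suc k..<Suc n] = map fst ps"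
    "map (\<lambda>i. \<beta> (y i)) [Suc k..<Suc n] = map snd ps" "map (\<lambda>i. \<beta> (z i)) [2..<Suc m] = tl zs"
    using \<beta> s unfolding ns_def split by (auto simp: comp_def)
  have "map (\<lambda>i. (\<beta> (x i), \<beta> (y i))) [Suc k..<Suc n] = zip (map fst ps) (map snd ps)"
    unfolding \<beta>_eqs(2,3)[symmetric] by (simp add: zip_map_map zip_same_conv_map)
  then have "map (\<lambda>i. (\<beta> (x i), \<beta> (y i))) [Suc k..<Suc n] = ps" by (simp add: zip_map_fst_snd)
  then have "ev (sub X \<beta>) Q = 0"
    unfolding evQ \<beta>_eqs zs[symmetric] using s(5) by (simp only: rotate_zero)
  moreover have "flen (\<beta> v) \<le> L" if "v \<in> vars X Q" for v
  proof -
    have "\<beta> v \<in> set (map \<beta> ns)" using that vars by simp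
    then have "\<beta> v \<in> set xs \<or> (\<exists>p\<in>set ps. \<beta> v = fst p \<or> \<beta> v = snd p) \<or> \<beta> v \<in> set zs"
      unfolding \<beta> using zs by (auto dest: list.set_sel(2)) (metis list.set_intros(2))
    then show ?thesis using s(6-8) by auto
  qed
  ultimately show ?thesis unfolding L_def by blast
qed

theorem theorem1p1:
  fixes A X :: "'g set" and Q :: "'g word"
  assumes "A \<inter> X = {}" and "countable X" and "infinite X"
    and "quadratic_word A X Q"
    and "\<exists>\<alpha>. solution A X Q \<alpha>"
  shows "(\<exists>\<alpha>. solution A X Q \<alpha> \<and>
           (\<forall>x \<in> vars X Q. length (\<alpha> [(x, True)]) \<le>
              (if orientable X Q then 40 * num_vars X Q * coeff_length A Q
               else 150 * (num_vars X Q)^2 * coeff_length A Q))) \<and>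
         (standard_orientable A X Q \<or> semistandard_nonorientable A X Q \<longrightarrow>
          (\<exists>\<alpha>. solution A X Q \<alpha> \<and>
           (\<forall>x \<in> vars X Q. length (\<alpha> [(x, True)]) \<le>
              (if orientable X Q then 8 * coeff_length A Q
               else 36 * num_vars X Q * coeff_length A Q))))"
proof -
  note disj = assms(1)
  have Q: "Q \<in> carrier (free_group (A \<union> X))" using assms(4) by (simp add: quadratic_word_def)
  have vars: "vars X Q = X \<inter> fst ` set Q" by (auto simp: vars_def)
  then have nv: "nvars X Q = num_vars X Q" by (simp add: nvars_def num_vars_def)
  have "filter (\<lambda>l. fst l \<notin> X) Q = filter (\<lambda>l. fst l \<in> A) Q"
    using Q disj by (intro filter_cong) (auto simp: carrier_free_group)
  then have nc: "ncoefs X Q = coeff_length A Q" by (simp add: ncoefs_def coeff_length_def)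
  have quad: "occ Q x = 0 \<or> occ Q x = 2" if "x \<in> X" for x
  proof (cases "x \<in> fst ` set Q")
    case True
    then show ?thesis using assms(4) that vars by (simp add: quadratic_word_def occ_filter)
  qed (simp add: occ_eq_0)
  have orient: "orientable X Q \<longleftrightarrow> oriented_on X Q"
  proof
    assume o: "orientable X Q"
    show "oriented_on X Q"
      unfolding oriented_on_def
    proof
      fix x assume x: "x \<in> X"
      show "count_list Q (x, True) = count_list Q (x, False) \<and> count_list Q (x, True) \<le> 1"
      proof (cases "x \<in> vars X Q")
        case True
        then show ?thesis using o by (simp add: orientable_def)
      next
        case False
        then have "occ Q x = 0" using x vars by (simp add: occ_eq_0)
        then show ?thesis by (simp add: occ_def)
      qed
    qed
  next
    assume o: "oriented_on X Q"
    show "orientable X Q"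
      unfolding orientable_def
    proof
      fix x assume "x \<in> vars X Q"
      then have "x \<in> X" "occ Q x = 2" using oriented_on_occ[OF o] vars by auto
      then show "count_list Q (x, True) = 1 \<and> count_list Q (x, False) = 1"
        using o by (auto simp: oriented_on_def occ_def)
    qed
  qed
  obtain \<alpha>0 where \<alpha>0: "solution A X Q \<alpha>0" using assms(5) by blast
  define \<beta>0 where "\<beta>0 x = cls (\<alpha>0 [(x, True)])" for x
  have "cls (\<alpha>0 Q) = 0" using \<alpha>0 by (simp add: solution_def free_group_def)
  then have sol: "ev (sub X \<beta>0) Q = 0"
    using solution_ev[OF \<alpha>0 Q] unfolding \<beta>0_def by simp
  have pull: "\<exists>\<alpha>. solution A X Q \<alpha> \<and> (\<forall>x\<in>vars X Q. length (\<alpha> [(x, True)]) \<le> b)"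
    if "ev (sub X \<beta>) Q = 0" "\<forall>x\<in>vars X Q. flen (\<beta> x) \<le> b" for \<beta> b
    using ev_solution[OF disj Q that(1)] that(2) vars by (metis IntE le_trans)
  show ?thesis
  proof (intro conjI impI)
    from general_bound[OF _ sol] quad
    obtain \<beta> where "ev (sub X \<beta>) Q = 0" "\<forall>x\<in>vars X Q. flen (\<beta> x) \<le>
      (if orientable X Q then 40 * num_vars X Q * coeff_length A Q
       else 150 * (num_vars X Q)\<^sup>2 * coeff_length A Q)"
      unfolding nv nc orient vars by blast
    then show "\<exists>\<alpha>. solution A X Q \<alpha> \<and> (\<forall>x\<in>vars X Q. length (\<alpha> [(x, True)]) \<le>
      (if orientable X Q then 40 * num_vars X Q * coeff_length A Q
       else 150 * (num_vars X Q)\<^sup>2 * coeff_length A Q))" by (rule pull)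
  next
    assume "standard_orientable A X Q \<or> semistandard_nonorientable A X Q"
    then obtain k n m x y z c where
      st: "distinct (map x [1..<Suc n] @ map y [Suc k..<Suc n] @ map z [2..<Suc m])"
        "set (map x [1..<Suc n] @ map y [Suc k..<Suc n] @ map z [2..<Suc m]) \<subseteq> X"
        "\<forall>i\<in>{1..m}. c i \<in> carrier (free_group A)" "k \<le> n" "Q = standard_word k n m x y z c"
    proof
      assume "standard_orientable A X Q"
      then obtain g m x y z c where
        "distinct (map x [1..<Suc g] @ map y [1..<Suc g] @ map z [2..<Suc m])"
        "set (map x [1..<Suc g] @ map y [1..<Suc g] @ map z [2..<Suc m]) \<subseteq> X"
        "\<forall>i\<in>{1..m}. c i \<in> carrier (free_group A) \<and> c i \<noteq> \<one>\<^bsub>free_group A\<^esub>"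
        "Q = concat (map (\<lambda>i. comm_word (x i) (y i)) [1..<Suc g]) @ coeff_tail m c z"
        unfolding standard_orientable_def by blast
      then show thesis by (intro that[of x g y 0 z m c]) (simp_all add: standard_word_def)
    next
      assume "semistandard_nonorientable A X Q"
      then obtain k n m x y z c where "1 \<le> k" "k \<le> n"
        "distinct (map x [1..<Suc n] @ map y [Suc k..<Suc n] @ map z [2..<Suc m])"
        "set (map x [1..<Suc n] @ map y [Suc k..<Suc n] @ map z [2..<Suc m]) \<subseteq> X"
        "\<forall>i\<in>{1..m}. c i \<in> carrier (free_group A) \<and> c i \<noteq> \<one>\<^bsub>free_group A\<^esub>"
        "Q = concat (map (\<lambda>i. square_word (x i)) [1..<Suc k]) @
            concat (map (\<lambda>i. comm_word (x i) (y i)) [Suc k..<Suc n]) @ coeff_tail m c z"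
        unfolding semistandard_nonorientable_def by blast
      then show thesis by (intro that[of x n y k z m c]) (simp_all add: standard_word_def)
    qed
    let ?C = "coeff_length A Q"
    obtain \<beta> where \<beta>: "ev (sub X \<beta>) Q = 0"
      "\<forall>v\<in>vars X Q. flen (\<beta> v) \<le> (if k = 0 then 3 * ?C else 29 * num_vars X Q * ?C)"
      using standard_bound[OF disj st sol] by blast
    \<comment> \<open>This direction suffices: for \<open>k = 0\<close> the bound
      \<open>3 * ?C\<close> lies below both of the bounds to be shown.\<close>
    have k0: "k = 0" if "orientable X Q"
    proof (rule ccontr)
      assume "k \<noteq> 0"
      then have "[1..<Suc k] = 1 # [2..<Suc k]" by (simp add: upt_rec numeral_2_eq_2)
      then have c2: "count_list Q (x 1, True) \<ge> 2"
        unfolding st(5) standard_word_def by (simp add: square_word_def)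
      have "1 \<in> set [1..<Suc n]" unfolding set_upt using st(4) \<open>k \<noteq> 0\<close> by simp
      then have "x 1 \<in> set (map x [1..<Suc n])" unfolding set_map by (rule imageI)
      then have "x 1 \<in> X" using st(2) unfolding set_append by blast
      then have "count_list Q (x 1, True) \<le> 1" using that unfolding orient oriented_on_def by blast
      with c2 show False by simp
    qed
    have "flen (\<beta> v) \<le> (if orientable X Q then 8 * ?C else 36 * num_vars X Q * ?C)" if v: "v \<in> vars X Q" for v
    proof -
      have "finite (vars X Q)" by (simp add: vars)
      then have "num_vars X Q \<ge> 1"
        using v unfolding num_vars_def by (metis One_nat_def Suc_leI card_gt_0_iff empty_iff)
      then have "1 * ?C \<le> num_vars X Q * ?C" by (rule mult_le_mono1)
      then have "3 * ?C \<le> 36 * num_vars X Q * ?C" "29 * num_vars X Q * ?C \<le> 36 * num_vars X Q * ?C"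
        unfolding mult.assoc by linarith+
      moreover have "flen (\<beta> v) \<le> (if k = 0 then 3 * ?C else 29 * num_vars X Q * ?C)" using \<beta>(2) v by blast
      ultimately show ?thesis using k0 by (auto split: if_splits intro: le_trans)
    qed
    with \<beta>(1) show "\<exists>\<alpha>. solution A X Q \<alpha> \<and> (\<forall>x\<in>vars X Q. length (\<alpha> [(x, True)]) \<le>
      (if orientable X Q then 8 * ?C else 36 * num_vars X Q * ?C))" by (intro pull) auto
  qed
qed

end
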